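(* Let $(\mathfrak{M}, \tau)$ be a tracial von Neumann algebra, let $T, S\in \mathfrak{M}$, and let $C \in \mathfrak{M}_{\mathrm{sa}}$. Then \[ d_H(V_C(T), V_C(S)) \leq \|C\|\,\|T-S\|. \] Thus, for any fixed $C \in \mathfrak{M}_{\mathrm{sa}}$, the map $T \mapsto V_C(T)$ is continuous from $\mathfrak{M}$ (equipped with the operator norm) to the compact, convex subsets of $\mathbb{C}$ equipped with the Hausdorff distance.
   Context: A tracial von Neumann algebra is a pair $(\mathfrak{M},\tau)$ with $\mathfrak{M}$ a von Neumann algebra and $\tau$ a normal, faithful, tracial state on $\mathfrak{M}$. $\mathfrak{M}_{\mathrm{sa}}$ is the set of self-adjoint elements of $\mathfrak{M}$. For a normal operator $N$ and a Borel set $B\subseteq\mathbb{C}$, $1_B(N)$ is the spectral projection of $N$ for $B$. For $T\in\mathfrak{M}_{\mathrm{sa}}$ the eigenvalue function of $T$ is $\lambda_T(s) = \inf\{t\in\mathbb{R} \mid \tau(1_{(t,\infty)}(T))\le s\}$ for $s\in[0,1)$. For real-valued $f,g\in L^\infty[0,1]$, write $g\prec f$ ($f$ majorizes $g$) if $\int_0^t g(x)\,dx\le\int_0^t f(x)\,dx$ for all $t\in[0,1]$ and $\int_0^1 g(x)\,dx=\int_0^1 f(x)\,dx$. For $C\in\mathfrak{M}_{\mathrm{sa}}$ and $T\in\mathfrak{M}$, the $C$-numerical range of $T$ is $V_C(T)=\{\tau(TX)\mid X\in\mathfrak{M}_{\mathrm{sa}},\ \lambda_X\prec\lambda_C\}\subseteq\mathbb{C}$,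 a (nonempty) compact convex set. The Hausdorff distance between compact subsets $X,Y$ of $\mathbb{C}$ is $d_H(X,Y)=\max\{\sup_{x\in X}\mathrm{dist}(x,Y),\ \sup_{y\in Y}\mathrm{dist}(y,X)\}$. *)

theory Defs
  imports "HOL-Analysis.Analysis"
begin

section \<open>Complex Hilbert spaces\<close>

text \<open>
  A complex Hilbert space is given on top of its underlying real Hilbert space, so that norm,
  topology and completeness are those of the library. The inner product is linear in the first
  argument.
\<close>

class complex_hilbert_space = real_inner + complete_space +
  fixes scaleC :: "complex \<Rightarrow> 'a \<Rightarrow> 'a" (infixr \<open>*\<^sub>C\<close> 75)
    and cinner :: "'a \<Rightarrow> 'a \<Rightarrow> complex"
  assumes scaleC_add_right: "a *\<^sub>C (x + y) = a *\<^sub>C x + a *\<^sub>C y"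
    and scaleC_add_left: "(a + b) *\<^sub>C x = a *\<^sub>C x + b *\<^sub>C x"
    and scaleC_scaleC: "a *\<^sub>C b *\<^sub>C x = (a * b) *\<^sub>C x"
    and scaleC_one: "1 *\<^sub>C x = x"
    and scaleR_scaleC: "r *\<^sub>R x = complex_of_real r *\<^sub>C x"
    and cinner_commute: "cinner x y = cnj (cinner y x)"
    and cinner_add_left: "cinner (x + y) z = cinner x z + cinner y z"
    and cinner_scaleC_left: "cinner (a *\<^sub>C x) y = a * cinner x y"
    and inner_eq_Re_cinner: "inner x y = Re (cinner x y)"

instantiation complex :: complex_hilbert_space
begin

definition scaleC_complex :: "complex \<Rightarrow> complex \<Rightarrow> complex"
  where "scaleC_complex a x = a * x"

definition cinner_complex :: "complex \<Rightarrow> complex \<Rightarrow> complex"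
  where "cinner_complex x y = x * cnj y"

instance
  by standard
    (auto simp: scaleC_complex_def cinner_complex_def algebra_simps inner_complex_def
      scaleR_conv_of_real)

end

lemma norm_scaleC: "norm (a *\<^sub>C x) = cmod a * norm (x :: 'a::complex_hilbert_space)"
proof -
  have "cinner (a *\<^sub>C x) (a *\<^sub>C x) = (a * cnj a) * cinner x x"
    by (subst cinner_scaleC_left, subst cinner_commute, subst cinner_scaleC_left)
      (simp add: cinner_commute[of x x, symmetric])
  also have "a * cnj a = complex_of_real ((cmod a)\<^sup>2)"
    using complex_norm_square[of a] by simp
  finally have "inner (a *\<^sub>C x) (a *\<^sub>C x) = (cmod a)\<^sup>2 * inner x x"
    by (simp add: inner_eq_Re_cinner)
  then show ?thesis
    by (simp add: norm_eq_sqrt_inner real_sqrt_mult)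
qed

lemma scaleC_scaleR_commute: "a *\<^sub>C r *\<^sub>R x = r *\<^sub>R a *\<^sub>C (x :: 'a::complex_hilbert_space)"
  by (simp add: scaleR_scaleC scaleC_scaleC mult.commute)

lemma bounded_linear_scaleC: "bounded_linear (\<lambda>x :: 'a::complex_hilbert_space. a *\<^sub>C x)"
  by (rule bounded_linear_intro[where K = "cmod a"])
    (simp_all add: scaleC_add_right scaleC_scaleR_commute norm_scaleC mult.commute)


section \<open>Bounded operators and von Neumann algebras\<close>

text \<open>
  The type \<open>'h \<Rightarrow>\<^sub>L 'h\<close> consists of the real-linear bounded operators; \<open>bounded_operators\<close> carves
  out the complex-linear ones. Composition and the operator norm are the library ones.
\<close>

definition bounded_operators :: "('h::complex_hilbert_space \<Rightarrow>\<^sub>L 'h) set"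
  where "bounded_operators = {T. \<forall>a x. blinfun_apply T (a *\<^sub>C x) = a *\<^sub>C blinfun_apply T x}"

lift_definition scaleC_blinfun ::
    "complex \<Rightarrow> ('h::complex_hilbert_space \<Rightarrow>\<^sub>L 'h) \<Rightarrow> ('h \<Rightarrow>\<^sub>L 'h)"
  is "\<lambda>a T x. a *\<^sub>C T x"
  by (rule bounded_linear_compose[OF bounded_linear_scaleC])

definition cadjoint ::
    "('h::complex_hilbert_space \<Rightarrow>\<^sub>L 'h) \<Rightarrow> ('h \<Rightarrow>\<^sub>L 'h)"
  where "cadjoint T = (THE S. \<forall>x y. cinner (blinfun_apply T x) y = cinner x (blinfun_apply S y))"

definition weak_operator_topology :: "('h::complex_hilbert_space \<Rightarrow>\<^sub>L 'h) topology"
  where "weak_operator_topology =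
    topology_generated_by {{T. cinner (blinfun_apply T x) y \<in> U} | x y U. open U}"

definition ultraweak_topology :: "('h::complex_hilbert_space \<Rightarrow>\<^sub>L 'h) topology"
  where "ultraweak_topology =
    topology_generated_by {{T. (\<Sum>n. cinner (blinfun_apply T (x n)) (y n)) \<in> U} | x y U.
      summable (\<lambda>n::nat. (norm (x n))\<^sup>2) \<and> summable (\<lambda>n. (norm (y n))\<^sup>2) \<and> open U}"

definition von_neumann_algebra :: "('h::complex_hilbert_space \<Rightarrow>\<^sub>L 'h) set \<Rightarrow> bool"
  where "von_neumann_algebra M \<longleftrightarrow>
    M \<subseteq> bounded_operators \<and>
    id_blinfun \<in> M \<and>
    (\<forall>A\<in>M. \<forall>B\<in>M. A + B \<in> M) \<and>
    (\<forall>a. \<forall>A\<in>M. scaleC_blinfun a A \<in> M) \<and>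
    (\<forall>A\<in>M. \<forall>B\<in>M. A o\<^sub>L B \<in> M) \<and>
    (\<forall>A\<in>M. cadjoint A \<in> M) \<and>
    closedin weak_operator_topology M"

definition self_adjoint_part ::
    "('h::complex_hilbert_space \<Rightarrow>\<^sub>L 'h) set \<Rightarrow> ('h \<Rightarrow>\<^sub>L 'h) set"
  where "self_adjoint_part M = {T \<in> M. cadjoint T = T}"

text \<open>
  A state is a positive linear functional of value 1 at the identity, and normality is
  ultraweak continuity. Only the values of \<open>\<tau>\<close> on \<open>M\<close> are constrained.
\<close>

definition tracial_von_neumann_algebra ::
    "('h::complex_hilbert_space \<Rightarrow>\<^sub>L 'h) set \<Rightarrow> (('h \<Rightarrow>\<^sub>L 'h) \<Rightarrow> complex) \<Rightarrow> bool"
  where "tracial_von_neumann_algebra M \<tau> \<longleftrightarrow>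
    von_neumann_algebra M \<and>
    (\<forall>A\<in>M. \<forall>B\<in>M. \<tau> (A + B) = \<tau> A + \<tau> B) \<and>
    (\<forall>a. \<forall>A\<in>M. \<tau> (scaleC_blinfun a A) = a * \<tau> A) \<and>
    (\<forall>A\<in>M. \<tau> (cadjoint A o\<^sub>L A) \<in> \<real> \<and> 0 \<le> Re (\<tau> (cadjoint A o\<^sub>L A))) \<and>
    \<tau> id_blinfun = 1 \<and>
    continuous_map (subtopology ultraweak_topology M) euclidean \<tau> \<and>
    (\<forall>A\<in>M. \<tau> (cadjoint A o\<^sub>L A) = 0 \<longrightarrow> A = 0) \<and>
    (\<forall>A\<in>M. \<forall>B\<in>M. \<tau> (A o\<^sub>L B) = \<tau> (B o\<^sub>L A))"


section \<open>Spectral projections\<close>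

definition spectral_measure :: "(complex set \<Rightarrow> ('h::complex_hilbert_space \<Rightarrow>\<^sub>L 'h)) \<Rightarrow> bool"
  where "spectral_measure E \<longleftrightarrow>
    (\<forall>B\<in>sets borel. E B \<in> bounded_operators \<and> E B o\<^sub>L E B = E B \<and> cadjoint (E B) = E B) \<and>
    E UNIV = id_blinfun \<and>
    (\<forall>A\<in>sets borel. \<forall>B\<in>sets borel. E (A \<inter> B) = E A o\<^sub>L E B) \<and>
    (\<forall>B :: nat \<Rightarrow> complex set. range B \<subseteq> sets borel \<longrightarrow> disjoint_family B \<longrightarrow>
      (\<forall>x. (\<lambda>n. E (B n) x) sums E (\<Union>n. B n) x))"

text \<open>The scalar measure \<open>B \<mapsto> \<langle>E(B)x, x\<rangle>\<close>.\<close>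

definition scalar_spectral_measure ::
    "(complex set \<Rightarrow> ('h::complex_hilbert_space \<Rightarrow>\<^sub>L 'h)) \<Rightarrow> 'h \<Rightarrow> complex measure"
  where "scalar_spectral_measure E x =
    measure_of UNIV (sets borel) (\<lambda>B. ennreal (Re (cinner (E B x) x)))"

text \<open>
  \<open>E\<close> is compactly supported and \<open>N = \<integral> z dE(z)\<close>; by polarization the integral is determined by
  its diagonal matrix coefficients. By the spectral theorem a bounded normal operator has exactly
  one such \<open>E\<close>, up to the irrelevant values of \<open>E\<close> at sets that are not Borel.
\<close>

definition is_spectral_measure_of ::
    "(complex set \<Rightarrow> ('h::complex_hilbert_space \<Rightarrow>\<^sub>L 'h)) \<Rightarrow> ('h \<Rightarrow>\<^sub>L 'h) \<Rightarrow> bool"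
  where "is_spectral_measure_of E N \<longleftrightarrow>
    spectral_measure E \<and>
    (\<exists>r. E (cball 0 r) = id_blinfun) \<and>
    (\<forall>x. cinner (N x) x = (LINT z|scalar_spectral_measure E x. z))"

definition spectral_projection ::
    "complex set \<Rightarrow> ('h::complex_hilbert_space \<Rightarrow>\<^sub>L 'h) \<Rightarrow> ('h \<Rightarrow>\<^sub>L 'h)"
  where "spectral_projection B N = (THE P. \<exists>E. is_spectral_measure_of E N \<and> P = E B)"


section \<open>Eigenvalue functions, majorization and the C-numerical range\<close>

definition eigenvalue_function ::
    "(('h::complex_hilbert_space \<Rightarrow>\<^sub>L 'h) \<Rightarrow> complex) \<Rightarrow> ('h \<Rightarrow>\<^sub>L 'h) \<Rightarrow> real \<Rightarrow> real"
  where "eigenvalue_function \<tau> T s =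
    Inf {t. Re (\<tau> (spectral_projection (complex_of_real ` {t<..}) T)) \<le> s}"

text \<open>\<open>g \<prec> f\<close>, to be used for bounded measurable functions on \<open>[0,1]\<close> only.\<close>

definition majorized_by :: "(real \<Rightarrow> real) \<Rightarrow> (real \<Rightarrow> real) \<Rightarrow> bool"
  where "majorized_by g f \<longleftrightarrow>
    (\<forall>t\<in>{0..1}. (LBINT x:{0..t}. g x) \<le> (LBINT x:{0..t}. f x)) \<and>
    (LBINT x:{0..1}. g x) = (LBINT x:{0..1}. f x)"

definition C_numerical_range ::
    "('h::complex_hilbert_space \<Rightarrow>\<^sub>L 'h) set \<Rightarrow> (('h \<Rightarrow>\<^sub>L 'h) \<Rightarrow> complex) \<Rightarrow>
      ('h \<Rightarrow>\<^sub>L 'h) \<Rightarrow> ('h \<Rightarrow>\<^sub>L 'h) \<Rightarrow> complex set"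
  where "C_numerical_range M \<tau> C T =
    {\<tau> (T o\<^sub>L X) | X. X \<in> self_adjoint_part M \<and>
      majorized_by (eigenvalue_function \<tau> X) (eigenvalue_function \<tau> C)}"


section \<open>The Hausdorff metric\<close>

definition hausdorff_distance :: "'a::metric_space set \<Rightarrow> 'a set \<Rightarrow> real"
  where "hausdorff_distance X Y = max (SUP x\<in>X. infdist x Y) (SUP y\<in>Y. infdist y X)"

definition compact_convex_sets :: "complex set set"
  where "compact_convex_sets = {K. K \<noteq> {} \<and> compact K \<and> convex K}"

text \<open>
  The locale \<open>Metric_space\<close> requires symmetry and nonnegativity off the carrier too, hence the
  cut-off: suprema of empty or unbounded sets are unspecified.
\<close>

definition compact_convex_distance :: "complex set \<Rightarrow> complex set \<Rightarrow> real"
  where "compact_convex_distance X Y =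
    (if X \<in> compact_convex_sets \<and> Y \<in> compact_convex_sets then hausdorff_distance X Y else 0)"

lemma bdd_above_infdist:
  fixes X Y :: "complex set"
  assumes "compact X"
  shows "bdd_above ((\<lambda>x. infdist x Y) ` X)"
  by (intro bounded_imp_bdd_above compact_imp_bounded compact_continuous_image assms
      continuous_intros)

lemma hausdorff_distance_leI:
  assumes "X \<noteq> {}" "Y \<noteq> {}"
    and "\<And>x. x \<in> X \<Longrightarrow> infdist x Y \<le> r" "\<And>y. y \<in> Y \<Longrightarrow> infdist y X \<le> r"
  shows "hausdorff_distance X Y \<le> r"
  unfolding hausdorff_distance_def using assms by (auto intro!: cSUP_least)

lemma infdist_le_hausdorff_distance:
  fixes X Y :: "complex set"
  assumes "compact X" "x \<in> X"
  shows "infdist x Y \<le> hausdorff_distance X Y"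
  unfolding hausdorff_distance_def
  using cSUP_upper[OF assms(2) bdd_above_infdist[OF assms(1), of Y]] by linarith

lemma hausdorff_distance_commute: "hausdorff_distance X Y = hausdorff_distance Y X"
  by (simp add: hausdorff_distance_def max.commute)

lemma hausdorff_distance_nonneg:
  fixes X Y :: "complex set"
  assumes "compact X" "X \<noteq> {}"
  shows "0 \<le> hausdorff_distance X Y"
  using assms infdist_le_hausdorff_distance infdist_nonneg order_trans by (metis ex_in_conv)

lemma infdist_triangle_hausdorff:
  fixes X Y Z :: "complex set"
  assumes "compact X" "compact Y" "Y \<noteq> {}" "x \<in> X"
  shows "infdist x Z \<le> hausdorff_distance X Y + hausdorff_distance Y Z"
proof -
  obtain y where y: "y \<in> Y" "infdist x Y = dist x y"
    using infdist_attains_inf[OF compact_imp_closed[OF assms(2)] assms(3)] by metis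
  have "infdist x Z \<le> infdist y Z + dist x y"
    by (rule infdist_triangle)
  then show ?thesis
    using infdist_le_hausdorff_distance[OF assms(1,4), of Y]
      infdist_le_hausdorff_distance[OF assms(2) y(1), of Z] y(2) by linarith
qed

lemma Metric_space_compact_convex: "Metric_space compact_convex_sets compact_convex_distance"
proof
  show "0 \<le> compact_convex_distance X Y" for X Y
    by (auto simp: compact_convex_distance_def compact_convex_sets_def hausdorff_distance_nonneg)
  show "compact_convex_distance X Y = compact_convex_distance Y X" for X Y
    by (simp add: compact_convex_distance_def hausdorff_distance_commute)
  show "compact_convex_distance X Y = 0 \<longleftrightarrow> X = Y"
    if "X \<in> compact_convex_sets" "Y \<in> compact_convex_sets" for X Y
  proof
    assume 0: "compact_convex_distance X Y = 0"
    have sub: "A \<subseteq> B" if "A \<in> compact_convex_sets" "B \<in> compact_convex_sets"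
      and "hausdorff_distance A B = 0" for A B
    proof
      fix x assume "x \<in> A"
      then have "infdist x B \<le> 0"
        using that infdist_le_hausdorff_distance[of A x B] by (simp add: compact_convex_sets_def)
      then show "x \<in> B"
        using that in_closed_iff_infdist_zero[of B x] infdist_nonneg[of x B]
        by (simp add: compact_convex_sets_def compact_imp_closed)
    qed
    show "X = Y"
      using sub[of X Y] sub[of Y X] 0 that
      by (simp add: compact_convex_distance_def hausdorff_distance_commute subset_antisym)
  next
    assume "X = Y"
    then show "compact_convex_distance X Y = 0"
      using that
      by (auto simp: compact_convex_distance_def compact_convex_sets_def
          intro!: antisym hausdorff_distance_leI hausdorff_distance_nonneg)
  qed
  show "compact_convex_distance X Z \<le> compact_convex_distance X Y + compact_convex_distance Y Z"
    if "X \<in> compact_convex_sets" "Y \<in> compact_convex_sets" "Z \<in> compact_convex_sets" for X Y Z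
  proof -
    have "hausdorff_distance X Z \<le> hausdorff_distance X Y + hausdorff_distance Y Z"
    proof (rule hausdorff_distance_leI)
      show "infdist z X \<le> hausdorff_distance X Y + hausdorff_distance Y Z" if "z \<in> Z" for z
        using infdist_triangle_hausdorff[of Z Y z X] that
          \<open>Y \<in> compact_convex_sets\<close> \<open>Z \<in> compact_convex_sets\<close>
        by (simp add: compact_convex_sets_def hausdorff_distance_commute add.commute)
    qed (use that infdist_triangle_hausdorff[of X Y] in \<open>auto simp: compact_convex_sets_def\<close>)
    then show ?thesis
      using that by (simp add: compact_convex_distance_def)
  qed
qed

definition hausdorff_topology :: "complex set topology"
  where "hausdorff_topology = Metric_space.mtopology compact_convex_sets compact_convex_distance"

end

theory Submission
  imports Defs "HOL-Probability.Distribution_Functions"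
begin

text \<open>
  The set \<open>V\<^sub>C(T)\<close> is the image of the majorized set \<open>\<O>(C) = {X self-adjoint. \<lambda>\<^sub>X \<prec> \<lambda>\<^sub>C}\<close> under
  \<open>X \<mapsto> \<tau>(T X)\<close>, so everything follows from a description of \<open>\<O>(C)\<close> that is free of eigenvalue
  functions. For self-adjoint \<open>X\<close> consider the excess
  \<open>e\<^sub>X(c) = \<tau>((X - c) 1\<^bsub>(c,\<infinity>)\<^esub>(X)) = \<tau>((X - c)\<^sup>+)\<close>. It is the largest value of \<open>\<tau>((X - c) P)\<close> over
  all \<open>P\<close> in the algebra with \<open>0 \<le> P \<le> 1\<close> (\<open>excess_max\<close>). Inserting \<open>P = 1\<^bsub>(d,\<infinity>)\<^esub>(X)\<close> shows that
  \<open>e\<^sub>X(c) - e\<^sub>X(d)\<close> lies between \<open>(d - c) D(d)\<close> and \<open>(d - c) D(c)\<close>, where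
  \<open>D(c) = \<tau>(1\<^bsub>(c,\<infinity>)\<^esub>(X))\<close>. The function \<open>c \<mapsto> \<integral>\<^sub>0\<^sup>1 (\<lambda>\<^sub>X(s) - c)\<^sup>+ ds\<close> obeys the same two bounds,
  because \<open>\<lambda>\<^sub>X\<close> is the generalized inverse of \<open>D\<close>, and both functions vanish for large \<open>c\<close>; hence
  they agree (\<open>excess_eq_excess_integral\<close>). By the Hardy-Littlewood-Polya argument, \<open>\<lambda>\<^sub>X \<prec> \<lambda>\<^sub>C\<close>
  then means \<open>e\<^sub>X \<le> e\<^sub>C\<close> pointwise together with \<open>\<tau>(X) = \<tau>(C)\<close> (\<open>majorized_iff\<close>).

  Two consequences carry the proof. First, faithfulness of \<open>\<tau>\<close> turns \<open>e\<^sub>X \<le> e\<^sub>C\<close> and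
  \<open>\<tau>(X) = \<tau>(C)\<close> into \<open>\<parallel>X\<parallel> \<le> \<parallel>C\<parallel>\<close> (\<open>norm_le_if_majorized\<close>). Since the same \<open>X\<close> serves as a
  witness for \<open>T\<close> and for \<open>S\<close>, and \<open>|\<tau>((T - S) X)| \<le> \<parallel>T - S\<parallel> \<parallel>X\<parallel>\<close>, the bound on the Hausdorff
  distance follows. Second, \<open>\<O>(C)\<close> is the part of a norm ball of \<open>M\<^sub>s\<^sub>a\<close> that is cut out by
  \<open>\<tau>(X) = \<tau>(C)\<close> and the linear inequalities \<open>\<tau>((X - c) P) \<le> e\<^sub>C(c)\<close> (\<open>majorized_set_iff\<close>). It is
  therefore convex and closed in the weak operator topology, hence compact, and \<open>\<tau>\<close> is continuous
  there; so \<open>V\<^sub>C(T)\<close> really is a point of the space of compact convex sets, and the Lipschitz bound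
  gives continuity.

  Spectral projections are defined by unique existence of a spectral measure, so both existence and
  uniqueness enter. Existence starts from the projections \<open>1\<^bsub>(c,\<infinity>)\<^esub>(X)\<close>, obtained from \<open>|X - c|\<close>
  inside the strongly closed algebra generated by \<open>X\<close> (\<open>spectral_cut_exists\<close>); the scalar measures
  \<open>B \<mapsto> \<langle>1\<^sub>B(X) x, x\<rangle>\<close> are then Lebesgue-Stieltjes measures, and an induction over the Borel sets
  produces all spectral projections (\<open>spectral_projection_exists\<close>). For uniqueness,
  \<open>1\<^bsub>(c,\<infinity>)\<^esub>(X)\<close> is the only projection commuting with \<open>X\<close> that splits the space into a part where
  \<open>X > c\<close> and a part where \<open>X \<le> c\<close> (\<open>spectral_cut_unique\<close>), and every spectral measure of \<open>X\<close>
  provides such a projection (\<open>spectral_measure_of_half_line\<close>).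
\<close>

instance complex_hilbert_space \<subseteq> banach ..

section \<open>Symmetric operators and the strongly closed algebra of an operator\<close>

definition symmetric_op :: "('a::real_inner \<Rightarrow>\<^sub>L 'a) \<Rightarrow> bool"
  where "symmetric_op T \<longleftrightarrow> (\<forall>x y. T x \<bullet> y = x \<bullet> T y)"

definition positive_op :: "('a::real_inner \<Rightarrow>\<^sub>L 'a) \<Rightarrow> bool"
  where "positive_op T \<longleftrightarrow> symmetric_op T \<and> (\<forall>x. 0 \<le> T x \<bullet> x)"

text \<open>
  Strong limits of sequences, rather than weak limits of nets, suffice for all operators constructed
  from \<open>X\<close> below, and they make commutation and symmetry provable by rule induction.
\<close>

inductive_set strong_algebra :: "('a::real_inner \<Rightarrow>\<^sub>L 'a) \<Rightarrow> ('a \<Rightarrow>\<^sub>L 'a) set" for X where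
  one: "id_blinfun \<in> strong_algebra X"
| gen: "X \<in> strong_algebra X"
| add: "\<lbrakk>S \<in> strong_algebra X; T \<in> strong_algebra X\<rbrakk> \<Longrightarrow> S + T \<in> strong_algebra X"
| scale: "T \<in> strong_algebra X \<Longrightarrow> r *\<^sub>R T \<in> strong_algebra X"
| comp: "\<lbrakk>S \<in> strong_algebra X; T \<in> strong_algebra X\<rbrakk> \<Longrightarrow> S o\<^sub>L T \<in> strong_algebra X"
| limit: "\<lbrakk>\<And>n::nat. U n \<in> strong_algebra X; \<And>x. (\<lambda>n. blinfun_apply (U n) x) \<longlonglongrightarrow> blinfun_apply T x\<rbrakk> \<Longrightarrow> T \<in> strong_algebra X"

lemma strong_algebra_diff:
  assumes "S \<in> strong_algebra X" "T \<in> strong_algebra X"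
  shows "S - T \<in> strong_algebra X"
  using strong_algebra.add[OF assms(1) strong_algebra.scale[OF assms(2), of "-1"]] by simp

lemmas strong_algebra_intros = strong_algebra.one strong_algebra.gen strong_algebra.add
  strong_algebra.scale strong_algebra.comp strong_algebra_diff

lemma strong_algebra_zero: "0 \<in> strong_algebra X"
  using strong_algebra.scale[OF strong_algebra.one, of 0] by simp

text \<open>
  \<open>Y\<close> is a bounded linear map on vectors instead of an operator of the algebra, so that scalar
  multiplication by \<open>\<i>\<close> can be used for \<open>Y\<close>.
\<close>

lemma strong_algebra_commute:
  assumes "T \<in> strong_algebra X" and "bounded_linear Y" and "\<And>x. Y (X x) = X (Y x)"
  shows "Y (T x) = T (Y x)"
  using assms(1)
proof (induction arbitrary: x)
  case (limit U T)
  have "(\<lambda>n. Y (U n x)) \<longlonglongrightarrow> Y (T x)"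
    using limit(2) by (rule bounded_linear.tendsto[OF assms(2)])
  moreover have "(\<lambda>n. Y (U n x)) \<longlonglongrightarrow> T (Y x)"
    using limit(2)[of "Y x"] limit(3) by simp
  ultimately show ?case by (rule LIMSEQ_unique)
qed (simp_all add: assms blinfun.add_left blinfun.scaleR_left bounded_linear.linear linear_add linear_scale)

lemma strong_algebra_comm:
  assumes "S \<in> strong_algebra X" "T \<in> strong_algebra X"
  shows "S (T x) = T (S x)"
  by (rule strong_algebra_commute[OF assms(2) blinfun.bounded_linear_right])
    (rule strong_algebra_commute[OF assms(1) blinfun.bounded_linear_right, symmetric], simp)

lemma strong_algebra_symmetric:
  assumes "symmetric_op X" "T \<in> strong_algebra X"
  shows "symmetric_op T"
  using assms(2)
proof induction
  case gen then show ?case by (rule assms(1))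
next
  case (comp S T)
  then show ?case
    using strong_algebra_comm[OF comp(1,2)] by (simp add: symmetric_op_def)
next
  case (limit U T)
  show ?case unfolding symmetric_op_def
  proof (intro allI)
    fix x y
    have "(\<lambda>n. U n x \<bullet> y) \<longlonglongrightarrow> T x \<bullet> y" by (intro tendsto_intros limit)
    moreover have "(\<lambda>n. x \<bullet> U n y) \<longlonglongrightarrow> x \<bullet> T y" by (intro tendsto_intros limit)
    ultimately show "T x \<bullet> y = x \<bullet> T y"
      using limit(3) LIMSEQ_unique by (simp add: symmetric_op_def)
  qed
qed (simp_all add: symmetric_op_def blinfun.add_left blinfun.scaleR_left inner_add_left inner_add_right)

section \<open>Square roots and kernel projections\<close>

text \<open>
  Polarization bounds \<open>4 \<langle>T x, v\<rangle>\<close> by \<open>2 r (\<parallel>x\<parallel>\<^sup>2 + \<parallel>v\<parallel>\<^sup>2)\<close>; the best choice of \<open>v\<close> is the multiple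
  of \<open>T x\<close> whose norm is \<open>\<parallel>x\<parallel>\<close>.
\<close>

lemma norm_symmetric_le:
  assumes "symmetric_op T" "0 \<le> r" "\<And>x. \<bar>T x \<bullet> x\<bar> \<le> r * (x \<bullet> x)"
  shows "norm T \<le> r"
proof (rule norm_blinfun_bound[OF assms(2)])
  fix x
  have sym: "T u \<bullet> v = T v \<bullet> u" for u v
    using assms(1) by (simp add: symmetric_op_def inner_commute)
  have bd: "4 * (T u \<bullet> v) \<le> 2 * r * (u \<bullet> u + v \<bullet> v)" for u v
  proof -
    have "4 * (T u \<bullet> v) = T (u + v) \<bullet> (u + v) - T (u - v) \<bullet> (u - v)"
      using sym[of u v] by (simp add: blinfun.bilinear_simps algebra_simps inner_add_left inner_add_right inner_diff_left inner_diff_right)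
    also have "\<dots> \<le> r * ((u + v) \<bullet> (u + v)) + r * ((u - v) \<bullet> (u - v))"
      using assms(3)[of "u+v"] assms(3)[of "u-v"] by linarith
    also have "\<dots> = 2 * r * (u \<bullet> u + v \<bullet> v)"
      by (simp add: algebra_simps inner_add_left inner_add_right inner_diff_left inner_diff_right inner_commute)
    finally show ?thesis .
  qed
  show "norm (T x) \<le> r * norm x"
  proof (cases "T x = 0 \<or> x = 0")
    case True then show ?thesis using assms(2) by auto
  next
    case False
    define v where "v = (norm x / norm (T x)) *\<^sub>R T x"
    have "T x \<bullet> v = norm x * norm (T x)" "v \<bullet> v = norm x ^ 2"
      using False by (simp_all add: v_def power2_eq_square dot_square_norm)
    then have "norm x * norm (T x) \<le> norm x * (r * norm x)"
      using bd[of x v] by (simp add: power2_eq_square dot_square_norm algebra_simps)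
    then show ?thesis using False by simp
  qed
qed

text \<open>
  After scaling, \<open>K = 1 - D\<close> with \<open>\<parallel>D\<parallel> \<le> 1\<close>, and the root is \<open>1 - Z\<close> where \<open>2 Z = D + Z\<^sup>2\<close>. The
  fixed point \<open>Z\<close> is the limit of the iteration \<open>Y \<mapsto> (D + Y\<^sup>2) / 2\<close> started at \<open>0\<close>. It converges in
  norm because its increments are dominated by those of the scalar iteration for \<open>D = 1\<close>, which
  increases and stays below \<open>1\<close>.
\<close>

lemma positive_op_sqrt:
  fixes X :: "'a::{real_inner,banach} \<Rightarrow>\<^sub>L 'a"
  assumes "symmetric_op X" "K \<in> strong_algebra X" "positive_op K"
  obtains R where "R \<in> strong_algebra X" "positive_op R" "\<And>x. R (R x) = K x"
proof -
  define s where "s = norm K + 1"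
  have s: "s > 0" "norm K \<le> s" unfolding s_def using norm_ge_zero[of K] by linarith+
  define D where "D = id_blinfun - (1/s) *\<^sub>R K"
  have DW: "D \<in> strong_algebra X"
    unfolding D_def by (intro strong_algebra_intros assms)
  have Dapp: "D x = x - (1/s) *\<^sub>R K x" for x
    by (simp add: D_def blinfun.bilinear_simps)
  have nD: "norm D \<le> 1"
  proof (rule norm_symmetric_le)
    show "symmetric_op D" using strong_algebra_symmetric[OF assms(1) DW] .
    fix x
    have "0 \<le> K x \<bullet> x" using assms(3) by (simp add: positive_op_def)
    moreover have "K x \<bullet> x \<le> s * (x \<bullet> x)"
    proof -
      have "K x \<bullet> x \<le> norm (K x) * norm x" by (rule norm_cauchy_schwarz)
      also have "\<dots> \<le> (norm K * norm x) * norm x"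
        by (intro mult_right_mono norm_blinfun) auto
      also have "\<dots> \<le> (s * norm x) * norm x"
        by (intro mult_right_mono s) auto
      finally show ?thesis by (simp add: power2_norm_eq_inner[symmetric] power2_eq_square)
    qed
    ultimately show "\<bar>D x \<bullet> x\<bar> \<le> 1 * (x \<bullet> x)"
      using s by (simp add: Dapp inner_diff_left divide_simps mult.commute)
  qed simp
  define Y where "Y = rec_nat (0::'a \<Rightarrow>\<^sub>L 'a) (\<lambda>_ Z. (1/2) *\<^sub>R (D + (Z o\<^sub>L Z)))"
  define y where "y = rec_nat (0::real) (\<lambda>_ z. (1/2) * (1 + z * z))"
  have Y0: "Y 0 = 0" and YS: "\<And>n. Y (Suc n) = (1/2) *\<^sub>R (D + (Y n o\<^sub>L Y n))"
    by (simp_all add: Y_def)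
  have y0: "y 0 = 0" and yS: "\<And>n. y (Suc n) = (1/2) * (1 + y n * y n)"
    by (simp_all add: y_def)
  have y01: "0 \<le> y n \<and> y n \<le> 1" for n
  proof (induction n)
    case (Suc n)
    then have "y n * y n \<le> 1 * 1" by (intro mult_mono) auto
    then show ?case by (simp add: yS)
  qed (simp add: y0)
  have Yy: "norm (Y n) \<le> y n" for n
  proof (induction n)
    case (Suc n)
    have "norm (Y n o\<^sub>L Y n) \<le> y n * y n"
      by (rule order_trans[OF norm_blinfun_compose]) (intro mult_mono Suc norm_ge_zero y01[THEN conjunct1])
    then have "norm (D + (Y n o\<^sub>L Y n)) \<le> 1 + y n * y n"
      by (rule norm_triangle_le[OF add_mono[OF nD]])
    then show ?case by (simp add: YS yS)
  qed (simp add: Y0 y0)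
  have Ydiff: "norm (Y (Suc n) - Y n) \<le> y (Suc n) - y n" for n
  proof (induction n)
    case 0 then show ?case using Yy[of "Suc 0"] by (simp add: Y0 y0)
  next
    case (Suc n)
    have eq: "Y (Suc (Suc n)) - Y (Suc n)
        = (1/2) *\<^sub>R ((Y (Suc n) o\<^sub>L (Y (Suc n) - Y n)) + ((Y (Suc n) - Y n) o\<^sub>L Y n))"
      unfolding YS[of "Suc n"] YS[of n]
      by (rule blinfun_eqI) (simp add: blinfun.bilinear_simps algebra_simps)
    have n1: "norm (Y (Suc n) o\<^sub>L (Y (Suc n) - Y n)) \<le> y (Suc n) * (y (Suc n) - y n)"
      by (rule order_trans[OF norm_blinfun_compose]) (intro mult_mono Suc Yy norm_ge_zero y01[THEN conjunct1])
    have n2: "norm ((Y (Suc n) - Y n) o\<^sub>L Y n) \<le> (y (Suc n) - y n) * y n"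
      by (rule order_trans[OF norm_blinfun_compose])
        (intro mult_mono Suc Yy norm_ge_zero y01[THEN conjunct1] order_trans[OF norm_ge_zero Suc])
    have "norm (Y (Suc (Suc n)) - Y (Suc n)) \<le> (1/2) * (y (Suc n) * (y (Suc n) - y n) + (y (Suc n) - y n) * y n)"
      unfolding eq using norm_triangle_le[OF add_mono[OF n1 n2]] by simp
    also have "\<dots> = y (Suc (Suc n)) - y (Suc n)"
      using yS[of "Suc n"] yS[of n] by (simp add: algebra_simps)
    finally show ?case .
  qed
  have yinc: "y n \<le> y (Suc n)" for n
    using order_trans[OF norm_ge_zero Ydiff[of n]] by simp
  have "convergent y"
    by (rule Bseq_mono_convergent)
      (use y01 in \<open>auto intro!: BseqI'[of _ 1] lift_Suc_mono_le[of y, OF yinc]\<close>)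
  then have "summable (\<lambda>n. y (Suc n) - y n)"
    by (auto simp: convergent_def intro: sums_summable telescope_sums)
  then have "summable (\<lambda>n. Y (Suc n) - Y n)"
    by (rule summable_comparison_test'[where N=0]) (use Ydiff in auto)
  then have "convergent (\<lambda>n. Y n - Y 0)"
    unfolding summable_iff_convergent by (simp add: sum_lessThan_telescope)
  then obtain Z where Z: "Y \<longlonglongrightarrow> Z" by (auto simp: convergent_def Y0)
  have YW: "Y n \<in> strong_algebra X" for n
    by (induction n) (auto simp: Y0 YS intro!: strong_algebra_zero strong_algebra_intros DW)
  have ZW: "Z \<in> strong_algebra X"
    by (rule strong_algebra.limit[of Y, OF YW]) (intro tendsto_intros Z)
  have nZ: "norm Z \<le> 1"
    by (rule LIMSEQ_le_const2[OF tendsto_norm[OF Z]]) (meson Yy y01 order_trans)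
  have "(\<lambda>n. Y (Suc n)) \<longlonglongrightarrow> (1/2) *\<^sub>R (D + (Z o\<^sub>L Z))"
    unfolding YS by (intro tendsto_intros bounded_bilinear.tendsto[OF bounded_bilinear_blinfun_compose] Z)
  then have Zeq: "Z = (1/2) *\<^sub>R (D + (Z o\<^sub>L Z))"
    using LIMSEQ_unique[OF LIMSEQ_Suc[OF Z]] by blast
  have Zapp: "2 *\<^sub>R Z x = D x + Z (Z x)" for x
    by (subst Zeq) (simp add: blinfun.bilinear_simps)
  define R where "R = sqrt s *\<^sub>R (id_blinfun - Z)"
  have RW: "R \<in> strong_algebra X"
    unfolding R_def by (intro strong_algebra_intros ZW)
  have Rapp: "R x = sqrt s *\<^sub>R (x - Z x)" for x by (simp add: R_def blinfun.bilinear_simps)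
  show ?thesis
  proof
    show "R \<in> strong_algebra X" by fact
    have "Z x \<bullet> x \<le> x \<bullet> x" for x
    proof -
      have "Z x \<bullet> x \<le> norm (Z x) * norm x" by (rule norm_cauchy_schwarz)
      also have "\<dots> \<le> (1 * norm x) * norm x"
        by (intro mult_right_mono order_trans[OF norm_blinfun] nZ) auto
      finally show ?thesis by (simp add: power2_norm_eq_inner[symmetric] power2_eq_square)
    qed
    then show "positive_op R"
      using strong_algebra_symmetric[OF assms(1) RW] s
      by (simp add: positive_op_def Rapp inner_diff_left)
    show "R (R x) = K x" for x
    proof -
      have "R (R x) = s *\<^sub>R (x - 2 *\<^sub>R Z x + Z (Z x))"
        using s by (simp add: Rapp blinfun.bilinear_simps algebra_simps scaleR_2)
      also have "\<dots> = s *\<^sub>R (x - D x)" by (simp add: Zapp)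
      also have "\<dots> = K x" using s by (simp add: Dapp)
      finally show ?thesis .
    qed
  qed
qed

lemma strong_limit_of_contractions:
  fixes X :: "'a::{real_inner,banach} \<Rightarrow>\<^sub>L 'a"
  assumes "\<And>n. U n \<in> strong_algebra X" and "\<And>n x. norm (U n x) \<le> norm x"
    and "\<And>x. convergent (\<lambda>n::nat. U n x)"
  obtains Q where "Q \<in> strong_algebra X" "\<And>x. (\<lambda>n. U n x) \<longlonglongrightarrow> Q x"
proof -
  define q where "q = (\<lambda>x. lim (\<lambda>n. U n x))"
  have q: "(\<lambda>n. U n x) \<longlonglongrightarrow> q x" for x
    using assms(3)[of x] by (simp add: q_def convergent_LIMSEQ_iff)
  have "bounded_linear q"
  proof (rule bounded_linear_intro[where K=1])
    fix x y r
    show "q (x + y) = q x + q y"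
      by (rule LIMSEQ_unique[OF q]) (simp add: blinfun.add_right tendsto_add q)
    show "q (r *\<^sub>R x) = r *\<^sub>R q x"
      by (rule LIMSEQ_unique[OF q]) (simp add: blinfun.scaleR_right tendsto_scaleR q)
    show "norm (q x) \<le> norm x * 1"
      by (rule LIMSEQ_le_const2[OF tendsto_norm[OF q]]) (use assms(2) in auto)
  qed
  then have Q: "Blinfun q x = q x" for x by (simp add: bounded_linear_Blinfun_apply)
  show ?thesis
    by (rule that[of "Blinfun q"], rule strong_algebra.limit[where U = U]) (simp_all add: Q q assms(1))
qed

text \<open>
  With \<open>D = 1 - K\<^sup>2 / b\<close> for large \<open>b\<close>, the powers \<open>D\<^sup>n\<close> are positive contractions fixing exactly the
  kernel of \<open>K\<close>, and they converge strongly to the projection onto it: the sequence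
  \<open>a\<^sub>n = \<langle>D\<^sup>n x, x\<rangle>\<close> decreases, and \<open>\<parallel>D\<^sup>m x - D\<^sup>n x\<parallel>\<^sup>2 = a\<^bsub>2m\<^esub> - 2 a\<^bsub>m+n\<^esub> + a\<^bsub>2n\<^esub>\<close>.
\<close>

lemma kernel_projection:
  fixes X :: "'a::{real_inner,banach} \<Rightarrow>\<^sub>L 'a"
  assumes "symmetric_op X" "K \<in> strong_algebra X"
  obtains Q where "Q \<in> strong_algebra X" "\<And>x. K x = 0 \<longleftrightarrow> Q x = x" "\<And>x. Q (Q x) = Q x"
proof -
  define b where "b = norm K ^ 2 + 1"
  have b: "b > 0" "norm K ^ 2 \<le> b" unfolding b_def using zero_le_power2[of "norm K"] by linarith+
  define D where "D = id_blinfun - (1/b) *\<^sub>R (K o\<^sub>L K)"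
  have DW: "D \<in> strong_algebra X"
    unfolding D_def by (intro strong_algebra_intros assms)
  have Dapp: "D x = x - (1/b) *\<^sub>R K (K x)" for x
    by (simp add: D_def blinfun.bilinear_simps)
  have Ksym: "K x \<bullet> y = x \<bullet> K y" for x y
    using strong_algebra_symmetric[OF assms] by (simp add: symmetric_op_def)
  have Dform: "0 \<le> D x \<bullet> x" "D x \<bullet> x \<le> x \<bullet> x" for x
  proof -
    have eq: "D x \<bullet> x = x \<bullet> x - (1/b) * (K x \<bullet> K x)"
      by (simp add: Dapp inner_diff_left Ksym)
    have "norm (K x) ^ 2 \<le> (norm K * norm x) ^ 2"
      by (intro power_mono norm_blinfun) auto
    also have "\<dots> \<le> b * norm x ^ 2"
      unfolding power_mult_distrib by (intro mult_right_mono b) auto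
    finally have "K x \<bullet> K x \<le> b * (x \<bullet> x)" by (simp add: power2_norm_eq_inner)
    then show "0 \<le> D x \<bullet> x" using b by (simp add: eq divide_simps mult.commute)
    show "D x \<bullet> x \<le> x \<bullet> x" using b by (simp add: eq)
  qed
  have Dsym: "D x \<bullet> y = x \<bullet> D y" for x y
    using strong_algebra_symmetric[OF assms(1) DW] by (simp add: symmetric_op_def)
  have nD: "norm D \<le> 1"
    using strong_algebra_symmetric[OF assms(1) DW] Dform by (intro norm_symmetric_le) auto
  define P where "P = rec_nat id_blinfun (\<lambda>_ Z. D o\<^sub>L Z)"
  have P0: "P 0 x = x" and PS: "P (Suc n) x = D (P n x)" for n x by (simp_all add: P_def)
  have PW: "P n \<in> strong_algebra X" for n
    by (induction n) (auto simp: P_def intro!: strong_algebra_intros DW)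
  have Padd: "P (m + n) x = P m (P n x)" for m n x
    by (induction m) (simp_all add: P0 PS)
  have Psym: "P n x \<bullet> y = x \<bullet> P n y" for n x y
    using strong_algebra_symmetric[OF assms(1) PW] by (simp add: symmetric_op_def)
  have Ppos: "0 \<le> P n x \<bullet> x" for n x
  proof (cases "even n")
    case True
    then obtain k where "n = k + k" by (metis evenE mult_2)
    then show ?thesis by (simp add: Padd Psym[of k "P k x"])
  next
    case False
    then obtain k where "n = k + Suc k" by (metis add_Suc_right mult_2 oddE Suc_eq_plus1)
    then have "P n x \<bullet> x = P k (D (P k x)) \<bullet> x" by (simp only: Padd PS)
    also have "\<dots> = D (P k x) \<bullet> P k x" by (rule Psym)
    finally show ?thesis using Dform by simp
  qed
  have PK: "P n (K x) = K (P n x)" for n x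
    by (rule strong_algebra_comm[OF PW assms(2)])
  have Pnorm: "norm (P n x) \<le> norm x" for n x
  proof (induction n)
    case (Suc n)
    have "norm (D (P n x)) \<le> 1 * norm (P n x)"
      by (rule order_trans[OF norm_blinfun mult_right_mono[OF nD]]) simp
    then show ?case using Suc by (simp add: PS)
  qed (simp add: P0)
  have conv: "convergent (\<lambda>n. P n x)" for x
  proof -
    define a where "a = (\<lambda>n. P n x \<bullet> x)"
    have dec: "a (Suc n) \<le> a n" for n
    proof -
      have "a n - a (Suc n) = (1/b) * (P n (K x) \<bullet> K x)"
        by (simp add: a_def PS Dapp inner_diff_left PK Ksym)
      then show ?thesis using Ppos[of n "K x"] b by (smt (verit) divide_nonneg_pos mult_cancel_right1 mult_nonneg_nonneg)
    qed
    have "Bseq a"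
    proof (rule BseqI'[of _ "norm x * norm x"])
      fix n show "norm (a n) \<le> norm x * norm x"
        unfolding a_def real_norm_def
        by (rule order_trans[OF Cauchy_Schwarz_ineq2]) (intro mult_right_mono Pnorm, simp)
    qed
    then have "convergent a"
      by (rule Bseq_monoseq_convergent)
        (use dec in \<open>auto simp: monoseq_Suc\<close>)
    then obtain L where L: "a \<longlonglongrightarrow> L" by (auto simp: convergent_def)
    have diff: "(norm (P m x - P n x))\<^sup>2 = a (m + m) - 2 * a (m + n) + a (n + n)" for m n
    proof -
      have ip: "P m x \<bullet> P n x = a (m + n)" for m n
        by (simp add: a_def Padd Psym strong_algebra_comm[OF PW PW, of m n])
      show ?thesis
        unfolding power2_norm_eq_inner
        by (simp add: inner_diff_left inner_diff_right ip add.commute[of n m])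
    qed
    have "Cauchy (\<lambda>n. P n x)"
      unfolding Cauchy_iff
    proof (intro allI impI)
      fix e :: real assume "e > 0"
      then have "eventually (\<lambda>n. dist (a n) L < e^2/4) sequentially"
        using tendstoD[OF L, of "e^2/4"] by simp
      then obtain N where N: "\<And>n. n \<ge> N \<Longrightarrow> \<bar>a n - L\<bar> < e^2/4"
        by (auto simp: eventually_sequentially dist_real_def)
      show "\<exists>N. \<forall>m\<ge>N. \<forall>n\<ge>N. norm (P m x - P n x) < e"
      proof (intro exI[of _ N] allI impI)
        fix m n assume "m \<ge> N" "n \<ge> N"
        then have "(norm (P m x - P n x))\<^sup>2 < e^2"
          unfolding diff using N[of "m+m"] N[of "m+n"] N[of "n+n"] by (simp add: abs_if split: if_splits)
        then show "norm (P m x - P n x) < e"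
          using \<open>e > 0\<close> by (simp add: power2_less_imp_less)
      qed
    qed
    then show ?thesis by (rule Cauchy_convergent)
  qed
  obtain Q where QW: "Q \<in> strong_algebra X" and q: "\<And>x. (\<lambda>n. P n x) \<longlonglongrightarrow> Q x"
    using strong_limit_of_contractions[OF PW Pnorm conv] by blast
  show ?thesis
  proof
    show "Q \<in> strong_algebra X"
      by (rule QW)
    have DQ: "D (Q x) = Q x" for x
    proof -
      have "(\<lambda>n. P (Suc n) x) \<longlonglongrightarrow> D (Q x)"
        unfolding PS by (intro tendsto_intros q)
      moreover have "(\<lambda>n. P (Suc n) x) \<longlonglongrightarrow> Q x" by (rule LIMSEQ_Suc[OF q])
      ultimately show ?thesis by (rule LIMSEQ_unique)
    qed
    have KQ: "K (Q x) = 0" for x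
    proof -
      have "K (K (Q x)) = 0" using DQ[of x] b by (simp add: Dapp)
      then have "K (Q x) \<bullet> K (Q x) = 0" using Ksym by simp
      then show ?thesis by simp
    qed
    have Qfix: "Q x = x" if "K x = 0" for x
    proof -
      have "P n x = x" for n by (induction n) (simp_all add: P0 PS Dapp that)
      then show ?thesis using q[of x] by (simp add: LIMSEQ_const_iff)
    qed
    show "K x = 0 \<longleftrightarrow> Q x = x" for x using KQ[of x] Qfix[of x] by auto
    show "Q (Q x) = Q x" for x using KQ Qfix by blast
  qed
qed

section \<open>Spectral projections of half-lines\<close>

text \<open>
  The characterization of \<open>1\<^bsub>(c,\<infinity>)\<^esub>(X)\<close> through quadratic forms. The strict inequality on the
  range decides that eigenvectors for the eigenvalue \<open>c\<close> belong to the kernel.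
\<close>

definition spectral_cut :: "('a::real_inner \<Rightarrow>\<^sub>L 'a) \<Rightarrow> real \<Rightarrow> ('a \<Rightarrow>\<^sub>L 'a) \<Rightarrow> bool"
  where "spectral_cut X c F \<longleftrightarrow> symmetric_op F \<and> (\<forall>x. F (F x) = F x) \<and> (\<forall>x. F (X x) = X (F x)) \<and>
    (\<forall>x. F x = x \<longrightarrow> x \<noteq> 0 \<longrightarrow> c * (x \<bullet> x) < X x \<bullet> x) \<and>
    (\<forall>x. F x = 0 \<longrightarrow> X x \<bullet> x \<le> c * (x \<bullet> x))"

text \<open>
  Put \<open>A = X - c\<close> and \<open>R = |A|\<close>. As \<open>(R + A) (R - A) = 0\<close>, the projection \<open>Q\<close> onto the kernel of
  \<open>R + A\<close> satisfies \<open>A = - R\<close> on its range and \<open>A = R\<close> on the complement, so \<open>1 - Q\<close> is the wanted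
  projection.
\<close>

lemma spectral_cut_exists:
  fixes X :: "'a::{real_inner,banach} \<Rightarrow>\<^sub>L 'a"
  assumes "symmetric_op X"
  obtains F where "F \<in> strong_algebra X" "spectral_cut X c F"
proof -
  let ?W = "strong_algebra X"
  define A where "A = X - c *\<^sub>R id_blinfun"
  have AW: "A \<in> ?W" unfolding A_def by (intro strong_algebra_intros)
  have Aapp: "A x = X x - c *\<^sub>R x" for x by (simp add: A_def blinfun.bilinear_simps)
  have Asym: "A x \<bullet> y = x \<bullet> A y" for x y
    using strong_algebra_symmetric[OF assms AW] by (simp add: symmetric_op_def)
  have AAW: "A o\<^sub>L A \<in> ?W" by (intro strong_algebra.comp AW)
  have "positive_op (A o\<^sub>L A)"
    using strong_algebra_symmetric[OF assms AAW] by (simp add: positive_op_def Asym[of "A x" for x])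
  then obtain R where R: "R \<in> ?W" "positive_op R" "\<And>x. R (R x) = A (A x)"
    using positive_op_sqrt[OF assms AAW] by auto
  have RAW: "R + A \<in> ?W" by (intro strong_algebra.add R AW)
  obtain Q where Q: "Q \<in> ?W" "\<And>x. (R + A) x = 0 \<longleftrightarrow> Q x = x" "\<And>x. Q (Q x) = Q x"
    using kernel_projection[OF assms RAW] by metis
  define F where "F = id_blinfun - Q"
  have FW: "F \<in> ?W" unfolding F_def by (intro strong_algebra_intros Q)
  have Fapp: "F x = x - Q x" for x by (simp add: F_def blinfun.bilinear_simps)
  have RA: "R (A x) = A (R x)" for x by (rule strong_algebra_comm[OF R(1) AW])
  \<comment> \<open>the range of \<open>R - A\<close> lies in the kernel of \<open>R + A\<close>\<close>
  have pm: "Q ((R - A) x) = (R - A) x" for x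
    using Q(2)[of "(R - A) x"] by (simp add: blinfun.bilinear_simps R RA)
  have QRA: "Q ((R - A) x) = (R - A) (Q x)" for x
    by (rule strong_algebra_comm[OF Q(1) strong_algebra_diff[OF R(1) AW]])
  have minus: "R x = A x" if "Q x = 0" for x
    using pm[of x] QRA[of x] that by (simp add: blinfun.bilinear_simps)
  have plus: "R x = - A x" if "Q x = x" for x
    using Q(2)[of x] that by (simp add: blinfun.bilinear_simps eq_neg_iff_add_eq_0)
  have Rpos: "0 \<le> R x \<bullet> x" for x using R(2) by (simp add: positive_op_def)
  have Rsym: "R x \<bullet> y = x \<bullet> R y" for x y using R(2) by (simp add: positive_op_def symmetric_op_def)
  have "spectral_cut X c F"
    unfolding spectral_cut_def
  proof (intro conjI allI impI)
    show "symmetric_op F" by (rule strong_algebra_symmetric[OF assms FW])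
    show "F (F x) = F x" for x by (simp add: Fapp blinfun.bilinear_simps Q)
    show "F (X x) = X (F x)" for x by (rule strong_algebra_comm[OF FW strong_algebra.gen])
    show "X x \<bullet> x \<le> c * (x \<bullet> x)" if "F x = 0" for x
      using Rpos[of x] plus[of x] that by (simp add: Fapp Aapp inner_diff_left)
    show "c * (x \<bullet> x) < X x \<bullet> x" if "F x = x" "x \<noteq> 0" for x
    proof (rule ccontr)
      have Qx: "Q x = 0" using that by (simp add: Fapp)
      assume "\<not> c * (x \<bullet> x) < X x \<bullet> x"
      then have "A x \<bullet> x \<le> 0" by (simp add: Aapp inner_diff_left)
      then have Ax0: "A x \<bullet> x = 0" using Rpos[of x] minus[OF Qx] by simp
      \<comment> \<open>a positive operator kills the vectors on which its quadratic form vanishes\<close>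
      obtain B where B: "positive_op B" "\<And>x. B (B x) = R x"
        using positive_op_sqrt[OF assms R(1,2)] by metis
      have "B x \<bullet> B x = 0"
        using B Ax0 minus[OF Qx] by (simp add: positive_op_def symmetric_op_def inner_commute[of x])
      then have "B x = 0" by simp
      then have "R x = 0" using B(2)[of x] by simp
      then have "(R + A) x = 0" using minus[OF Qx] by (simp add: blinfun.bilinear_simps)
      then show False using Q(2)[of x] Qx that by simp
    qed
  qed
  then show ?thesis using FW that by blast
qed

text \<open>
  On a vector in the range of \<open>G\<close> and in the kernel of \<open>F\<close>, the form of \<open>X\<close> would be both greater
  than \<open>d\<close> and at most \<open>c\<close>.
\<close>

lemma cut_le_cut:
  assumes F: "spectral_cut X c F" and G: "spectral_cut X d G" and "c \<le> d"
    and comm: "\<And>x. F (G x) = G (F x)"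
  shows "F (G x) = G x"
proof -
  define y where "y = G x - F (G x)"
  have "F y = 0" "G y = y"
    using F G comm by (simp_all add: y_def spectral_cut_def blinfun.bilinear_simps)
  then have "X y \<bullet> y \<le> c * (y \<bullet> y)" "y \<noteq> 0 \<Longrightarrow> d * (y \<bullet> y) < X y \<bullet> y"
    using F G by (simp_all add: spectral_cut_def)
  moreover have "c * (y \<bullet> y) \<le> d * (y \<bullet> y)" using assms by (intro mult_right_mono) auto
  ultimately have "y = 0" by fastforce
  then show ?thesis by (simp add: y_def)
qed

lemma spectral_cut_unique:
  assumes F: "F \<in> strong_algebra X" "spectral_cut X c F" and G: "spectral_cut X c G"
  shows "G = F"
proof (rule blinfun_eqI)
  fix x
  have comm: "G (F x) = F (G x)" for x
    using G by (intro strong_algebra_commute[OF F(1)] blinfun.bounded_linear_right) (auto simp: spectral_cut_def)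
  show "G x = F x"
    using cut_le_cut[OF F(2) G order_refl comm[symmetric]] cut_le_cut[OF G F(2) order_refl comm] comm
    by metis
qed

section \<open>Spectral measures on the real line\<close>

text \<open>
  Subdividing \<open>[a, b]\<close> into \<open>n\<close> equal parts makes the bounds telescope to
  \<open>(b - a) (f a - f b) / n\<close>.
\<close>

lemma constant_if_increments_small:
  fixes h f :: "real \<Rightarrow> real"
  assumes "\<And>c d. c \<le> d \<Longrightarrow> \<bar>h c - h d\<bar> \<le> (d - c) * (f c - f d)" and "a \<le> b"
  shows "h a = h b"
proof (rule ccontr)
  assume ne: "h a \<noteq> h b"
  have bd: "\<bar>h a - h b\<bar> \<le> (b - a) * (f a - f b) / real n" if "n > 0" for n
  proof -
    define s where "s = (b - a) / real n"
    have s0: "s \<ge> 0" using assms(2) by (simp add: s_def)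
    have "\<bar>h a - h (a + real k * s)\<bar> \<le> s * (f a - f (a + real k * s))" for k
    proof (induction k)
      case (Suc k)
      have "\<bar>h (a + real k * s) - h (a + real (Suc k) * s)\<bar>
          \<le> (a + real (Suc k) * s - (a + real k * s)) * (f (a + real k * s) - f (a + real (Suc k) * s))"
        by (rule assms(1)) (use s0 in \<open>simp add: algebra_simps\<close>)
      also have "a + real (Suc k) * s - (a + real k * s) = s" by (simp add: algebra_simps)
      finally show ?case using Suc by (simp add: right_diff_distrib)
    qed simp
    from this[of n] show ?thesis using that by (simp add: s_def)
  qed
  obtain n where n: "real n > (b - a) * (f a - f b) / \<bar>h a - h b\<bar>" using reals_Archimedean2 by blast
  have "(b - a) * (f a - f b) < real (Suc n) * \<bar>h a - h b\<bar>"
    using n ne by (simp add: divide_simps algebra_simps split: if_splits)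
  then show False using bd[of "Suc n"] by (simp add: field_simps)
qed

lemma symmetric_op_eqI:
  assumes "symmetric_op S" "symmetric_op T" "\<And>x. S x \<bullet> x = T x \<bullet> x"
  shows "S = T"
proof -
  have "symmetric_op (S - T)"
    using assms by (simp add: symmetric_op_def blinfun.bilinear_simps inner_diff_left inner_diff_right)
  then have "norm (S - T) \<le> 0"
    by (rule norm_symmetric_le) (simp_all add: blinfun.bilinear_simps inner_diff_left assms)
  then show ?thesis by simp
qed

lemma abs_form_le: "\<bar>T x \<bullet> x\<bar> \<le> norm T * (x \<bullet> x)" for T :: "'a::real_inner \<Rightarrow>\<^sub>L 'a"
proof -
  have "\<bar>T x \<bullet> x\<bar> \<le> norm (T x) * norm x" by (rule Cauchy_Schwarz_ineq2)
  also have "\<dots> \<le> (norm T * norm x) * norm x" by (intro mult_right_mono norm_blinfun) auto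
  finally show ?thesis by (simp add: dot_square_norm power2_eq_square)
qed

locale symmetric_operator =
  fixes X :: "'a::{real_inner,banach} \<Rightarrow>\<^sub>L 'a"
  assumes symmetric: "symmetric_op X"
begin

definition proj :: "('a \<Rightarrow>\<^sub>L 'a) \<Rightarrow> bool"
  where "proj P \<longleftrightarrow> P \<in> strong_algebra X \<and> (\<forall>x. P (P x) = P x)"

lemma projD:
  assumes "proj P"
  shows "P \<in> strong_algebra X" "P (P x) = P x" "P x \<bullet> y = x \<bullet> P y" "symmetric_op P"
  using assms strong_algebra_symmetric[OF symmetric, of P] by (auto simp: proj_def symmetric_op_def)

lemma proj_comm: "proj P \<Longrightarrow> proj Q \<Longrightarrow> P (Q x) = Q (P x)"
  unfolding proj_def by (blast intro: strong_algebra_comm)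

lemma proj_form: "proj P \<Longrightarrow> P x \<bullet> x = P x \<bullet> P x"
  using projD(2,3)[of P] by metis

lemma proj_form_le: assumes "proj P" shows "0 \<le> P x \<bullet> x" "P x \<bullet> x \<le> x \<bullet> x" "norm (P x) \<le> norm x"
proof -
  show "0 \<le> P x \<bullet> x" by (simp add: proj_form[OF assms])
  have "(x - P x) \<bullet> (x - P x) = x \<bullet> x - P x \<bullet> x"
    using proj_form[OF assms, of x] by (simp add: inner_diff_left inner_diff_right inner_commute[of x "P x"])
  then show *: "P x \<bullet> x \<le> x \<bullet> x" using inner_ge_zero[of "x - P x"] by linarith
  show "norm (P x) \<le> norm x" using * by (simp add: proj_form[OF assms] norm_le)
qed

lemma proj_eqI: "proj P \<Longrightarrow> proj Q \<Longrightarrow> (\<And>x. P x \<bullet> x = Q x \<bullet> x) \<Longrightarrow> P = Q"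
  by (rule symmetric_op_eqI) (auto intro: projD)

lemma proj_compl: "proj P \<Longrightarrow> proj (id_blinfun - P)"
  unfolding proj_def by (auto intro!: strong_algebra_intros simp: blinfun.bilinear_simps)

lemma proj_zero: "proj 0" and proj_one: "proj id_blinfun"
  by (auto simp: proj_def strong_algebra_zero strong_algebra.one)

text \<open>
  Evaluate the hypothesis at a vector in the range of \<open>Q\<close>: no room is left for \<open>P\<close>.
\<close>

lemma proj_orthogonal:
  assumes "proj P" "proj Q" "\<And>x. P x \<bullet> x + Q x \<bullet> x \<le> x \<bullet> x"
  shows "P (Q x) = 0"
proof -
  have "P (Q x) \<bullet> P (Q x) \<le> 0"
    using assms(3)[of "Q x"] by (simp add: proj_form[OF assms(1)] projD(2)[OF assms(2)])
  then show ?thesis using inner_ge_zero[of "P (Q x)"] by (metis antisym inner_eq_zero_iff)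
qed

lemma proj_le:
  assumes "proj P" "proj Q" "\<And>x. P x \<bullet> x \<le> Q x \<bullet> x"
  shows "Q (P x) = P x"
proof -
  have "(id_blinfun - Q) (P x) = 0"
    by (rule proj_orthogonal[OF proj_compl[OF assms(2)] assms(1)])
      (use assms(3) in \<open>simp add: blinfun.bilinear_simps inner_diff_left\<close>)
  then show ?thesis by (simp add: blinfun.bilinear_simps)
qed

lemma proj_add:
  assumes "proj P" "proj Q" "\<And>x. P x \<bullet> x + Q x \<bullet> x \<le> x \<bullet> x"
  shows "proj (P + Q)"
  using assms proj_orthogonal[OF assms] proj_comm[OF assms(1,2)]
  unfolding proj_def by (auto intro!: strong_algebra_intros simp: blinfun.bilinear_simps)

text \<open>
  The numbers \<open>\<langle>P\<^sub>n x, x\<rangle>\<close> increase and are bounded, and their differences are the squared distances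
  between the vectors \<open>P\<^sub>n x\<close>.
\<close>

lemma proj_increasing_limit:
  assumes "\<And>n. proj (P n)" "\<And>n m x. n \<le> m \<Longrightarrow> P m (P n x) = P n x"
  obtains Q where "proj Q" "\<And>x. (\<lambda>n. P n x) \<longlonglongrightarrow> Q x"
proof -
  have conv: "convergent (\<lambda>n. P n x)" for x
  proof -
    define a where "a = (\<lambda>n. P n x \<bullet> x)"
    have diff: "(norm (P m x - P n x))\<^sup>2 = a m - a n" if "n \<le> m" for m n
    proof -
      have "P m x \<bullet> P n x = a n" "P n x \<bullet> P m x = a n"
        using projD(3)[OF assms(1), of m x "P n x"] assms(2)[OF that, of x] by (simp_all add: a_def inner_commute)
      then show ?thesis
        by (simp add: power2_norm_eq_inner inner_diff_left inner_diff_right a_def proj_form[OF assms(1), symmetric])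
    qed
    have inc: "a n \<le> a (Suc n)" for n using diff[of n "Suc n"] by (metis diff_ge_0_iff_ge le_SucI order_refl zero_le_power2)
    have "Bseq a"
      by (rule BseqI'[of _ "x \<bullet> x"]) (use proj_form_le[OF assms(1)] in \<open>auto simp: a_def\<close>)
    then have "convergent a" by (rule Bseq_monoseq_convergent) (use inc in \<open>auto simp: monoseq_Suc\<close>)
    then have cau: "Cauchy a" by (rule convergent_Cauchy)
    have "Cauchy (\<lambda>n. P n x)"
      unfolding Cauchy_iff
    proof (intro allI impI)
      fix e :: real assume "e > 0"
      then obtain N where N: "\<And>m n. m \<ge> N \<Longrightarrow> n \<ge> N \<Longrightarrow> \<bar>a m - a n\<bar> < e^2"
        using cau unfolding Cauchy_iff real_norm_def by (meson zero_less_power)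
      have *: "norm (P m x - P n x) < e" if "m \<ge> N" "n \<ge> N" "n \<le> m" for m n
        using N[OF that(1,2)] diff[OF that(3)] \<open>e > 0\<close> by (intro power2_less_imp_less[of _ e]) auto
      then show "\<exists>N. \<forall>m\<ge>N. \<forall>n\<ge>N. norm (P m x - P n x) < e"
        by (metis nle_le norm_minus_commute)
    qed
    then show ?thesis by (rule Cauchy_convergent)
  qed
  obtain Q where Q: "Q \<in> strong_algebra X" "\<And>x. (\<lambda>n. P n x) \<longlonglongrightarrow> Q x"
    using strong_limit_of_contractions[OF projD(1)[OF assms(1)] proj_form_le(3)[OF assms(1)] conv] by blast
  have PQ: "P n (Q x) = P n x" for n x
  proof -
    have "(\<lambda>m. P n (P m x)) \<longlonglongrightarrow> P n (Q x)" by (intro tendsto_intros Q)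
    moreover have "P n (P m x) = P n x" if "n \<le> m" for m
      using assms(2)[OF that, of x] proj_comm[OF assms(1) assms(1), of n m x] by simp
    then have "\<forall>\<^sub>F m in sequentially. P n (P m x) = P n x"
      by (rule eventually_mono[OF eventually_ge_at_top[of n]])
    ultimately show ?thesis by (metis LIMSEQ_unique tendsto_eventually)
  qed
  have "Q (Q x) = Q x" for x
    using LIMSEQ_unique[OF Q(2)[of "Q x"]] Q(2)[of x] by (simp add: PQ)
  then show ?thesis using that Q by (auto simp: proj_def)
qed

definition cut :: "real \<Rightarrow> ('a \<Rightarrow>\<^sub>L 'a)"
  where "cut c = (SOME F. F \<in> strong_algebra X \<and> spectral_cut X c F)"

lemma cut: "cut c \<in> strong_algebra X" "spectral_cut X c (cut c)"
proof -
  have "\<exists>F. F \<in> strong_algebra X \<and> spectral_cut X c F" using spectral_cut_exists[OF symmetric] by metis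
  then have "cut c \<in> strong_algebra X \<and> spectral_cut X c (cut c)" unfolding cut_def by (rule someI_ex)
  then show "cut c \<in> strong_algebra X" "spectral_cut X c (cut c)" by auto
qed

lemma proj_cut: "proj (cut c)"
  using cut[of c] by (auto simp: proj_def spectral_cut_def)

lemma cut_above: "cut c x = x \<Longrightarrow> x \<noteq> 0 \<Longrightarrow> c * (x \<bullet> x) < X x \<bullet> x"
  and cut_below: "cut c x = 0 \<Longrightarrow> X x \<bullet> x \<le> c * (x \<bullet> x)"
  and cut_X: "cut c (X x) = X (cut c x)"
  using cut[of c] by (auto simp: spectral_cut_def)

lemma cut_cut: "c \<le> d \<Longrightarrow> cut c (cut d x) = cut d x"
  by (rule cut_le_cut[OF cut(2) cut(2)]) (auto intro: proj_comm proj_cut)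

lemma cut_eq_0:
  assumes "norm X \<le> c"
  shows "cut c = 0"
proof (rule blinfun_eqI)
  fix x
  let ?y = "cut c x"
  have "X ?y \<bullet> ?y \<le> c * (?y \<bullet> ?y)"
    using abs_form_le[of X ?y] mult_right_mono[OF assms inner_ge_zero[of ?y]] by linarith
  then show "cut c x = blinfun_apply 0 x"
    using cut_above[of c ?y] projD(2)[OF proj_cut, of c x] by force
qed

lemma cut_eq_id:
  assumes "c < - norm X"
  shows "cut c = id_blinfun"
proof (rule blinfun_eqI)
  fix x
  let ?y = "x - cut c x"
  have "X ?y \<bullet> ?y \<le> c * (?y \<bullet> ?y)"
    by (rule cut_below) (simp add: blinfun.bilinear_simps projD(2)[OF proj_cut])
  moreover have "- (norm X * (?y \<bullet> ?y)) \<le> X ?y \<bullet> ?y"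
    using abs_form_le[of X ?y] by linarith
  ultimately have "(- norm X - c) * (?y \<bullet> ?y) \<le> 0" by (simp add: algebra_simps)
  then have "?y \<bullet> ?y \<le> 0" using assms by (simp add: mult_le_0_iff)
  then have "?y = 0" using inner_ge_zero[of ?y] by (metis antisym inner_eq_zero_iff)
  then show "cut c x = blinfun_apply id_blinfun x" by simp
qed

lemma cut_form_antimono: "c \<le> d \<Longrightarrow> cut d x \<bullet> x \<le> cut c x \<bullet> x"
  using proj_form_le(2)[OF proj_cut, of d "cut c x"]
    cut_cut[of c d x] proj_comm[OF proj_cut proj_cut, of c d x]
  by (metis proj_cut proj_form projD(2))

text \<open>
  The cuts at \<open>c + 1/(n+1)\<close> increase to some projection \<open>Q\<close> below the cut at \<open>c\<close>. On the
  difference of the two, the form of \<open>X\<close> exceeds \<open>c\<close> strictly but is at most \<open>c + 1/(n+1)\<close> for all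
  \<open>n\<close>, so the difference vanishes.
\<close>

lemma cut_right_limit: "(\<lambda>n. cut (c + 1 / real (Suc n)) x) \<longlonglongrightarrow> cut c x"
proof -
  let ?P = "\<lambda>n. cut (c + 1 / real (Suc n))"
  have inc: "?P m (?P n x) = ?P n x" if "n \<le> m" for m n x
    by (rule cut_cut) (use that in \<open>simp add: frac_le\<close>)
  obtain Q where Q: "proj Q" "\<And>x. (\<lambda>n. ?P n x) \<longlonglongrightarrow> Q x"
    using proj_increasing_limit[of ?P, OF proj_cut inc] by blast
  have PQ: "?P n (Q x) = ?P n x" for n x
  proof -
    have "(\<lambda>m. ?P n (?P m x)) \<longlonglongrightarrow> ?P n (Q x)" by (intro tendsto_intros Q)
    moreover have "?P n (?P m x) = ?P n x" if "n \<le> m" for m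
      using inc[OF that, of x] proj_comm[OF proj_cut proj_cut] by metis
    then have "\<forall>\<^sub>F m in sequentially. ?P n (?P m x) = ?P n x"
      by (rule eventually_mono[OF eventually_ge_at_top[of n]])
    ultimately show ?thesis by (metis LIMSEQ_unique tendsto_eventually)
  qed
  have cQ: "cut c (Q x) = Q x" for x
  proof -
    have "(\<lambda>m. cut c (?P m x)) \<longlonglongrightarrow> cut c (Q x)" by (intro tendsto_intros Q)
    then have "(\<lambda>m. ?P m x) \<longlonglongrightarrow> cut c (Q x)" by (simp add: cut_cut)
    then show ?thesis using LIMSEQ_unique Q(2) by blast
  qed
  define z where "z = cut c x - Q x"
  have "cut c z = z" by (simp add: z_def blinfun.bilinear_simps cQ projD(2)[OF proj_cut])
  moreover have "?P n z = 0" for n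
  proof -
    have "?P n (cut c x) = cut c (?P n x)" by (rule proj_comm[OF proj_cut proj_cut])
    also have "\<dots> = ?P n x" by (rule cut_cut) simp
    finally show ?thesis by (simp add: z_def blinfun.bilinear_simps PQ del: of_nat_Suc)
  qed
  then have "X z \<bullet> z \<le> (c + 1 / real (Suc n)) * (z \<bullet> z)" for n by (rule cut_below)
  then have "X z \<bullet> z \<le> (c + 0) * (z \<bullet> z)"
    by (intro LIMSEQ_le_const[of "\<lambda>n. (c + 1 / real (Suc n)) * (z \<bullet> z)"] tendsto_intros LIMSEQ_Suc[OF lim_1_over_n]) auto
  ultimately have "z = 0" using cut_above[of c z] by force
  then show ?thesis using Q(2)[of x] by (simp add: z_def)
qed

definition cdf_of :: "'a \<Rightarrow> real \<Rightarrow> real" where "cdf_of x t = x \<bullet> x - cut t x \<bullet> x"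

text \<open>
  The measure \<open>B \<mapsto> \<langle>1\<^sub>B(X) x, x\<rangle>\<close>, built from its distribution function before the projections
  \<open>1\<^sub>B(X)\<close> are known to exist.
\<close>

definition scalar_measure :: "'a \<Rightarrow> real measure" where "scalar_measure x = interval_measure (cdf_of x)"

lemma cdf_mono: "s \<le> t \<Longrightarrow> cdf_of x s \<le> cdf_of x t"
  by (simp add: cdf_of_def cut_form_antimono)

lemma cdf_right_cont: "continuous (at_right a) (cdf_of x)"
proof (subst continuous_at_right_real_increasing[OF cdf_mono], assumption, intro allI impI)
  fix e :: real assume "e > 0"
  have "(\<lambda>n. cdf_of x (a + 1 / real (Suc n))) \<longlonglongrightarrow> cdf_of x a"
    unfolding cdf_of_def by (intro tendsto_intros cut_right_limit)
  then have "\<forall>\<^sub>F n in sequentially. dist (cdf_of x (a + 1 / real (Suc n))) (cdf_of x a) < e"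
    using \<open>e > 0\<close> by (rule tendstoD)
  then obtain n where "dist (cdf_of x (a + 1 / real (Suc n))) (cdf_of x a) < e"
    by (auto simp: eventually_sequentially)
  then show "\<exists>d>0. cdf_of x (a + d) - cdf_of x a < e"
    by (intro exI[of _ "1 / real (Suc n)"]) (auto simp: dist_real_def)
qed

lemma scalar_measure_UNIV: "emeasure (scalar_measure x) UNIV = ennreal (x \<bullet> x)"
  unfolding scalar_measure_def
proof (rule interval_measure_UNIV[OF cdf_mono cdf_right_cont])
  show "(cdf_of x \<longlongrightarrow> 0) at_bot"
    by (rule tendsto_eventually, rule eventually_mono[OF eventually_gt_at_bot[of "- norm X"]])
      (simp add: cdf_of_def cut_eq_id)
  show "(cdf_of x \<longlongrightarrow> x \<bullet> x) at_top"
    by (rule tendsto_eventually) (auto simp: eventually_at_top_linorder cdf_of_def cut_eq_0 intro!: exI[of _ "norm X"])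
qed auto

lemma sets_scalar_measure [simp, measurable_cong]: "sets (scalar_measure x) = sets borel" by (simp add: scalar_measure_def)
lemma space_scalar_measure [simp]: "space (scalar_measure x) = UNIV" by (simp add: scalar_measure_def)

lemma finite_scalar_measure: "finite_measure (scalar_measure x)"
  by (rule finite_measureI) (simp add: scalar_measure_UNIV)

lemma measure_scalar_measure_UNIV: "measure (scalar_measure x) UNIV = x \<bullet> x"
  by (simp add: measure_def scalar_measure_UNIV)

lemma measure_scalar_measure_le: "measure (scalar_measure x) B \<le> x \<bullet> x"
  using finite_measure.bounded_measure[OF finite_scalar_measure, of x B] by (simp add: measure_scalar_measure_UNIV)

lemma measure_scalar_measure_Ioc: "a \<le> b \<Longrightarrow> measure (scalar_measure x) {a<..b} = cut a x \<bullet> x - cut b x \<bullet> x"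
  unfolding scalar_measure_def by (subst measure_interval_measure_Ioc[OF _ cdf_mono cdf_right_cont]) (auto simp: cdf_of_def)

lemma proj_diff_cut:
  assumes "c \<le> d" shows "proj (cut c - cut d)"
  unfolding proj_def using cut_cut[OF assms] proj_comm[OF proj_cut proj_cut, of c d] projD(2)[OF proj_cut]
  by (auto intro!: strong_algebra_intros cut simp: blinfun.bilinear_simps)

text \<open>
  Induction over the Borel sets from the half-open intervals. In the step for disjoint unions, the
  projections are orthogonal because the scalar measures have total mass \<open>\<langle>x, x\<rangle>\<close>, so their partial
  sums are an increasing sequence of projections.
\<close>

lemma spectral_projection_exists:
  assumes "B \<in> sets borel"
  shows "\<exists>P. proj P \<and> (\<forall>x. P x \<bullet> x = measure (scalar_measure x) B)"
proof -
  have B: "B \<in> sigma_sets UNIV (range (\<lambda>(a, b). {a <.. b::real}))"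
    using assms by (subst (asm) borel_sigma_sets_Ioc) simp
  show ?thesis
  proof (rule sigma_sets_induct_disjoint[OF _ _ B, where P = "\<lambda>B. \<exists>P. proj P \<and> (\<forall>x. P x \<bullet> x = measure (scalar_measure x) B)"], goal_cases)
    case 1 then show ?case by (auto simp: Int_stable_def)
  next
    case 2 then show ?case by simp
  next
    case (3 A)
    then obtain a b where A: "A = {a<..b}" by auto
    show ?case
    proof (cases "a \<le> b")
      case True
      then show ?thesis
        by (intro exI[of _ "cut a - cut b"]) (simp add: A proj_diff_cut measure_scalar_measure_Ioc blinfun.bilinear_simps inner_diff_left)
    qed (use proj_zero in \<open>auto simp: A intro!: exI[of _ 0]\<close>)
  next
    case 4 then show ?case using proj_zero by (auto intro!: exI[of _ 0])
  next
    case (5 A) 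
    then obtain P where P: "proj P" "\<And>x. P x \<bullet> x = measure (scalar_measure x) A" by blast
    have "A \<in> sets borel" using 5 by (subst borel_sigma_sets_Ioc) simp
    then have "measure (scalar_measure x) (UNIV - A) = x \<bullet> x - measure (scalar_measure x) A" for x
      using finite_measure.finite_measure_compl[OF finite_scalar_measure, of A x] by (simp add: measure_scalar_measure_UNIV)
    then show ?case
      by (intro exI[of _ "id_blinfun - P"]) (simp add: proj_compl P blinfun.bilinear_simps inner_diff_left)
  next
    case (6 A)
    then obtain P where P: "\<And>n. proj (P n)" "\<And>n x. P n x \<bullet> x = measure (scalar_measure x) (A n)" by metis
    have A: "A n \<in> sets borel" for n using 6 by (subst borel_sigma_sets_Ioc) auto
    define S where "S = (\<lambda>n. \<Sum>k<n. P k)"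
    have S: "proj (S n) \<and> (\<forall>x. S n x \<bullet> x = measure (scalar_measure x) (\<Union>k<n. A k))" for n
    proof (induction n)
      case (Suc n)
      have m: "measure (scalar_measure x) (\<Union>k<Suc n. A k) = S n x \<bullet> x + P n x \<bullet> x" for x
      proof -
        have "(\<Union>k<n. A k) \<inter> A n = {}" 
        proof -
          have "A k \<inter> A n = {}" if "k < n" for k
            using \<open>disjoint_family A\<close> that by (intro disjoint_family_onD) auto
          then show ?thesis by blast
        qed
        then have "measure (scalar_measure x) ((\<Union>k<n. A k) \<union> A n) = measure (scalar_measure x) (\<Union>k<n. A k) + measure (scalar_measure x) (A n)"
          using A by (intro finite_measure.finite_measure_Union[OF finite_scalar_measure]) auto
        then show ?thesis using Suc P by (simp add: lessThan_Suc Un_commute)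
      qed
      have "S (Suc n) = S n + P n" by (simp add: S_def)
      then show ?case
        using proj_add[of "S n" "P n"] Suc P(1) m measure_scalar_measure_le[of _ "\<Union>k<Suc n. A k"]
        by (simp add: blinfun.bilinear_simps inner_add_left)
    qed (simp add: S_def proj_zero)
    have "S m (S n x) = S n x" if "n \<le> m" for n m x
      using S A that
      by (intro proj_le) (auto intro!: finite_measure.finite_measure_mono[OF finite_scalar_measure] sets.finite_UN, force)
    then obtain Q where Q: "proj Q" "\<And>x. (\<lambda>n. S n x) \<longlonglongrightarrow> Q x"
      using proj_increasing_limit[of S] S by blast
    have "Q x \<bullet> x = measure (scalar_measure x) (\<Union>i. A i)" for x
    proof (rule LIMSEQ_unique)
      show "(\<lambda>n. S n x \<bullet> x) \<longlonglongrightarrow> Q x \<bullet> x" by (intro tendsto_intros Q)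
      have "(\<lambda>i. measure (scalar_measure x) (A i)) sums measure (scalar_measure x) (\<Union>i. A i)"
        using A \<open>disjoint_family A\<close> by (intro finite_measure.finite_measure_UNION[OF finite_scalar_measure]) auto
      moreover have "(\<Sum>k<n. measure (scalar_measure x) (A k)) = S n x \<bullet> x" for n
        by (simp add: S_def blinfun.sum_left inner_sum_left P)
      ultimately show "(\<lambda>n. S n x \<bullet> x) \<longlonglongrightarrow> measure (scalar_measure x) (\<Union>i. A i)"
        by (simp add: sums_def)
    qed
    then show ?case using Q by blast
  qed
qed

text \<open>
  Well defined by \<open>proj_eqI\<close>: a projection in the algebra is determined by its quadratic form.
\<close>

definition E :: "real set \<Rightarrow> ('a \<Rightarrow>\<^sub>L 'a)"
  where "E B = (SOME P. proj P \<and> (\<forall>x. P x \<bullet> x = measure (scalar_measure x) B))"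

lemma E:
  assumes "B \<in> sets borel"
  shows "proj (E B)" "E B x \<bullet> x = measure (scalar_measure x) B"
  using someI_ex[OF spectral_projection_exists[OF assms]] by (auto simp: E_def)

lemma E_eqI: "B \<in> sets borel \<Longrightarrow> proj P \<Longrightarrow> (\<And>x. P x \<bullet> x = measure (scalar_measure x) B) \<Longrightarrow> E B = P"
  by (rule proj_eqI) (auto simp: E)

lemma E_UNIV: "E UNIV = id_blinfun"
  by (rule E_eqI) (auto simp: proj_one measure_scalar_measure_UNIV)

lemma E_mono: "A \<in> sets borel \<Longrightarrow> B \<in> sets borel \<Longrightarrow> A \<subseteq> B \<Longrightarrow> E B (E A x) = E A x"
  by (rule proj_le) (auto simp: E intro!: finite_measure.finite_measure_mono[OF finite_scalar_measure])

lemma E_disjoint: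
  assumes "A \<in> sets borel" "B \<in> sets borel" "A \<inter> B = {}"
  shows "E A (E B x) = 0" "E (A \<union> B) = E A + E B"
proof -
  have m: "measure (scalar_measure y) (A \<union> B) = E A y \<bullet> y + E B y \<bullet> y" for y
    using finite_measure.finite_measure_Union[OF finite_scalar_measure, of A y B] assms by (simp add: E)
  have le: "E A y \<bullet> y + E B y \<bullet> y \<le> y \<bullet> y" for y
    using measure_scalar_measure_le[of y "A \<union> B"] by (simp add: m)
  show "E A (E B x) = 0" by (rule proj_orthogonal[OF E(1) E(1) le]) (use assms in auto)
  show "E (A \<union> B) = E A + E B"
    using assms by (intro E_eqI proj_add E le) (auto simp: m blinfun.bilinear_simps inner_add_left)
qed

lemma E_Int:
  assumes A: "A \<in> sets borel" and B: "B \<in> sets borel"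
  shows "E (A \<inter> B) = E A o\<^sub>L E B"
proof (rule blinfun_eqI)
  fix x
  have "(A \<inter> B) \<union> (A - B) = A" by blast
  then have "E A = E (A \<inter> B) + E (A - B)"
    using E_disjoint(2)[of "A \<inter> B" "A - B"] A B by auto
  moreover have "(A - B) \<inter> B = {}" by blast
  ultimately have "E A (E B x) = E (A \<inter> B) (E B x)"
    using E_disjoint(1)[of "A - B" B x] A B by (simp add: blinfun.bilinear_simps del: Diff_Int_distrib2)
  also have "\<dots> = E B (E (A \<inter> B) x)" by (rule proj_comm[OF E(1) E(1)]) (use A B in auto)
  also have "\<dots> = E (A \<inter> B) x" by (rule E_mono) (use A B in auto)
  finally show "E (A \<inter> B) x = (E A o\<^sub>L E B) x" by simp
qed

lemma E_sums:
  fixes B :: "nat \<Rightarrow> real set"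
  assumes "range B \<subseteq> sets borel" "disjoint_family B"
  shows "(\<lambda>n. E (B n) x) sums E (\<Union>n. B n) x"
proof -
  have Bm: "B n \<in> sets borel" "(\<Union>n. B n) \<in> sets borel" "(\<Union>k<n. B k) \<in> sets borel" for n
    using assms by auto
  have S: "(\<Sum>k<n. E (B k)) = E (\<Union>k<n. B k)" for n
  proof (induction n)
    case 0
    have "E {} = 0" by (rule E_eqI) (auto simp: proj_zero)
    then show ?case by simp
  next
    case (Suc n)
    have "B k \<inter> B n = {}" if "k < n" for k
      using assms(2) that by (intro disjoint_family_onD) auto
    then have "E ((\<Union>k<n. B k) \<union> B n) = E (\<Union>k<n. B k) + E (B n)"
      using Bm by (intro E_disjoint) blast+
    then show ?case by (simp add: Suc lessThan_Suc Un_commute)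
  qed
  obtain Q where Q: "proj Q" "\<And>x. (\<lambda>n. E (\<Union>k<n. B k) x) \<longlonglongrightarrow> Q x"
  proof (rule proj_increasing_limit[of "\<lambda>n. E (\<Union>k<n. B k)"])
    show "E (\<Union>k<m. B k) (E (\<Union>k<n. B k) x) = E (\<Union>k<n. B k) x" if "n \<le> m" for n m x
      using that by (intro E_mono Bm) force
  qed (auto intro: E(1) Bm)
  have "E (\<Union>n. B n) = Q"
  proof (rule E_eqI[OF Bm(2) Q(1)])
    fix x
    show "Q x \<bullet> x = measure (scalar_measure x) (\<Union>n. B n)"
    proof (rule LIMSEQ_unique)
      show "(\<lambda>n. E (\<Union>k<n. B k) x \<bullet> x) \<longlonglongrightarrow> Q x \<bullet> x" by (intro tendsto_intros Q)
      have "(\<lambda>n. measure (scalar_measure x) (\<Union>k<n. B k)) \<longlonglongrightarrow> measure (scalar_measure x) (\<Union>n. \<Union>k<n. B k)"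
        using Bm by (intro finite_measure.finite_Lim_measure_incseq[OF finite_scalar_measure]) (auto simp: incseq_def, force)
      moreover have "(\<Union>n. \<Union>k<n. B k) = (\<Union>n. B n)" by auto
      ultimately show "(\<lambda>n. E (\<Union>k<n. B k) x \<bullet> x) \<longlonglongrightarrow> measure (scalar_measure x) (\<Union>n. B n)"
        using Bm by (simp add: E)
    qed
  qed
  then show ?thesis
    using Q(2)[of x] by (simp add: sums_def S[symmetric] blinfun.sum_left)
qed

lemma AE_scalar_measure_bounded: "AE t in scalar_measure x. \<bar>t\<bar> \<le> norm X + 1"
proof (rule AE_I)
  let ?B = "{- norm X - 1<..norm X + 1}"
  show "{t \<in> space (scalar_measure x). \<not> \<bar>t\<bar> \<le> norm X + 1} \<subseteq> UNIV - ?B" by auto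
  have "measure (scalar_measure x) (UNIV - ?B) = x \<bullet> x - measure (scalar_measure x) ?B"
    using finite_measure.finite_measure_compl[OF finite_scalar_measure, of ?B x] by (simp add: measure_scalar_measure_UNIV)
  also have "measure (scalar_measure x) ?B = x \<bullet> x"
    using norm_ge_zero[of X] by (subst measure_scalar_measure_Ioc) (auto simp: cut_eq_0 cut_eq_id)
  finally show "emeasure (scalar_measure x) (UNIV - ?B) = 0"
    by (simp add: finite_measure.emeasure_eq_measure[OF finite_scalar_measure])
qed auto

lemma integrable_scalar_measure_id: "integrable (scalar_measure x) (\<lambda>t. t)"
  by (rule finite_measure.integrable_const_bound[OF finite_scalar_measure, where B = "norm X + 1"])
    (use AE_scalar_measure_bounded in \<open>auto\<close>)

text \<open>
  The difference \<open>h(c)\<close> of the two sides, restricted to the spectral subspace of \<open>(c, \<infinity>)\<close>, changes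
  over an interval \<open>(c, d]\<close> by at most \<open>d - c\<close> times the mass of that interval, hence is constant;
  and \<open>h\<close> vanishes beyond the norm of \<open>X\<close>.
\<close>

lemma form_eq_integral: "X x \<bullet> x = (LINT t|scalar_measure x. t)"
proof -
  have nn: "- norm X - 2 \<le> norm X + 2" using norm_ge_zero[of X] by simp
  define f where "f = (\<lambda>c. cut c x \<bullet> x)"
  \<comment> \<open>both sides of the claim, cut off to the left of \<open>c\<close>\<close>
  define h where "h = (\<lambda>c. X (cut c x) \<bullet> x - (LINT t|scalar_measure x. indicator {c<..} t * t))"
  have int: "integrable (scalar_measure x) (\<lambda>t. indicator B t * t)" if "B \<in> sets borel" for B
    using integrable_mult_indicator[OF _ integrable_scalar_measure_id, of B x] that by simp
  have intc: "integrable (scalar_measure x) (\<lambda>t. indicator B t * k)" if "B \<in> sets borel" for B and k :: real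
    using that finite_measure.emeasure_finite[OF finite_scalar_measure]
    by (intro integrable_mult_left integrable_real_indicator) (auto simp: less_top)
  have inc: "\<bar>h c - h d\<bar> \<le> (d - c) * (f c - f d)" if "c \<le> d" for c d
  proof -
    let ?B = "{c<..d}"
    define y where "y = cut c x - cut d x"
    have pr: "proj (cut c - cut d)" by (rule proj_diff_cut[OF that])
    have y: "y = (cut c - cut d) x" by (simp add: y_def blinfun.bilinear_simps)
    have yy: "y \<bullet> y = f c - f d"
      unfolding y proj_form[OF pr, symmetric] by (simp add: f_def blinfun.bilinear_simps inner_diff_left)
    have Xy: "X y \<bullet> x = X y \<bullet> y"
    proof -
      have "X y \<bullet> y = (cut c - cut d) (X y) \<bullet> x" unfolding y by (rule projD(3)[OF pr, symmetric])
      also have "(cut c - cut d) (X y) = X ((cut c - cut d) y)" by (simp add: blinfun.bilinear_simps cut_X)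
      also have "(cut c - cut d) y = y" unfolding y by (rule projD(2)[OF pr])
      finally show ?thesis by simp
    qed
    have up: "X y \<bullet> x \<le> d * (f c - f d)"
      unfolding Xy yy[symmetric]
      by (rule cut_below)
        (use cut_cut[OF that] proj_comm[OF proj_cut proj_cut, of c d] in \<open>simp add: y_def blinfun.bilinear_simps projD(2)[OF proj_cut]\<close>)
    have "cut c y = y" by (simp add: y_def blinfun.bilinear_simps projD(2)[OF proj_cut] cut_cut that)
    then have lo: "c * (f c - f d) \<le> X y \<bullet> x"
      unfolding Xy yy[symmetric] using cut_above[of c y] by (cases "y = 0") auto
    have m: "(LINT t|scalar_measure x. indicator ?B t * k) = k * (f c - f d)" for k :: real
      using measure_scalar_measure_Ioc[OF that, of x] by (simp add: f_def)
    have up': "(LINT t|scalar_measure x. indicator ?B t * t) \<le> d * (f c - f d)"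
      unfolding m[symmetric] by (rule integral_mono[OF int intc]) (auto split: split_indicator)
    have lo': "c * (f c - f d) \<le> (LINT t|scalar_measure x. indicator ?B t * t)"
      unfolding m[symmetric] by (rule integral_mono[OF intc int]) (auto split: split_indicator)
    have "(LINT t|scalar_measure x. indicator {c<..} t * t) - (LINT t|scalar_measure x. indicator {d<..} t * t)
        = (LINT t|scalar_measure x. indicator {c<..} t * t - indicator {d<..} t * t)"
      by (rule Bochner_Integration.integral_diff[OF int int, symmetric]) auto
    also have "\<dots> = (LINT t|scalar_measure x. indicator ?B t * t)"
      by (rule Bochner_Integration.integral_cong) (use that in \<open>auto split: split_indicator\<close>)
    finally have "h c - h d = X y \<bullet> x - (LINT t|scalar_measure x. indicator ?B t * t)"
      by (simp add: h_def y_def blinfun.bilinear_simps inner_diff_left)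
    then show ?thesis using up lo up' lo' by (simp add: abs_le_iff algebra_simps)
  qed
  have "h (- norm X - 2) = h (norm X + 2)"
    by (rule constant_if_increments_small[of h f, OF inc]) (assumption, rule nn)
  moreover have "h (norm X + 2) = 0"
  proof -
    have "(LINT t|scalar_measure x. indicator {norm X + 2<..} t * t) = (LINT t|scalar_measure x. 0)"
      by (rule integral_cong_AE) (use AE_scalar_measure_bounded[of x] in \<open>auto split: split_indicator\<close>)
    then show ?thesis by (simp add: h_def cut_eq_0)
  qed
  moreover have "h (- norm X - 2) = X x \<bullet> x - (LINT t|scalar_measure x. t)"
  proof -
    have "(LINT t|scalar_measure x. indicator {- norm X - 2<..} t * t) = (LINT t|scalar_measure x. t)"
      by (rule integral_cong_AE) (use AE_scalar_measure_bounded[of x] in \<open>auto split: split_indicator\<close>)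
    then show ?thesis by (simp add: h_def cut_eq_id)
  qed
  ultimately show ?thesis by simp
qed

end

section \<open>Adjoints in complex Hilbert spaces\<close>

text \<open>
  The representing vector minimizes \<open>\<langle>x, x\<rangle> - 2 f x\<close>. Minimizing sequences are Cauchy by the
  parallelogram identity, and stationarity at the minimum is the claim.
\<close>

lemma riesz_representation:
  fixes f :: "'a::{real_inner,banach} \<Rightarrow> real"
  assumes "bounded_linear f"
  obtains v where "\<And>x. f x = x \<bullet> v"
proof -
  interpret f: bounded_linear f by fact
  define J where "J x = x \<bullet> x - 2 * f x" for x
  define m where "m = Inf (range J)"
  have bdd: "bdd_below (range J)"
  proof -
    obtain K where K: "\<And>x. norm (f x) \<le> norm x * K" using f.bounded by blast
    have "- (K^2) \<le> J x" for x
    proof -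
      have "f x \<le> norm x * K" using K[of x] by simp
      moreover have "0 \<le> (norm x - K)^2" by simp
      ultimately show ?thesis
        by (simp add: J_def dot_square_norm power2_eq_square algebra_simps)
    qed
    then show ?thesis by (intro bdd_belowI[of _ "- (K^2)"]) auto
  qed
  have m: "m \<le> J x" for x unfolding m_def by (rule cInf_lower[OF _ bdd]) simp
  have "\<exists>x. J x < m + 1 / real (Suc n)" for n
    using cInf_lessD[of "range J" "m + 1 / real (Suc n)"] by (auto simp: m_def)
  then obtain u where u: "\<And>n. J (u n) < m + 1 / real (Suc n)" by metis
  have par: "(norm (x - y))\<^sup>2 \<le> 2 * J x + 2 * J y - 4 * m" for x y
  proof -
    have "(norm (x - y))\<^sup>2 = 2 * J x + 2 * J y - 4 * J ((1/2) *\<^sub>R (x + y))"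
      by (simp add: J_def power2_norm_eq_inner f.add f.diff f.scaleR inner_add_left inner_add_right
          inner_diff_left inner_diff_right inner_commute[of y x] algebra_simps)
    then show ?thesis using m[of "(1/2) *\<^sub>R (x + y)"] by linarith
  qed
  have "Cauchy u"
    unfolding Cauchy_iff
  proof (intro allI impI)
    fix e :: real assume "e > 0"
    then obtain N where N: "4 / e^2 < real N" using reals_Archimedean2 by blast
    show "\<exists>N. \<forall>i\<ge>N. \<forall>j\<ge>N. norm (u i - u j) < e"
    proof (intro exI[of _ N] allI impI)
      fix i j assume ij: "i \<ge> N" "j \<ge> N"
      have small: "1 / real (Suc k) < e^2 / 4" if "k \<ge> N" for k
      proof -
        have "4 / e^2 < real (Suc k)" using N that by (simp add: less_le_trans)
        then show ?thesis using \<open>e > 0\<close> by (simp add: field_simps)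
      qed
      have "(norm (u i - u j))\<^sup>2 < e^2"
        using par[of "u i" "u j"] u[of i] u[of j] small[OF ij(1)] small[OF ij(2)] by linarith
      then show "norm (u i - u j) < e" using \<open>e > 0\<close> by (simp add: power2_less_imp_less)
    qed
  qed
  then obtain v where v: "u \<longlonglongrightarrow> v" using Cauchy_convergent convergent_def by blast
  have "J v \<le> m + 0"
  proof (rule LIMSEQ_le)
    show "(\<lambda>n. J (u n)) \<longlonglongrightarrow> J v" unfolding J_def by (intro tendsto_intros f.tendsto v)
    show "(\<lambda>n. m + 1 / real (Suc n)) \<longlonglongrightarrow> m + 0" by (intro tendsto_intros LIMSEQ_Suc[OF lim_1_over_n])
  qed (use u in \<open>auto intro: less_imp_le\<close>)
  then have Jv: "J v \<le> J x" for x using m[of x] by simp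
  show ?thesis
  proof
    fix x
    define b where "b = x \<bullet> v - f x"
    have quad: "0 \<le> t^2 * (x \<bullet> x) + 2 * t * b" for t
      using Jv[of "v + t *\<^sub>R x"]
      by (simp add: J_def b_def f.add f.scaleR inner_add_left inner_add_right power2_eq_square inner_commute[of v x] algebra_simps)
    have "b = 0"
    proof (rule ccontr)
      assume "b \<noteq> 0"
      let ?s = "x \<bullet> x + 1"
      have s: "?s > 0" by (simp add: add_nonneg_pos)
      \<comment> \<open>a small step against the sign of \<open>b\<close> would lower the minimum; \<open>1/?s\<close> is small enough\<close>
      have "0 \<le> (- b / ?s)^2 * (x \<bullet> x) + 2 * (- b / ?s) * b" by (rule quad)
      also have "\<dots> \<le> (- b / ?s)^2 * ?s + 2 * (- b / ?s) * b" by (simp add: mult_left_mono)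
      also have "\<dots> = - (b^2 / ?s)" using s by (simp add: power2_eq_square divide_simps)
      finally show False using s \<open>b \<noteq> 0\<close> by (simp add: divide_le_0_iff)
    qed
    then show "f x = x \<bullet> v" by (simp add: b_def)
  qed
qed

lemma operator_of_bilinear_form:
  fixes B :: "'a::{real_inner,banach} \<Rightarrow> 'a \<Rightarrow> real"
  assumes "\<And>x x' y. B (x + x') y = B x y + B x' y" "\<And>r x y. B (r *\<^sub>R x) y = r * B x y"
    and "\<And>x y y'. B x (y + y') = B x y + B x y'" "\<And>r x y. B x (r *\<^sub>R y) = r * B x y"
    and bd: "\<And>x y. \<bar>B x y\<bar> \<le> k * norm x * norm y" and k: "0 \<le> k"
  obtains T :: "'a \<Rightarrow>\<^sub>L 'a" where "\<And>x y. B x y = T x \<bullet> y" "norm T \<le> k"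
proof -
  have "\<exists>v. \<forall>y. B x y = y \<bullet> v" for x
  proof -
    have "bounded_linear (B x)"
      by (rule bounded_linear_intro[where K = "k * norm x"])
        (use assms(3,4) bd[of x] in \<open>auto simp: mult.commute\<close>)
    then show ?thesis using riesz_representation by metis
  qed
  then obtain t where t: "\<And>x y. B x y = y \<bullet> t x" by metis
  have eq: "u = v" if "\<And>y. y \<bullet> u = y \<bullet> v" for u v :: 'a
  proof -
    have "(u - v) \<bullet> (u - v) = 0" using that[of "u - v"] by (simp add: inner_diff_right)
    then show ?thesis by simp
  qed
  have nt: "norm (t x) \<le> k * norm x" for x
  proof (cases "t x = 0")
    case False
    have "norm (t x) * norm (t x) = B x (t x)" by (simp add: t dot_square_norm power2_eq_square)
    also have "\<dots> \<le> k * norm x * norm (t x)" using bd[of x "t x"] by linarith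
    finally show ?thesis using False by simp
  qed (use k in simp)
  have "bounded_linear t"
  proof (rule bounded_linear_intro[where K = k])
    show "t (x + y) = t x + t y" for x y
      by (rule eq) (simp add: t[symmetric] inner_add_right assms)
    show "t (r *\<^sub>R x) = r *\<^sub>R t x" for r x
      by (rule eq) (simp add: t[symmetric] assms)
  qed (use nt in \<open>simp add: mult.commute\<close>)
  then have "blinfun_apply (Blinfun t) = t" by (simp add: bounded_linear_Blinfun_apply)
  then show ?thesis
    using nt by (intro that[of "Blinfun t"]) (auto simp: t inner_commute intro!: norm_blinfun_bound k)
qed

lemma cinner_scaleC_right: "cinner x (a *\<^sub>C y) = cnj a * cinner x (y::'h::complex_hilbert_space)"
  by (subst (1 2) cinner_commute) (simp add: cinner_scaleC_left)

lemma Im_cinner: "Im (cinner x y) = inner x (\<i> *\<^sub>C y)"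
  by (simp add: inner_eq_Re_cinner cinner_scaleC_right)

lemma inner_ii: "inner (\<i> *\<^sub>C x) y = - inner x (\<i> *\<^sub>C y)" for x :: "'h::complex_hilbert_space"
  by (simp add: inner_eq_Re_cinner cinner_scaleC_right cinner_scaleC_left)

text \<open>
  Reduces complex inner products to the underlying real one, for which the operator theory above was
  developed.
\<close>

lemma cinner_eq_inner: "cinner x y = Complex (inner x y) (inner x (\<i> *\<^sub>C y))"
  by (simp add: complex_eq_iff inner_eq_Re_cinner[symmetric] Im_cinner)

lemma bounded_operators_scaleC:
  fixes T :: "'h::complex_hilbert_space \<Rightarrow>\<^sub>L 'h"
  shows "T \<in> bounded_operators \<Longrightarrow> T (a *\<^sub>C x) = a *\<^sub>C T x"
  by (simp add: bounded_operators_def)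

lemma scaleC_eq: "a *\<^sub>C x = Re a *\<^sub>R x + Im a *\<^sub>R \<i> *\<^sub>C (x::'h::complex_hilbert_space)"
proof -
  have "a *\<^sub>C x = (complex_of_real (Re a) + complex_of_real (Im a) * \<i>) *\<^sub>C x"
    by (metis complex_eq mult.commute)
  then show ?thesis by (simp only: scaleC_add_left scaleC_scaleC[symmetric] scaleR_scaleC[symmetric])
qed

lemma bounded_operatorsI:
  fixes T :: "'h::complex_hilbert_space \<Rightarrow>\<^sub>L 'h"
  shows "(\<And>x. T (\<i> *\<^sub>C x) = \<i> *\<^sub>C T x) \<Longrightarrow> T \<in> bounded_operators"
  unfolding bounded_operators_def mem_Collect_eq
  by (intro allI, subst (1 2) scaleC_eq) (simp add: blinfun.bilinear_simps)

lemma cinner_adjointI: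
  fixes S T :: "'h::complex_hilbert_space \<Rightarrow>\<^sub>L 'h"
  assumes "S \<in> bounded_operators" "\<And>x y. T x \<bullet> y = x \<bullet> S y"
  shows "cinner (T x) y = cinner x (S y)"
  using assms(2)[of x] by (simp add: cinner_eq_inner bounded_operators_scaleC[OF assms(1), symmetric])

lemma cadjoint_eqI:
  fixes S T :: "'h::complex_hilbert_space \<Rightarrow>\<^sub>L 'h"
  assumes "\<And>x y. cinner (T x) y = cinner x (S y)"
  shows "cadjoint T = S"
  unfolding cadjoint_def
proof (rule the_equality)
  show "\<forall>x y. cinner (T x) y = cinner x (S y)" using assms by blast
  fix S' :: "'h \<Rightarrow>\<^sub>L 'h" assume S': "\<forall>x y. cinner (T x) y = cinner x (S' y)"
  show "S' = S"
  proof (rule blinfun_eqI)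
    fix y
    have "cinner x (S' y) = cinner x (S y)" for x using assms S' by metis
    then have "x \<bullet> S' y = x \<bullet> S y" for x by (simp add: inner_eq_Re_cinner)
    then have "x \<bullet> (S' y - S y) = 0" for x by (simp add: inner_diff_right)
    then show "S' y = S y" by (metis eq_iff_diff_eq_0 inner_eq_zero_iff)
  qed
qed

lemma cadjoint:
  fixes T :: "'h::complex_hilbert_space \<Rightarrow>\<^sub>L 'h"
  assumes "T \<in> bounded_operators"
  shows "cadjoint T \<in> bounded_operators" "cinner (T x) y = cinner x (cadjoint T y)"
    "T x \<bullet> y = x \<bullet> cadjoint T y" "norm (cadjoint T) \<le> norm T"
proof -
  obtain S :: "'h \<Rightarrow>\<^sub>L 'h" where S: "\<And>x y. x \<bullet> T y = S x \<bullet> y" "norm S \<le> norm T"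
  proof (rule operator_of_bilinear_form[of "\<lambda>x y. x \<bullet> T y" "norm T"])
    show "\<bar>x \<bullet> T y\<bar> \<le> norm T * norm x * norm y" for x y
    proof -
      have "\<bar>x \<bullet> T y\<bar> \<le> norm x * norm (T y)" by (rule Cauchy_Schwarz_ineq2)
      also have "\<dots> \<le> norm x * (norm T * norm y)" by (intro mult_left_mono norm_blinfun) auto
      finally show ?thesis by (simp add: mult_ac)
    qed
  qed (auto simp: blinfun.bilinear_simps inner_add_left inner_add_right)
  have SC: "S \<in> bounded_operators"
  proof (rule bounded_operatorsI)
    fix x
    have "S (\<i> *\<^sub>C x) \<bullet> y = (\<i> *\<^sub>C S x) \<bullet> y" for y
      by (simp add: S(1)[symmetric] inner_ii bounded_operators_scaleC[OF assms, symmetric])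
    then have "(S (\<i> *\<^sub>C x) - \<i> *\<^sub>C S x) \<bullet> y = 0" for y by (simp add: inner_diff_left)
    then show "S (\<i> *\<^sub>C x) = \<i> *\<^sub>C S x" by (metis eq_iff_diff_eq_0 inner_eq_zero_iff)
  qed
  have c: "cinner (T x) y = cinner x (S y)" for x y
    by (rule cinner_adjointI[OF SC]) (metis S(1) inner_commute)
  have eq: "cadjoint T = S" using c by (rule cadjoint_eqI)
  show "cadjoint T \<in> bounded_operators" "cinner (T x) y = cinner x (cadjoint T y)"
    "norm (cadjoint T) \<le> norm T" using SC c S(2) by (auto simp: eq)
  show "T x \<bullet> y = x \<bullet> cadjoint T y" using c by (simp add: eq inner_eq_Re_cinner)
qed

lemma cadjoint_eq_iff_symmetric:
  assumes "T \<in> bounded_operators"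
  shows "cadjoint T = T \<longleftrightarrow> symmetric_op T"
proof
  assume "symmetric_op T"
  then show "cadjoint T = T"
    using assms by (intro cadjoint_eqI cinner_adjointI) (auto simp: symmetric_op_def)
next
  assume "cadjoint T = T"
  then show "symmetric_op T" using cadjoint(3)[OF assms] by (simp add: symmetric_op_def)
qed

lemma strong_algebra_bounded_operators:
  assumes "X \<in> bounded_operators" "T \<in> strong_algebra X"
  shows "T \<in> bounded_operators"
  using strong_algebra_commute[OF assms(2) bounded_linear_scaleC] bounded_operators_scaleC[OF assms(1)]
  by (auto simp: bounded_operators_def)

section \<open>The spectral theorem for self-adjoint operators\<close>

locale self_adjoint_operator = symmetric_operator X
  for X :: "'h::complex_hilbert_space \<Rightarrow>\<^sub>L 'h" +
  assumes complex_linear: "X \<in> bounded_operators"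
begin

lemma proj_bounded: "proj P \<Longrightarrow> P \<in> bounded_operators"
  using projD(1) strong_algebra_bounded_operators[OF complex_linear] by blast

lemma proj_cadjoint: "proj P \<Longrightarrow> cadjoint P = P"
  using projD(4) cadjoint_eq_iff_symmetric[OF proj_bounded] by blast

lemma form_real: "cinner (X x) x = complex_of_real (X x \<bullet> x)"
proof -
  have "cinner (X x) x = cinner x (X x)"
    by (rule cinner_adjointI[OF complex_linear]) (use symmetric in \<open>simp add: symmetric_op_def\<close>)
  then have "Im (cinner (X x) x) = 0" by (metis cinner_commute cnj.simps(2) neg_equal_zero)
  then show ?thesis by (simp add: complex_eq_iff inner_eq_Re_cinner)
qed

lemma spectral_measure_exists:
  "is_spectral_measure_of (\<lambda>B. E (complex_of_real -` B)) X"
proof -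
  let ?G = "\<lambda>B. E (complex_of_real -` B)"
  have b: "complex_of_real -` B \<in> sets borel" if "B \<in> sets borel" for B
    using measurable_sets[OF borel_measurable_of_real that] by simp
  have scalar: "scalar_spectral_measure ?G x = distr (scalar_measure x) borel complex_of_real" for x
  proof -
    have "scalar_spectral_measure ?G x
        = measure_of UNIV (sets borel) (emeasure (distr (scalar_measure x) borel complex_of_real))"
      unfolding scalar_spectral_measure_def
    proof (rule measure_of_eq)
      fix B :: "complex set" assume "B \<in> sigma_sets UNIV (sets borel)"
      then have B: "B \<in> sets borel" by (metis sets.sigma_sets_eq space_borel)
      have "emeasure (distr (scalar_measure x) borel complex_of_real) B = emeasure (scalar_measure x) (complex_of_real -` B)"
        using B by (subst emeasure_distr) auto
      then show "ennreal (Re (cinner (?G B x) x)) = emeasure (distr (scalar_measure x) borel complex_of_real) B"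
        using E(2)[OF b[OF B], of x]
        by (simp add: finite_measure.emeasure_eq_measure[OF finite_scalar_measure] inner_eq_Re_cinner)
    qed simp
    also have "\<dots> = distr (scalar_measure x) borel complex_of_real"
      using measure_of_of_measure[of "distr (scalar_measure x) borel complex_of_real"] by simp
    finally show ?thesis .
  qed
  have sm: "spectral_measure ?G"
    unfolding spectral_measure_def
  proof (intro conjI ballI allI impI)
    fix B :: "complex set" assume B: "B \<in> sets borel"
    show "?G B \<in> bounded_operators" "cadjoint (?G B) = ?G B"
      by (rule proj_bounded proj_cadjoint, rule E, rule b[OF B])+
    show "?G B o\<^sub>L ?G B = ?G B"
      using projD(2)[OF E(1)[OF b[OF B]]] by (intro blinfun_eqI) simp
  next
    show "?G UNIV = id_blinfun" by (simp add: E_UNIV)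
  next
    fix A B :: "complex set" assume "A \<in> sets borel" "B \<in> sets borel"
    then show "?G (A \<inter> B) = ?G A o\<^sub>L ?G B" using E_Int[OF b b] by simp
  next
    fix B :: "nat \<Rightarrow> complex set" and x
    assume "range B \<subseteq> sets borel" "disjoint_family B"
    then show "(\<lambda>n. ?G (B n) x) sums ?G (\<Union>n. B n) x"
      using E_sums[of "\<lambda>n. complex_of_real -` B n" x] b
      by (simp add: vimage_UN image_subset_iff disjoint_family_on_def vimage_Int[symmetric] del: vimage_Int)
  qed
  have "?G (cball 0 (norm X + 1)) = id_blinfun"
  proof (rule E_eqI)
    show "complex_of_real -` cball 0 (norm X + 1) \<in> sets borel" by (rule b) simp
    fix x
    have "measure (scalar_measure x) (complex_of_real -` cball 0 (norm X + 1)) = measure (scalar_measure x) UNIV"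
      by (rule finite_measure.finite_measure_eq_AE[OF finite_scalar_measure])
        (use AE_scalar_measure_bounded[of x] b[of "cball 0 (norm X + 1)"] in \<open>auto elim!: eventually_mono\<close>)
    then show "id_blinfun x \<bullet> x = measure (scalar_measure x) (complex_of_real -` cball 0 (norm X + 1))"
      by (simp add: measure_scalar_measure_UNIV)
  qed (rule proj_one)
  moreover have "cinner (X x) x = (LINT z|scalar_spectral_measure ?G x. z)" for x
    unfolding scalar form_real form_eq_integral
    by (subst integral_distr) (auto simp: integral_complex_of_real)
  ultimately show ?thesis using sm by (auto simp: is_spectral_measure_of_def)
qed

text \<open>
  All that has to be shown is that \<open>G(c, \<infinity>)\<close> is a spectral cut. It commutes with \<open>X\<close> because, for
  \<open>a\<close> in its range and \<open>b\<close> in its kernel, the scalar measures of \<open>a + b\<close> and \<open>a - b\<close> coincide; so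
  the forms of \<open>X\<close> at these two vectors agree, that is, \<open>\<langle>X a, b\<rangle> = 0\<close>. The two inequalities
  follow by integrating the real part of \<open>z\<close>, once \<open>G\<close> is known to live on the real line; it does,
  since the imaginary part of \<open>z\<close> integrates to the imaginary part of \<open>\<langle>X y, y\<rangle>\<close>, which is \<open>0\<close>.
\<close>

lemma spectral_measure_of_half_line:
  assumes "is_spectral_measure_of G X"
  shows "G (complex_of_real ` {c<..}) = cut c"
proof -
  have sm: "spectral_measure G" and int: "\<And>x. cinner (X x) x = (LINT z|scalar_spectral_measure G x. z)"
    using assms by (auto simp: is_spectral_measure_of_def)
  obtain r where r: "G (cball 0 r) = id_blinfun" using assms by (auto simp: is_spectral_measure_of_def)
  define N where "N = scalar_spectral_measure G"
  have G: "G B \<in> bounded_operators" "symmetric_op (G B)" "G B (G B x) = G B x" if "B \<in> sets borel" for B x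
  proof -
    show *: "G B \<in> bounded_operators" using sm that by (simp add: spectral_measure_def)
    show "symmetric_op (G B)"
      using sm that cadjoint_eq_iff_symmetric[OF *] by (simp add: spectral_measure_def)
    have "G B o\<^sub>L G B = G B" using sm that by (simp add: spectral_measure_def)
    then show "G B (G B x) = G B x" by (metis blinfun_apply_blinfun_compose)
  qed
  have GU: "G UNIV = id_blinfun" using sm by (simp add: spectral_measure_def)
  have GI: "G (A \<inter> B) x = G A (G B x)" if "A \<in> sets borel" "B \<in> sets borel" for A B x
    using sm that by (simp add: spectral_measure_def)
  have Gcomm: "G A (G B x) = G B (G A x)" if "A \<in> sets borel" "B \<in> sets borel" for A B x
    using GI[OF that] GI[OF that(2,1)] by (simp add: Int_commute)
  have Gsums: "(\<lambda>n. G (B n) x) sums G (\<Union>n. B n) x"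
    if "range B \<subseteq> sets borel" "disjoint_family B" for B :: "nat \<Rightarrow> complex set" and x
    using sm that by (simp add: spectral_measure_def)
  have form: "G B x \<bullet> x = G B x \<bullet> G B x" if "B \<in> sets borel" for B x
    using G[OF that] by (metis symmetric_op_def)
  have setsN: "sets (N x) = sets borel" and spaceN: "space (N x) = UNIV" for x
    using sets.sigma_sets_eq[of "borel :: complex measure"] by (simp_all add: N_def scalar_spectral_measure_def)
  have emN: "emeasure (N x) B = ennreal (G B x \<bullet> x)" if B: "B \<in> sets borel" for x B
  proof (rule emeasure_measure_of[where \<Omega> = UNIV and A = "sets borel"])
    show "N x = measure_of UNIV (sets borel) (\<lambda>B. ennreal (G B x \<bullet> x))"
      by (simp add: N_def scalar_spectral_measure_def inner_eq_Re_cinner)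
    have "(\<lambda>n. G {} x) sums G {} x" using Gsums[of "\<lambda>_. {}" x] by (simp add: disjoint_family_on_def)
    then have "(\<lambda>n. G {} x) \<longlonglongrightarrow> 0" by (intro summable_LIMSEQ_zero sums_summable)
    then have "G {} x = 0" by (simp add: LIMSEQ_const_iff)
    then show "positive (sets (N x)) (\<lambda>B. ennreal (G B x \<bullet> x))" by (simp add: positive_def)
    show "countably_additive (sets (N x)) (\<lambda>B. ennreal (G B x \<bullet> x))"
      unfolding countably_additive_def setsN
    proof (intro allI impI)
      fix A :: "nat \<Rightarrow> complex set" assume A: "range A \<subseteq> sets borel" "disjoint_family A"
      have s: "(\<lambda>n. G (A n) x \<bullet> x) sums (G (\<Union>n. A n) x \<bullet> x)"
        by (rule bounded_linear.sums[OF bounded_linear_inner_left Gsums[OF A]])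
      show "(\<Sum>i. ennreal (G (A i) x \<bullet> x)) = ennreal (G (\<Union> (range A)) x \<bullet> x)"
        using sums_unique[OF s] sums_summable[OF s] A form[of "A _" x]
        by (subst suminf_ennreal2) auto
    qed
  qed (use B setsN in auto)
  have finN: "finite_measure (N x)" for x
    by (rule finite_measureI) (simp add: spaceN emN)
  have bN: "AE z in N x. norm z \<le> r" for x
  proof (rule AE_I)
    show "{z \<in> space (N x). \<not> norm z \<le> r} \<subseteq> UNIV - cball 0 r" by auto
    have "emeasure (N x) (UNIV - cball 0 r) = emeasure (N x) UNIV - emeasure (N x) (cball 0 r)"
      by (rule emeasure_Diff) (auto simp: setsN emN)
    then show "emeasure (N x) (UNIV - cball 0 r) = 0" by (simp add: emN GU r)
  qed (simp add: setsN)
  have intN: "integrable (N x) (\<lambda>z. z)" for x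
    by (rule finite_measure.integrable_const_bound[OF finN bN]) (simp add: setsN cong: measurable_cong_sets)
  have AEN: "AE z in N x. z \<in> B" if "B \<in> sets borel" "G B x = x" for x B
  proof (rule AE_I)
    show "{z \<in> space (N x). z \<notin> B} \<subseteq> UNIV - B" by auto
    have "emeasure (N x) (UNIV - B) = emeasure (N x) UNIV - emeasure (N x) B"
      by (rule emeasure_Diff) (use that in \<open>auto simp: setsN emN\<close>)
    then show "emeasure (N x) (UNIV - B) = 0" using that by (simp add: emN GU)
  qed (use that setsN in simp)
  have AEN': "AE z in N x. z \<notin> B" if "B \<in> sets borel" "G B x = 0" for x B
    by (rule AE_I[of _ _ B]) (use that setsN emN in auto)
  have lower: "c * (x \<bullet> x) < \<phi> (cinner (X x) x)"
    if "B \<in> sets borel" "G B x = x" "x \<noteq> 0" "\<And>z. z \<in> B \<Longrightarrow> c < \<phi> z" "bounded_linear \<phi>" for B x c and \<phi> :: "complex \<Rightarrow> real"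
  proof -
    have "\<phi> (cinner (X x) x) = (LINT z|N x. \<phi> z)"
      unfolding int N_def[symmetric] by (rule integral_bounded_linear[OF that(5) intN, symmetric])
    moreover have "(LINT z|N x. c) < (LINT z|N x. \<phi> z)"
    proof (rule finite_measure.integral_less_AE_space[OF finN])
      show "AE z in N x. c < \<phi> z" using AEN[OF that(1,2)] by eventually_elim (rule that(4))
      show "emeasure (N x) (space (N x)) \<noteq> 0" using that(3) by (simp add: spaceN emN GU)
      show "integrable (N x) \<phi>" by (rule integrable_bounded_linear[OF that(5) intN])
    qed (simp add: finite_measure.integrable_const[OF finN])
    moreover have "measure (N x) UNIV = x \<bullet> x" by (simp add: measure_def emN GU)
    ultimately show ?thesis by (simp add: spaceN mult.commute)
  qed
  define B where "B = complex_of_real ` {c<..}"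
  have Beq: "B = {z. Im z = 0} \<inter> {z. c < Re z}"
    by (auto simp: B_def image_iff complex_eq_iff)
  have borel: "B \<in> sets borel" "{z. 0 < Im z} \<in> sets borel" "{z. Im z < 0} \<in> sets borel"
  proof -
    have "closed {z. Im z = 0}" "open {z. c < Re z}" "open {z. 0 < Im z}" "open {z. Im z < 0}"
      by (intro closed_Collect_eq open_Collect_less continuous_intros)+
    then show "B \<in> sets borel" "{z. 0 < Im z} \<in> sets borel" "{z. Im z < 0} \<in> sets borel"
      unfolding Beq by auto
  qed
  \<comment> \<open>the open upper and lower half-planes carry no mass\<close>
  have G0: "G A x = 0" if "A \<in> {{z. 0 < Im z}, {z. Im z < 0}}" for A x
  proof (rule ccontr)
    assume ne: "G A x \<noteq> 0"
    have A: "A \<in> sets borel" using that borel by auto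
    from that consider "A = {z. 0 < Im z}" | "A = {z. Im z < 0}" by auto
    then show False
    proof cases
      case 1
      show False using lower[OF A G(3)[OF A] ne, of 0 Im] 1 by (auto simp: form_real bounded_linear_Im)
    next
      case 2
      show False using lower[OF A G(3)[OF A] ne, of 0 "\<lambda>z. - Im z"] 2
        by (auto simp: form_real intro: bounded_linear_minus bounded_linear_Im)
    qed
  qed
  have "spectral_cut X c (G B)"
    unfolding spectral_cut_def
  proof (intro conjI allI impI)
    show "symmetric_op (G B)" "G B (G B x) = G B x" for x by (rule G[OF borel(1)])+
    have sy: "G A u \<bullet> v = u \<bullet> G A v" if "A \<in> sets borel" for A u v
      using G(2)[OF that] by (simp add: symmetric_op_def)
    have Xs: "X u \<bullet> v = X v \<bullet> u" for u v using symmetric by (simp add: symmetric_op_def inner_commute)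
    have orth: "X (G B u) \<bullet> (v - G B v) = 0" for u v
    proof -
      define a where "a = G B u"
      define b where "b = v - G B v"
      have a: "G B a = a" and b: "G B b = 0" by (simp_all add: a_def b_def G[OF borel(1)] blinfun.bilinear_simps)
      have ab: "G A a \<bullet> b = 0" "G A b \<bullet> a = 0" if "A \<in> sets borel" for A
      proof -
        have "G A a = G B (G A a)" using Gcomm[OF that borel(1), of a] a by simp
        then show *: "G A a \<bullet> b = 0" using sy[OF borel(1), of "G A a" b] b by simp
        show "G A b \<bullet> a = 0" using * sy[OF that, of b a] by (simp add: inner_commute)
      qed
      have "N (a + b) = N (a - b)"
      proof (rule measure_eqI)
        fix A assume "A \<in> sets (N (a + b))"
        then have A: "A \<in> sets borel" by (simp add: setsN)
        show "emeasure (N (a + b)) A = emeasure (N (a - b)) A"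
          by (simp add: emN A blinfun.bilinear_simps inner_add_left inner_add_right inner_diff_left inner_diff_right ab[OF A])
      qed (simp add: setsN)
      then have "cinner (X (a + b)) (a + b) = cinner (X (a - b)) (a - b)"
        unfolding int N_def[symmetric] by simp
      then have "X (a + b) \<bullet> (a + b) = X (a - b) \<bullet> (a - b)" by (simp add: inner_eq_Re_cinner)
      then show ?thesis
        using Xs[of a b] by (simp add: blinfun.bilinear_simps inner_add_left inner_add_right inner_diff_left inner_diff_right a_def[symmetric] b_def[symmetric])
    qed
    show "G B (X x) = X (G B x)" for x
    proof -
      have "G B (X x) \<bullet> v = X (G B x) \<bullet> v" for v
      proof -
        have "G B (X x) \<bullet> v = X (G B v) \<bullet> x" using sy[OF borel(1), of "X x" v] Xs[of x "G B v"] by simp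
        also have "\<dots> = X (G B v) \<bullet> G B x" using orth[of v x] by (simp add: inner_diff_right)
        also have "\<dots> = X (G B x) \<bullet> G B v" by (rule Xs)
        also have "\<dots> = X (G B x) \<bullet> v" using orth[of x v] by (simp add: inner_diff_right)
        finally show ?thesis .
      qed
      then have "(G B (X x) - X (G B x)) \<bullet> v = 0" for v by (simp add: inner_diff_left)
      then show ?thesis by (metis eq_iff_diff_eq_0 inner_eq_zero_iff)
    qed
    show "c * (x \<bullet> x) < X x \<bullet> x" if "G B x = x" "x \<noteq> 0" for x
      using lower[OF borel(1) that, of c Re] by (auto simp: Beq form_real bounded_linear_Re)
    show "X x \<bullet> x \<le> c * (x \<bullet> x)" if "G B x = 0" for x
    proof -
      have "AE z in N x. Re z \<le> c"
        using AEN'[OF borel(1) that] AEN'[OF borel(2) G0[OF insertI1], of x] AEN'[OF borel(3) G0[OF insertI2[OF singletonI]], of x]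
        by eventually_elim (auto simp: Beq)
      moreover have "X x \<bullet> x = (LINT z|N x. Re z)"
      proof -
        have "Re (cinner (X x) x) = (LINT z|N x. Re z)"
          unfolding int N_def[symmetric] by (rule integral_bounded_linear[OF bounded_linear_Re intN, symmetric])
        then show ?thesis by (simp add: inner_eq_Re_cinner)
      qed
      moreover have "measure (N x) UNIV = x \<bullet> x" by (simp add: measure_def emN GU)
      ultimately show ?thesis
        using integral_mono_AE[of "N x" Re "\<lambda>_. c"] integrable_bounded_linear[OF bounded_linear_Re intN, of x]
          finite_measure.integrable_const[OF finN, of x c]
        by (simp add: spaceN mult.commute)
    qed
  qed
  then show ?thesis
    unfolding B_def by (rule spectral_cut_unique[OF cut])
qed

text \<open>
  The definition by unique existence therefore denotes the intended projection.
\<close>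

lemma spectral_projection_half_line:
  "spectral_projection (complex_of_real ` {c<..}) X = cut c"
  unfolding spectral_projection_def
proof (rule the_equality)
  show "\<exists>E. is_spectral_measure_of E X \<and> cut c = E (complex_of_real ` {c<..})"
    using spectral_measure_exists spectral_measure_of_half_line[OF spectral_measure_exists, of c] by metis
qed (use spectral_measure_of_half_line in auto)

end

section \<open>The weak operator topology on bounded sets\<close>

lemma topspace_WOT [simp]: "topspace weak_operator_topology = UNIV"
  unfolding weak_operator_topology_def by (auto intro!: exI[of _ UNIV])

lemma WOT_subbasis: "\<Union> {{T :: 'h::complex_hilbert_space \<Rightarrow>\<^sub>L 'h. cinner (blinfun_apply T x) y \<in> U} | x y U. open U} = UNIV"
  using topspace_WOT unfolding weak_operator_topology_def topology_generated_by_topspace .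

lemma openin_WOT_coefficient:
  "open U \<Longrightarrow> openin weak_operator_topology {T. cinner (blinfun_apply T x) y \<in> U}"
  unfolding weak_operator_topology_def by (rule topology_generated_by_Basis) blast

lemma continuous_map_coefficient:
  "continuous_map weak_operator_topology euclidean (\<lambda>T. cinner (blinfun_apply T x) y)"
  using openin_WOT_coefficient[of _ x y] by (auto simp: continuous_map_def)

lemma strong_limit_WOT:
  fixes U :: "nat \<Rightarrow> 'h::complex_hilbert_space \<Rightarrow>\<^sub>L 'h" and T :: "'h \<Rightarrow>\<^sub>L 'h"
  assumes "\<And>x. (\<lambda>n. U n x) \<longlonglongrightarrow> T x"
  shows "limitin weak_operator_topology U T sequentially"
  unfolding limitin_def
proof (intro conjI allI impI)
  fix V assume "openin weak_operator_topology V \<and> T \<in> V"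
  then have "generate_topology_on {{T. cinner (blinfun_apply T x) y \<in> U} | x y U. open U} V" and "T \<in> V"
    by (auto simp: weak_operator_topology_def openin_topology_generated_by_iff)
  then show "\<forall>\<^sub>F n in sequentially. U n \<in> V"
  proof (induction V)
    case (Int a b) then show ?case by (auto intro: eventually_conj)
  next
    case (UN K) 
    then obtain s where s: "s \<in> K" "T \<in> s" by blast
    then have "\<forall>\<^sub>F n in sequentially. U n \<in> s" using UN by blast
    then show ?case by (rule eventually_mono) (use s in blast)
  next
    case (Basis s)
    then obtain x y V where s: "s = {T. cinner (blinfun_apply T x) y \<in> V}" "open V" by blast
    have "(\<lambda>n. cinner (U n x) y) \<longlonglongrightarrow> cinner (T x) y"
      unfolding cinner_eq_inner by (intro tendsto_Complex tendsto_inner assms tendsto_const)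
    then show ?case using topological_tendstoD[of _ _ _ V] Basis s by auto
  qed auto
qed simp

text \<open>
  Operators of norm at most \<open>k\<close> correspond to real bilinear forms \<open>\<phi>\<close> with
  \<open>|\<phi> (x, y)| \<le> k \<parallel>x\<parallel> \<parallel>y\<parallel>\<close> that are compatible with multiplication by \<open>\<i>\<close>. These forms are a closed
  subset of a product of compact intervals, compact by Tychonoff's theorem, and coefficients of the
  operator depend continuously on the form.
\<close>

lemma compactin_WOT_ball:
  assumes k: "0 \<le> k"
  shows "compactin weak_operator_topology {T \<in> bounded_operators. norm (T :: 'h::complex_hilbert_space \<Rightarrow>\<^sub>L 'h) \<le> k}"
proof -
  define box :: "('h \<times> 'h \<Rightarrow> real) set" where "box = (\<Pi>\<^sub>E p\<in>UNIV. cball 0 (k * norm (fst p) * norm (snd p)))"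
  define forms :: "('h \<times> 'h \<Rightarrow> real) set" where "forms =
    {\<phi>. (\<forall>x x' y. \<phi> (x + x', y) = \<phi> (x, y) + \<phi> (x', y)) \<and> (\<forall>r x y. \<phi> (r *\<^sub>R x, y) = r * \<phi> (x, y)) \<and>
      (\<forall>x y y'. \<phi> (x, y + y') = \<phi> (x, y) + \<phi> (x, y')) \<and> (\<forall>r x y. \<phi> (x, r *\<^sub>R y) = r * \<phi> (x, y)) \<and>
      (\<forall>x y. \<phi> (\<i> *\<^sub>C x, y) = - \<phi> (x, \<i> *\<^sub>C y))}"
  have "compact box"
    using compactin_PiE[of "\<lambda>_. euclidean :: real topology" UNIV "\<lambda>p::'h\<times>'h. cball 0 (k * norm (fst p) * norm (snd p))"]
    by (simp add: box_def euclidean_product_topology)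
  moreover have "closed forms"
    unfolding forms_def
    by (intro closed_Collect_conj closed_Collect_all closed_Collect_eq continuous_intros
        continuous_on_product_coordinates)
  ultimately have cpt: "compact (box \<inter> forms)" by (rule compact_Int_closed)
  define op :: "('h \<times> 'h \<Rightarrow> real) \<Rightarrow> 'h \<Rightarrow>\<^sub>L 'h" where "op \<phi> = (SOME T. T \<in> bounded_operators \<and> norm T \<le> k \<and> (\<forall>x y. \<phi> (x, y) = T x \<bullet> y))" for \<phi>
  have op: "op \<phi> \<in> bounded_operators \<and> norm (op \<phi>) \<le> k \<and> (\<forall>x y. \<phi> (x, y) = op \<phi> x \<bullet> y)" if "\<phi> \<in> box \<inter> forms" for \<phi>
    unfolding op_def
  proof (rule someI_ex)
    note \<phi> = that
    obtain T :: "'h \<Rightarrow>\<^sub>L 'h" where T: "\<And>x y. \<phi> (x, y) = T x \<bullet> y" "norm T \<le> k"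
    proof (rule operator_of_bilinear_form[of "\<lambda>x y. \<phi> (x, y)" k])
      show "\<bar>\<phi> (x, y)\<bar> \<le> k * norm x * norm y" for x y
        using \<phi> by (auto simp: box_def PiE_def Pi_def dist_real_def)
    qed (use \<phi> k in \<open>auto simp: forms_def\<close>)
    have "T \<in> bounded_operators"
    proof (rule bounded_operatorsI)
      fix x
      have "\<phi> (\<i> *\<^sub>C x, y) = - \<phi> (x, \<i> *\<^sub>C y)" for y using that by (simp add: forms_def)
      then have "(T (\<i> *\<^sub>C x) - \<i> *\<^sub>C T x) \<bullet> y = 0" for y by (simp add: T inner_diff_left inner_ii)
      then show "T (\<i> *\<^sub>C x) = \<i> *\<^sub>C T x" by (metis eq_iff_diff_eq_0 inner_eq_zero_iff)
    qed
    then show "\<exists>T. T \<in> bounded_operators \<and> norm T \<le> k \<and> (\<forall>x y. \<phi> (x, y) = T x \<bullet> y)" using T by blast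
  qed
  have "continuous_map (top_of_set (box \<inter> forms)) weak_operator_topology op"
    unfolding weak_operator_topology_def
  proof (rule continuous_on_generated_topo)
    fix W :: "('h \<Rightarrow>\<^sub>L 'h) set" assume "W \<in> {{T. cinner (blinfun_apply T x) y \<in> U} | x y U. open U}"
    then obtain x y U where W: "W = {T. cinner (blinfun_apply T x) y \<in> U}" "open U" by blast
    let ?c = "\<lambda>\<phi>. Complex (\<phi> (x, y)) (\<phi> (x, \<i> *\<^sub>C y))"
    have "cinner (op \<phi> x) y = ?c \<phi>" if "\<phi> \<in> box \<inter> forms" for \<phi>
      using op[OF that] by (simp add: cinner_eq_inner)
    then have "op -` W \<inter> topspace (top_of_set (box \<inter> forms)) = (box \<inter> forms) \<inter> ?c -` U"
      unfolding W by auto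
    moreover have "continuous_on UNIV ?c"
      unfolding Complex_eq by (intro continuous_intros continuous_on_product_coordinates)
    ultimately show "openin (top_of_set (box \<inter> forms)) (op -` W \<inter> topspace (top_of_set (box \<inter> forms)))"
      using W(2) by (simp add: openin_open_Int open_vimage)
  next
    show "op ` topspace (top_of_set (box \<inter> forms)) \<subseteq> \<Union> {{T. cinner (blinfun_apply T x) y \<in> U} | x y U. open U}"
      unfolding WOT_subbasis by simp
  qed
  then have "compactin weak_operator_topology (op ` (box \<inter> forms))"
    using cpt by (intro image_compactin[of "top_of_set (box \<inter> forms)"]) (simp_all add: compactin_subtopology)
  moreover have "op ` (box \<inter> forms) = {T \<in> bounded_operators. norm T \<le> k}"
  proof
    show "op ` (box \<inter> forms) \<subseteq> {T \<in> bounded_operators. norm T \<le> k}" using op by blast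
    show "{T \<in> bounded_operators. norm T \<le> k} \<subseteq> op ` (box \<inter> forms)"
    proof
      fix T :: "'h \<Rightarrow>\<^sub>L 'h" assume T: "T \<in> {T \<in> bounded_operators. norm T \<le> k}"
      define \<phi> where "\<phi> = (\<lambda>p. T (fst p) \<bullet> snd p)"
      have "\<bar>T x \<bullet> y\<bar> \<le> k * norm x * norm y" for x y
      proof -
        have "\<bar>T x \<bullet> y\<bar> \<le> norm (T x) * norm y" by (rule Cauchy_Schwarz_ineq2)
        also have "\<dots> \<le> (k * norm x) * norm y"
          using T by (intro mult_right_mono order_trans[OF norm_blinfun]) auto
        finally show ?thesis .
      qed
      then have \<phi>: "\<phi> \<in> box \<inter> forms"
        using T by (auto simp: box_def forms_def \<phi>_def PiE_def Pi_def dist_real_def blinfun.bilinear_simps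
            inner_add_left inner_add_right bounded_operators_scaleC inner_ii)
      have "op \<phi> = T"
      proof (rule blinfun_eqI)
        fix x
        have "\<phi> (x, y) = T x \<bullet> y" for y by (simp add: \<phi>_def)
        then have "(op \<phi> x - T x) \<bullet> y = 0" for y
          using op[OF \<phi>] by (simp add: inner_diff_left)
        then show "op \<phi> x = T x" by (metis eq_iff_diff_eq_0 inner_eq_zero_iff)
      qed
      then show "T \<in> op ` (box \<inter> forms)" using \<phi> by blast
    qed
  qed
  ultimately show ?thesis by simp
qed

lemma norm_cinner_le: "norm (cinner x y) \<le> 2 * norm x * norm (y::'h::complex_hilbert_space)"
proof -
  have "norm (cinner x y) \<le> \<bar>inner x y\<bar> + \<bar>inner x (\<i> *\<^sub>C y)\<bar>"
    using cmod_le[of "cinner x y"] by (simp add: cinner_eq_inner)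
  also have "\<dots> \<le> norm x * norm y + norm x * norm (\<i> *\<^sub>C y)"
    by (intro add_mono Cauchy_Schwarz_ineq2)
  finally show ?thesis by (simp add: norm_scaleC)
qed

text \<open>
  On bounded sets, the series defining ultraweakly open sets converge uniformly by the Weierstrass
  test, so they are continuous in the weak operator topology.
\<close>

lemma ultraweak_continuous_WOT_on_bounded:
  fixes \<tau> :: "('h::complex_hilbert_space \<Rightarrow>\<^sub>L 'h) \<Rightarrow> complex"
  assumes "continuous_map (subtopology ultraweak_topology M) euclidean \<tau>"
    and "S \<subseteq> M" and bd: "\<And>T. T \<in> S \<Longrightarrow> norm T \<le> k"
  shows "continuous_map (subtopology weak_operator_topology S) euclidean \<tau>"
proof -
  let ?B = "{{T. (\<Sum>n. cinner (blinfun_apply T (x n)) (y n)) \<in> U} | x y U.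
      summable (\<lambda>n::nat. (norm (x n :: 'h))\<^sup>2) \<and> summable (\<lambda>n. (norm (y n))\<^sup>2) \<and> open U}"
  have "continuous_map (subtopology weak_operator_topology S) ultraweak_topology id"
    unfolding ultraweak_topology_def
  proof (rule continuous_on_generated_topo)
    fix W :: "('h \<Rightarrow>\<^sub>L 'h) set" assume "W \<in> ?B"
    then obtain x y :: "nat \<Rightarrow> 'h" and U where W: "W = {T. (\<Sum>n. cinner (blinfun_apply T (x n)) (y n)) \<in> U}"
      and xy: "summable (\<lambda>n. (norm (x n))\<^sup>2)" "summable (\<lambda>n. (norm (y n))\<^sup>2)" and U: "open U" by blast
    let ?f = "\<lambda>n T. cinner (blinfun_apply T (x n)) (y n)"
    have "norm (?f n T) \<le> \<bar>k\<bar> * ((norm (x n))\<^sup>2 + (norm (y n))\<^sup>2)" if "T \<in> S" for n T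
    proof -
      have "norm (?f n T) \<le> 2 * norm (T (x n)) * norm (y n)" by (rule norm_cinner_le)
      also have "\<dots> \<le> 2 * (\<bar>k\<bar> * norm (x n)) * norm (y n)"
        using bd[OF that] by (intro mult_right_mono mult_left_mono order_trans[OF norm_blinfun]) auto
      also have "\<dots> = \<bar>k\<bar> * (2 * norm (x n) * norm (y n))" by simp
      also have "\<dots> \<le> \<bar>k\<bar> * ((norm (x n))\<^sup>2 + (norm (y n))\<^sup>2)"
        by (intro mult_left_mono sum_squares_bound) auto
      finally show ?thesis .
    qed
    moreover have "summable (\<lambda>n. \<bar>k\<bar> * ((norm (x n))\<^sup>2 + (norm (y n))\<^sup>2))"
      by (intro summable_mult summable_add xy)
    ultimately have ul: "uniform_limit S (\<lambda>n T. \<Sum>i<n. ?f i T) (\<lambda>T. \<Sum>i. ?f i T) sequentially"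
      by (rule Weierstrass_m_test)
    have part: "continuous_map (subtopology weak_operator_topology S) euclidean (\<lambda>T. \<Sum>i<n. ?f i T)" for n
      by (intro continuous_map_sum continuous_map_from_subtopology continuous_map_coefficient) auto
    show "openin (subtopology weak_operator_topology S) (id -` W \<inter> topspace (subtopology weak_operator_topology S))"
    proof (subst openin_subopen, intro ballI)
      fix T assume "T \<in> id -` W \<inter> topspace (subtopology weak_operator_topology S)"
      then have T: "T \<in> S" "(\<Sum>n. ?f n T) \<in> U" by (auto simp: W)
      then obtain e where e: "e > 0" "ball (\<Sum>n. ?f n T) e \<subseteq> U" using U by (meson open_contains_ball)
      then have "e / 3 > 0" by simp
      then have "\<forall>\<^sub>F n in sequentially. \<forall>T\<in>S. dist (\<Sum>i<n. ?f i T) (\<Sum>i. ?f i T) < e / 3"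
        by (rule uniform_limitD[OF ul])
      then obtain n where n: "\<And>T. T \<in> S \<Longrightarrow> dist (\<Sum>i<n. ?f i T) (\<Sum>i. ?f i T) < e / 3"
        unfolding eventually_sequentially by blast
      let ?V = "{T' \<in> topspace (subtopology weak_operator_topology S). (\<Sum>i<n. ?f i T') \<in> ball (\<Sum>i<n. ?f i T) (e/3)}"
      have "openin (subtopology weak_operator_topology S) ?V"
        by (rule openin_continuous_map_preimage[OF part]) simp
      moreover have "T \<in> ?V" using T e by simp
      moreover have "?V \<subseteq> id -` W \<inter> topspace (subtopology weak_operator_topology S)"
      proof
        fix T' assume T': "T' \<in> ?V"
        then have "T' \<in> S" by simp
        have "dist (\<Sum>i. ?f i T) (\<Sum>i. ?f i T')
            \<le> dist (\<Sum>i. ?f i T) (\<Sum>i<n. ?f i T) + (dist (\<Sum>i<n. ?f i T) (\<Sum>i<n. ?f i T') + dist (\<Sum>i<n. ?f i T') (\<Sum>i. ?f i T'))"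
          by (meson add_left_mono dist_triangle order_trans)
        also have "\<dots> < e" using n[OF T(1)] n[OF \<open>T' \<in> S\<close>] T' by (simp add: dist_commute)
        finally show "T' \<in> id -` W \<inter> topspace (subtopology weak_operator_topology S)"
          using e(2) T' by (auto simp: W)
      qed
      ultimately show "\<exists>V. openin (subtopology weak_operator_topology S) V \<and> T \<in> V \<and> V \<subseteq> id -` W \<inter> topspace (subtopology weak_operator_topology S)"
        by blast
    qed
  next
    have "UNIV \<in> ?B"
      by (rule CollectI, rule exI[of _ "\<lambda>_. 0"], rule exI[of _ "\<lambda>_. 0"], rule exI[of _ UNIV]) simp
    then show "id ` topspace (subtopology weak_operator_topology S) \<subseteq> \<Union> ?B" by blast
  qed
  then have "continuous_map (subtopology weak_operator_topology S) (subtopology ultraweak_topology M) id"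
    using assms(2) by (auto simp: continuous_map_in_subtopology)
  from continuous_map_compose[OF this assms(1)] show ?thesis by simp
qed

section \<open>Traces of positive operators\<close>

locale tracial_algebra =
  fixes M :: "('h::complex_hilbert_space \<Rightarrow>\<^sub>L 'h) set" and \<tau> :: "('h \<Rightarrow>\<^sub>L 'h) \<Rightarrow> complex"
  assumes tracial: "tracial_von_neumann_algebra M \<tau>"
begin

lemma vN: "von_neumann_algebra M"
  using tracial by (simp add: tracial_von_neumann_algebra_def)

lemma M_bounded: "A \<in> M \<Longrightarrow> A \<in> bounded_operators"
  and M_one: "id_blinfun \<in> M"
  and M_add: "A \<in> M \<Longrightarrow> B \<in> M \<Longrightarrow> A + B \<in> M"
  and M_scaleC: "A \<in> M \<Longrightarrow> scaleC_blinfun a A \<in> M"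
  and M_comp: "A \<in> M \<Longrightarrow> B \<in> M \<Longrightarrow> A o\<^sub>L B \<in> M"
  and M_adj: "A \<in> M \<Longrightarrow> cadjoint A \<in> M"
  and M_closed: "closedin weak_operator_topology M"
  using vN by (auto simp: von_neumann_algebra_def)

lemma scaleR_scaleC_blinfun: "r *\<^sub>R A = scaleC_blinfun (complex_of_real r) (A :: 'h \<Rightarrow>\<^sub>L 'h)"
  by (rule blinfun_eqI) (simp add: scaleC_blinfun.rep_eq blinfun.bilinear_simps scaleR_scaleC)

lemma M_scaleR: "A \<in> M \<Longrightarrow> r *\<^sub>R A \<in> M"
  by (simp add: scaleR_scaleC_blinfun M_scaleC)

lemma M_diff: "A \<in> M \<Longrightarrow> B \<in> M \<Longrightarrow> A - B \<in> M"
  using M_add[of A "(-1) *\<^sub>R B"] M_scaleR[of B "-1"] by simp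

lemmas M_intros = M_one M_add M_scaleR M_comp M_diff M_adj

lemma M_strong_limit:
  assumes "\<And>n. U n \<in> M" "\<And>x. (\<lambda>n. blinfun_apply (U n) x) \<longlonglongrightarrow> blinfun_apply T x"
  shows "T \<in> M"
  by (rule limitin_closedin[OF strong_limit_WOT[OF assms(2)] M_closed]) (auto simp: assms(1))

lemma strong_algebra_M: 
  assumes "X \<in> M" shows "strong_algebra X \<subseteq> M"
proof
  fix A assume "A \<in> strong_algebra X"
  then show "A \<in> M" by induction (auto intro: M_intros assms M_strong_limit)
qed

definition re_tau :: "('h \<Rightarrow>\<^sub>L 'h) \<Rightarrow> real" where "re_tau A = Re (\<tau> A)"

lemma tau_add: "A \<in> M \<Longrightarrow> B \<in> M \<Longrightarrow> \<tau> (A + B) = \<tau> A + \<tau> B"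
  and tau_scaleC: "A \<in> M \<Longrightarrow> \<tau> (scaleC_blinfun a A) = a * \<tau> A"
  and tau_one: "\<tau> id_blinfun = 1"
  and tau_pos: "A \<in> M \<Longrightarrow> \<tau> (cadjoint A o\<^sub>L A) \<in> \<real> \<and> 0 \<le> Re (\<tau> (cadjoint A o\<^sub>L A))"
  and tau_faithful: "A \<in> M \<Longrightarrow> \<tau> (cadjoint A o\<^sub>L A) = 0 \<Longrightarrow> A = 0"
  and tau_comm: "A \<in> M \<Longrightarrow> B \<in> M \<Longrightarrow> \<tau> (A o\<^sub>L B) = \<tau> (B o\<^sub>L A)"
  and tau_continuous: "continuous_map (subtopology ultraweak_topology M) euclidean \<tau>"
  using tracial by (auto simp: tracial_von_neumann_algebra_def)

lemma tau_scaleR: "A \<in> M \<Longrightarrow> \<tau> (r *\<^sub>R A) = complex_of_real r * \<tau> A"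
  by (simp add: scaleR_scaleC_blinfun tau_scaleC)

lemma tau_diff: "A \<in> M \<Longrightarrow> B \<in> M \<Longrightarrow> \<tau> (A - B) = \<tau> A - \<tau> B"
  using tau_add[of A "(-1) *\<^sub>R B"] M_scaleR[of B "-1"] tau_scaleR[of B "-1"] by simp

lemma re_tau_simps: "A \<in> M \<Longrightarrow> B \<in> M \<Longrightarrow> re_tau (A + B) = re_tau A + re_tau B"
  "A \<in> M \<Longrightarrow> B \<in> M \<Longrightarrow> re_tau (A - B) = re_tau A - re_tau B"
  "A \<in> M \<Longrightarrow> re_tau (r *\<^sub>R A) = r * re_tau A" "re_tau id_blinfun = 1"
  "A \<in> M \<Longrightarrow> B \<in> M \<Longrightarrow> re_tau (A o\<^sub>L B) = re_tau (B o\<^sub>L A)"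
  by (simp_all add: re_tau_def tau_add tau_diff tau_scaleR tau_one tau_comm)

text \<open>
  Positivity and faithfulness of the trace are formulated for operators \<open>A\<^sup>* A\<close>; square roots carry
  them over to operators with a positive quadratic form.
\<close>

lemma sqrt_in_M:
  assumes "A \<in> M" "positive_op A"
  obtains R where "R \<in> M" "symmetric_op R" "cadjoint R = R" "R o\<^sub>L R = A"
proof -
  obtain R where R: "R \<in> strong_algebra A" "positive_op R" "\<And>x. R (R x) = A x"
    using positive_op_sqrt[OF _ strong_algebra.gen assms(2)] assms(2) by (metis positive_op_def)
  have "R \<in> M" using R(1) strong_algebra_M[OF assms(1)] by blast
  moreover have "symmetric_op R" using R(2) by (simp add: positive_op_def)
  moreover have "R o\<^sub>L R = A" by (rule blinfun_eqI) (simp add: R)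
  ultimately show ?thesis using that cadjoint_eq_iff_symmetric[OF M_bounded] by blast
qed

lemma tau_positive:
  assumes "A \<in> M" "positive_op A"
  shows "Im (\<tau> A) = 0" "0 \<le> re_tau A" "re_tau A = 0 \<Longrightarrow> A = 0"
proof -
  obtain R where R: "R \<in> M" "cadjoint R = R" "R o\<^sub>L R = A" using sqrt_in_M[OF assms] by metis
  show im: "Im (\<tau> A) = 0" and "0 \<le> re_tau A"
    using tau_pos[OF R(1)] by (auto simp: R re_tau_def complex_is_Real_iff)
  show "A = 0" if "re_tau A = 0"
  proof -
    have "\<tau> (cadjoint R o\<^sub>L R) = 0" using im that by (simp add: R re_tau_def complex_eq_iff)
    then have "R = 0" by (rule tau_faithful[OF R(1)])
    then show "A = 0" using R(3) by simp
  qed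
qed

text \<open>
  With \<open>A = R\<^sup>2\<close> and \<open>B = S\<^sup>2\<close>, the trace of \<open>A B\<close> is that of \<open>(R S)\<^sup>* (R S)\<close>.
\<close>

lemma re_tau_product_nonneg:
  assumes "A \<in> M" "positive_op A" "B \<in> M" "positive_op B"
  shows "0 \<le> re_tau (A o\<^sub>L B)"
proof -
  obtain R where R: "R \<in> M" "symmetric_op R" "R o\<^sub>L R = A" using sqrt_in_M[OF assms(1,2)] by metis
  obtain S where S: "S \<in> M" "symmetric_op S" "S o\<^sub>L S = B" using sqrt_in_M[OF assms(3,4)] by metis
  have SRM: "S o\<^sub>L R \<in> M" "R o\<^sub>L S \<in> M" by (intro M_intros R S)+
  have "cadjoint (R o\<^sub>L S) = S o\<^sub>L R"
    by (intro cadjoint_eqI cinner_adjointI M_bounded SRM) (use R(2) S(2) in \<open>simp add: symmetric_op_def\<close>)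
  then have "0 \<le> re_tau ((S o\<^sub>L R) o\<^sub>L (R o\<^sub>L S))" using tau_pos[OF SRM(2)] by (simp add: re_tau_def)
  also have "(S o\<^sub>L R) o\<^sub>L (R o\<^sub>L S) = S o\<^sub>L (A o\<^sub>L S)"
    by (rule blinfun_eqI) (simp add: R(3)[symmetric])
  also have "re_tau (S o\<^sub>L (A o\<^sub>L S)) = re_tau ((A o\<^sub>L S) o\<^sub>L S)" by (intro re_tau_simps M_intros assms S)
  also have "(A o\<^sub>L S) o\<^sub>L S = A o\<^sub>L B" by (rule blinfun_eqI) (simp add: S(3)[symmetric])
  finally show ?thesis .
qed

lemma positive_norm_minus:
  assumes "symmetric_op A" shows "positive_op (norm A *\<^sub>R id_blinfun - A)"
  using assms abs_form_le[of A]
  by (auto simp: positive_op_def symmetric_op_def blinfun.bilinear_simps inner_diff_left inner_diff_right abs_le_iff)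

lemma tau_symmetric_real:
  assumes "A \<in> M" "symmetric_op A" shows "Im (\<tau> A) = 0"
proof -
  have "Im (\<tau> (norm A *\<^sub>R id_blinfun - A)) = 0"
    by (rule tau_positive[OF _ positive_norm_minus[OF assms(2)]]) (intro M_intros assms)
  then show ?thesis using assms(1) by (simp add: tau_diff tau_scaleR tau_one M_scaleR M_one)
qed

lemma re_tau_symmetric_le_norm:
  assumes "A \<in> M" "symmetric_op A" shows "re_tau A \<le> norm A"
proof -
  have "0 \<le> re_tau (norm A *\<^sub>R id_blinfun - A)"
    by (rule tau_positive[OF _ positive_norm_minus[OF assms(2)]]) (intro M_intros assms)
  then show ?thesis using assms(1) by (simp add: re_tau_simps M_scaleR M_one)
qed

text \<open>
  Only the symmetric part of \<open>A\<close> contributes to the real part of the trace.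
\<close>

lemma re_tau_le_norm:
  assumes "A \<in> M" shows "re_tau A \<le> norm A"
proof -
  let ?A' = "cadjoint A"
  have A': "?A' \<in> M" by (rule M_adj[OF assms])
  have ad: "A x \<bullet> y = x \<bullet> ?A' y" "?A' x \<bullet> y = x \<bullet> A y" for x y
    using cadjoint(3)[OF M_bounded[OF assms]] by (auto simp: inner_commute)
  have ii: "y \<bullet> \<i> *\<^sub>C A x = - (x \<bullet> \<i> *\<^sub>C ?A' y)" for x y
  proof -
    have "y \<bullet> \<i> *\<^sub>C A x = - (A x \<bullet> \<i> *\<^sub>C y)" using inner_ii[of y "A x"] by (simp add: inner_commute)
    also have "A x \<bullet> \<i> *\<^sub>C y = x \<bullet> \<i> *\<^sub>C ?A' y"
      by (simp add: ad bounded_operators_scaleC[OF M_bounded[OF A']])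
    finally show ?thesis .
  qed
  have "symmetric_op (scaleC_blinfun \<i> (A - ?A'))"
    unfolding symmetric_op_def
  proof (intro allI)
    fix x y
    have "scaleC_blinfun \<i> (A - ?A') x \<bullet> y = y \<bullet> \<i> *\<^sub>C A x - y \<bullet> \<i> *\<^sub>C ?A' x"
      by (simp add: scaleC_blinfun.rep_eq blinfun.bilinear_simps bounded_linear.linear[OF bounded_linear_scaleC, THEN linear_diff] inner_diff_right inner_commute[of _ y])
    also have "\<dots> = x \<bullet> \<i> *\<^sub>C A y - x \<bullet> \<i> *\<^sub>C ?A' y"
      using ii[of y x] ii[of x y] by simp
    also have "\<dots> = x \<bullet> scaleC_blinfun \<i> (A - ?A') y"
      by (simp add: scaleC_blinfun.rep_eq blinfun.bilinear_simps bounded_linear.linear[OF bounded_linear_scaleC, THEN linear_diff] inner_diff_right)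
    finally show "scaleC_blinfun \<i> (A - ?A') x \<bullet> y = x \<bullet> scaleC_blinfun \<i> (A - ?A') y" .
  qed
  then have "Im (\<tau> (scaleC_blinfun \<i> (A - ?A'))) = 0"
    by (intro tau_symmetric_real M_scaleC M_diff assms A')
  then have "re_tau A = re_tau ?A'" by (simp add: tau_scaleC M_diff assms A' tau_diff re_tau_def)
  then have "re_tau A = re_tau ((1/2) *\<^sub>R (A + ?A'))" by (simp add: re_tau_simps M_add assms A')
  also have "\<dots> \<le> norm ((1/2) *\<^sub>R (A + ?A'))"
    by (intro re_tau_symmetric_le_norm M_intros assms)
      (auto simp: symmetric_op_def blinfun.bilinear_simps inner_add_left inner_add_right ad)
  also have "\<dots> \<le> norm A"
    using norm_triangle_ineq[of A ?A'] cadjoint(4)[OF M_bounded[OF assms]] by simp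
  finally show ?thesis .
qed

lemma norm_scaleC_blinfun_le: "norm (scaleC_blinfun a (A :: 'h \<Rightarrow>\<^sub>L 'h)) \<le> cmod a * norm A"
  by (rule norm_blinfun_bound)
    (auto simp: scaleC_blinfun.rep_eq norm_scaleC mult.assoc intro!: mult_left_mono norm_blinfun)

lemma cmod_tau_le:
  assumes "A \<in> M" shows "cmod (\<tau> A) \<le> norm A"
proof (cases "\<tau> A = 0")
  case False
  \<comment> \<open>the phase that makes the trace real and nonnegative\<close>
  define u where "u = cnj (\<tau> A) / cmod (\<tau> A)"
  have u: "cmod u = 1" using False by (simp add: u_def norm_divide)
  have "u * \<tau> A = cmod (\<tau> A)"
    using False by (simp add: u_def complex_norm_square[symmetric] mult.commute[of "cnj _"] power2_eq_square)
  then have "cmod (\<tau> A) = re_tau (scaleC_blinfun u A)" by (simp add: re_tau_def tau_scaleC assms)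
  also have "\<dots> \<le> norm (scaleC_blinfun u A)" by (intro re_tau_le_norm M_scaleC assms)
  also have "\<dots> \<le> norm A" using norm_scaleC_blinfun_le[of u A] u by simp
  finally show ?thesis .
qed simp

lemma continuous_map_tau_comp:
  assumes A: "A \<in> M"
  shows "continuous_map (subtopology weak_operator_topology {X \<in> M. norm X \<le> k}) euclidean (\<lambda>X. \<tau> (X o\<^sub>L A))"
proof -
  have "continuous_map weak_operator_topology weak_operator_topology (\<lambda>X. X o\<^sub>L A)"
  proof (subst (2) weak_operator_topology_def, rule continuous_on_generated_topo)
    fix W :: "('h \<Rightarrow>\<^sub>L 'h) set" assume "W \<in> {{T. cinner (blinfun_apply T x) y \<in> U} | x y U. open U}"
    then obtain x y U where W: "W = {T. cinner (blinfun_apply T x) y \<in> U}" "open U" by blast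
    then show "openin weak_operator_topology ((\<lambda>X. X o\<^sub>L A) -` W \<inter> topspace weak_operator_topology)"
      using openin_WOT_coefficient[of U "A x" y] by (simp add: vimage_def)
  next
    show "(\<lambda>X. X o\<^sub>L A) ` topspace weak_operator_topology \<subseteq> \<Union> {{T. cinner (blinfun_apply T x) y \<in> U} | x y U. open U}"
      unfolding WOT_subbasis by simp
  qed
  then have "continuous_map (subtopology weak_operator_topology {X \<in> M. norm X \<le> k})
      (subtopology weak_operator_topology {X \<in> M. norm X \<le> k * norm A}) (\<lambda>X. X o\<^sub>L A)"
    by (auto simp: continuous_map_in_subtopology continuous_map_from_subtopology M_comp A
        intro!: order_trans[OF norm_blinfun_compose] mult_right_mono)
  moreover have "continuous_map (subtopology weak_operator_topology {X \<in> M. norm X \<le> k * norm A}) euclidean \<tau>"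
    by (rule ultraweak_continuous_WOT_on_bounded[OF tau_continuous]) auto
  ultimately have "continuous_map (subtopology weak_operator_topology {X \<in> M. norm X \<le> k}) euclidean (\<tau> \<circ> (\<lambda>X. X o\<^sub>L A))"
    by (rule continuous_map_compose)
  then show ?thesis by (simp add: o_def)
qed

lemma compactin_M_ball: "compactin weak_operator_topology {X \<in> M. norm X \<le> k}"
proof (cases "0 \<le> k")
  case True
  have "compactin weak_operator_topology (M \<inter> {T \<in> bounded_operators. norm T \<le> k})"
    by (rule closed_Int_compactin[OF M_closed compactin_WOT_ball[OF True]])
  also have "M \<inter> {T \<in> bounded_operators. norm T \<le> k} = {X \<in> M. norm X \<le> k}" using M_bounded by auto
  finally show ?thesis .
next
  case False
  then have "\<not> norm X \<le> k" for X :: "'h \<Rightarrow>\<^sub>L 'h" using norm_ge_zero[of X] by linarith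
  then show ?thesis by simp
qed

lemma re_tau_strong_limit:
  assumes "\<And>n. U n \<in> M" "T \<in> M" "\<And>n. norm (U n) \<le> k" "norm T \<le> k"
    and "\<And>x. (\<lambda>n. blinfun_apply (U n) x) \<longlonglongrightarrow> blinfun_apply T x"
  shows "(\<lambda>n. re_tau (U n)) \<longlonglongrightarrow> re_tau T"
proof -
  have "limitin (subtopology weak_operator_topology {X \<in> M. norm X \<le> k}) U T sequentially"
    using strong_limit_WOT[OF assms(5)] assms by (simp add: limitin_subtopology)
  then have "limitin euclidean ((\<lambda>X. \<tau> (X o\<^sub>L id_blinfun)) \<circ> U) (\<tau> (T o\<^sub>L id_blinfun)) sequentially"
    by (rule continuous_map_limit[OF continuous_map_tau_comp[OF M_one]])
  moreover have "X o\<^sub>L id_blinfun = X" for X :: "'h \<Rightarrow>\<^sub>L 'h" by (rule blinfun_eqI) simp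
  ultimately have "(\<lambda>n. \<tau> (U n)) \<longlonglongrightarrow> \<tau> T" by (simp add: o_def)
  then show ?thesis unfolding re_tau_def by (rule tendsto_Re)
qed

end

section \<open>Majorization and excess integrals\<close>

text \<open>
  Working on \<open>[0, 1)\<close> avoids the endpoint \<open>1\<close>, where the eigenvalue function is an infimum over an
  unbounded set and has no prescribed value.
\<close>

definition unit_interval :: "real measure"
  where "unit_interval = restrict_space lborel {0..<1}"

lemma space_unit_interval [simp]: "space unit_interval = {0..<1}"
  by (simp add: unit_interval_def space_restrict_space)

lemma sets_unit_interval: "A \<in> sets borel \<Longrightarrow> A \<subseteq> {0..<1} \<Longrightarrow> A \<in> sets unit_interval"
  by (auto simp: unit_interval_def sets_restrict_space_iff)

lemma measure_unit_interval:
  assumes "0 \<le> u" "u \<le> 1" shows "emeasure unit_interval {0..<u} = ennreal u"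
  using assms by (simp add: unit_interval_def emeasure_restrict_space)

lemma finite_unit_interval: "finite_measure unit_interval"
  using measure_unit_interval[of 1] by (intro finite_measureI) simp

lemma integral_indicator_unit_interval:
  assumes "0 \<le> u" "u \<le> 1" shows "(LINT s|unit_interval. indicator {0..<u} s * k) = u * (k::real)"
proof -
  have "measure unit_interval {0..<u} = u" using measure_unit_interval[OF assms] assms by (simp add: measure_def)
  moreover have "{0..<u} \<inter> {0..<1} = {0..<u}" using assms by auto
  ultimately show ?thesis by simp
qed

text \<open>
  The properties of \<open>c \<mapsto> \<tau>(1\<^bsub>(c,\<infinity>)\<^esub>(X))\<close> that determine how the eigenvalue function integrates.
\<close>

locale tail_function =
  fixes D :: "real \<Rightarrow> real" and r :: real
  assumes antimono: "c \<le> d \<Longrightarrow> D d \<le> D c"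
    and right_limit: "(\<lambda>n. D (c + 1 / real (Suc n))) \<longlonglongrightarrow> D c"
    and eq_0: "r \<le> c \<Longrightarrow> D c = 0"
    and eq_1: "c < - r \<Longrightarrow> D c = 1"
begin

definition quantile :: "real \<Rightarrow> real" where "quantile s = Inf {t. D t \<le> s}"

lemma D_bounds: "0 \<le> D c" "D c \<le> 1"
  using antimono[of c "max c r"] antimono[of "min c (- r - 1)" c] by (simp_all add: eq_0 eq_1)

text \<open>
  The set of all \<open>t\<close> with \<open>D t \<le> s\<close> is upwards closed, and by right continuity it contains its
  infimum. Thus the superlevel set of the quantile function at level \<open>c\<close> is the interval
  \<open>[0, D c)\<close>.
\<close>

lemma less_quantile_iff:
  assumes "0 \<le> s" "s < 1"
  shows "c < quantile s \<longleftrightarrow> s < D c"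
proof -
  let ?L = "{t. D t \<le> s}"
  have ne: "r \<in> ?L" using assms by (simp add: eq_0)
  have bdd: "bdd_below ?L"
    using assms eq_1 by (intro bdd_belowI[of _ "- r"]) (metis mem_Collect_eq not_le)
  have "D c \<le> s \<longleftrightarrow> quantile s \<le> c"
  proof
    assume "D c \<le> s"
    then show "quantile s \<le> c" unfolding quantile_def by (intro cInf_lower bdd) simp
  next
    assume le: "quantile s \<le> c"
    have "D (c + 1 / real (Suc n)) \<le> s" for n
    proof -
      have "0 < 1 / real (Suc n)" by simp
      then have "Inf ?L < c + 1 / real (Suc n)" using le unfolding quantile_def by linarith
      then obtain t where "D t \<le> s" "t < c + 1 / real (Suc n)" using cInf_lessD[of ?L] ne by blast
      then show ?thesis using antimono[of t "c + 1 / real (Suc n)"] by linarith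
    qed
    then show "D c \<le> s" by (intro LIMSEQ_le_const2[OF right_limit]) auto
  qed
  then show ?thesis by linarith
qed

lemma quantile_bounds:
  assumes "0 \<le> s" "s < 1"
  shows "- r \<le> quantile s" "quantile s \<le> r"
proof -
  show "quantile s \<le> r" using less_quantile_iff[OF assms, of r] assms by (simp add: eq_0)
  have "c < quantile s" if "c < - r" for c using less_quantile_iff[OF assms, of c] assms that by (simp add: eq_1)
  then show "- r \<le> quantile s" by (meson dense not_le order_less_irrefl order_less_trans)
qed

lemma quantile_measurable: "quantile \<in> borel_measurable unit_interval"
proof (rule borel_measurable_iff_greater[THEN iffD2], intro allI)
  fix c
  have "{s \<in> space unit_interval. c < quantile s} = {0..<1} \<inter> {..<D c}"
    by (auto simp: less_quantile_iff)
  then show "{s \<in> space unit_interval. c < quantile s} \<in> sets unit_interval"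
    by (simp add: sets_unit_interval)
qed

definition partial_integral :: "real \<Rightarrow> real" where "partial_integral u = (LINT s|unit_interval. indicator {0..<u} s * quantile s)"

definition excess_integral :: "real \<Rightarrow> real" where "excess_integral c = (LINT s|unit_interval. max 0 (quantile s - c))"

lemma set_integral_quantile:
  assumes "0 \<le> u" "u \<le> 1"
  shows "(LBINT s:{0..u}. quantile s) = partial_integral u"
proof -
  have "partial_integral u = (LINT s|lborel. indicator {0..<1} s *\<^sub>R (indicator {0..<u} s * quantile s))"
    unfolding partial_integral_def unit_interval_def by (rule integral_restrict_space) simp
  also have "\<dots> = (LBINT s:{0..u}. quantile s)"
    unfolding set_lebesgue_integral_def
    by (rule integral_discrete_difference[of "{u}"]) (use assms in \<open>auto split: split_indicator\<close>)
  finally show ?thesis by simp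
qed

lemma integrable_quantile: "integrable unit_interval quantile"
  by (rule finite_measure.integrable_const_bound[OF finite_unit_interval _ quantile_measurable, of "\<bar>r\<bar>"])
    (use quantile_bounds in \<open>force intro!: AE_I2\<close>)

lemma integrable_excess: "integrable unit_interval (\<lambda>s. max 0 (quantile s - c))"
  by (intro integrable_max integrable_const Bochner_Integration.integrable_diff integrable_quantile)
    (simp_all add: finite_measure.integrable_const[OF finite_unit_interval])

lemma integrable_indicator_const: "integrable unit_interval (\<lambda>s. indicator {0..<u} s * (k::real))"
  if "u \<le> 1"
  using integrable_mult_indicator[of "{0..<u}" unit_interval "\<lambda>_. k"] that
  by (simp add: finite_measure.integrable_const[OF finite_unit_interval] sets_unit_interval)

lemma integrable_indicator_quantile: "integrable unit_interval (\<lambda>s. indicator {0..<u} s * quantile s)"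
  if "u \<le> 1"
  using integrable_mult_indicator[of "{0..<u}" unit_interval quantile] that
  by (simp add: integrable_quantile sets_unit_interval)

lemma partial_integral_minus:
  assumes "0 \<le> u" "u \<le> 1"
  shows "partial_integral u - c * u = (LINT s|unit_interval. indicator {0..<u} s * (quantile s - c))"
proof -
  have "(LINT s|unit_interval. indicator {0..<u} s * (quantile s - c))
      = (LINT s|unit_interval. indicator {0..<u} s * quantile s - indicator {0..<u} s * c)"
    by (simp add: right_diff_distrib)
  also have "\<dots> = partial_integral u - (LINT s|unit_interval. indicator {0..<u} s * c)"
    unfolding partial_integral_def by (intro Bochner_Integration.integral_diff integrable_indicator_quantile integrable_indicator_const assms)
  finally show ?thesis unfolding integral_indicator_unit_interval[OF assms] by (simp add: mult.commute)
qed

text \<open>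
  The integral over \<open>[0, u)\<close> of \<open>quantile - c\<close> is at most that of its positive part. Equality holds
  when \<open>[0, u)\<close> separates the values above \<open>c\<close> from those below; for a given \<open>c\<close>,
  \<open>u = D c\<close> does so, and for a given \<open>u\<close>, the value of the quantile function at \<open>u\<close> is a suitable
  \<open>c\<close>. This is the duality behind the Hardy-Littlewood-Polya criterion.
\<close>

lemma partial_integral_le_excess_integral:
  assumes "0 \<le> u" "u \<le> 1"
  shows "partial_integral u - c * u \<le> excess_integral c"
  unfolding partial_integral_minus[OF assms] excess_integral_def
proof (rule integral_mono[OF _ integrable_excess])
  have "integrable unit_interval (\<lambda>s. indicator {0..<u} s * quantile s - indicator {0..<u} s * c)"
    by (intro Bochner_Integration.integrable_diff integrable_indicator_quantile integrable_indicator_const assms)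
  then show "integrable unit_interval (\<lambda>s. indicator {0..<u} s * (quantile s - c))"
    by (simp add: right_diff_distrib)
qed (auto split: split_indicator)

lemma partial_integral_eq_excess_integral:
  assumes "0 \<le> u" "u \<le> 1" "\<And>s. 0 \<le> s \<Longrightarrow> s < u \<Longrightarrow> c \<le> quantile s" "\<And>s. u \<le> s \<Longrightarrow> s < 1 \<Longrightarrow> quantile s \<le> c"
  shows "partial_integral u - c * u = excess_integral c"
  unfolding partial_integral_minus[OF assms(1,2)] excess_integral_def
  by (rule Bochner_Integration.integral_cong[OF refl]) (use assms in \<open>auto split: split_indicator\<close>)

lemma partial_integral_eq_excess_integral_at_D: "partial_integral (D c) - c * D c = excess_integral c"
proof (rule partial_integral_eq_excess_integral[OF D_bounds])
  fix s assume "0 \<le> s" "s < D c"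
  then show "c \<le> quantile s" using less_quantile_iff[of s c] D_bounds(2)[of c] by simp
next
  fix s assume "D c \<le> s" "s < 1"
  then show "quantile s \<le> c" using less_quantile_iff[of s c] D_bounds(1)[of c] by simp
qed

lemma quantile_antimono: "0 \<le> s \<Longrightarrow> s \<le> s' \<Longrightarrow> s' < 1 \<Longrightarrow> quantile s' \<le> quantile s"
  using less_quantile_iff[of s' "quantile s"] less_quantile_iff[of s "quantile s"] by force

lemma partial_integral_eq_excess_integral_somewhere:
  assumes "0 \<le> u" "u \<le> 1"
  obtains c where "partial_integral u - c * u = excess_integral c"
proof (cases "u < 1")
  case True
  have "partial_integral u - quantile u * u = excess_integral (quantile u)"
    by (rule partial_integral_eq_excess_integral[OF assms]) (use assms True quantile_antimono in auto)
  then show ?thesis by (rule that)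
next
  case False
  have "partial_integral u - (- r) * u = excess_integral (- r)"
    by (rule partial_integral_eq_excess_integral[OF assms]) (use assms False quantile_bounds in auto)
  then show ?thesis by (rule that)
qed

lemma excess_integral_eq_0: "r \<le> c \<Longrightarrow> excess_integral c = 0"
  using partial_integral_eq_excess_integral_at_D[of c] by (simp add: eq_0 partial_integral_def)

lemma excess_integral_increment:
  assumes "c \<le> d"
  shows "(d - c) * D d \<le> excess_integral c - excess_integral d" "excess_integral c - excess_integral d \<le> (d - c) * D c"
proof -
  show "(d - c) * D d \<le> excess_integral c - excess_integral d"
    using partial_integral_eq_excess_integral_at_D[of d] partial_integral_le_excess_integral[OF D_bounds, of d c] by (simp add: algebra_simps)
  show "excess_integral c - excess_integral d \<le> (d - c) * D c"
    using partial_integral_eq_excess_integral_at_D[of c] partial_integral_le_excess_integral[OF D_bounds, of c d] by (simp add: algebra_simps)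
qed

text \<open>
  The two functions differ by a function whose increments are at most
  \<open>(d - c) (D c - D d)\<close>, hence by a constant, which is \<open>0\<close> beyond \<open>r\<close>.
\<close>

lemma excess_integral_unique:
  assumes "\<And>c d. c \<le> d \<Longrightarrow> (d - c) * D d \<le> g c - g d" "\<And>c d. c \<le> d \<Longrightarrow> g c - g d \<le> (d - c) * D c"
    and "\<And>c. r \<le> c \<Longrightarrow> g c = 0"
  shows "g c = excess_integral c"
proof -
  have inc: "\<bar>(g c - excess_integral c) - (g d - excess_integral d)\<bar> \<le> (d - c) * (D c - D d)" if "c \<le> d" for c d
    using assms(1,2)[OF that] excess_integral_increment[OF that] by (simp add: abs_le_iff algebra_simps)
  have "(\<lambda>c. g c - excess_integral c) c = (\<lambda>c. g c - excess_integral c) (max c r)"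
    by (rule constant_if_increments_small[of "\<lambda>c. g c - excess_integral c" D, OF inc]) simp_all
  then show ?thesis using assms(3)[of "max c r"] excess_integral_eq_0[of "max c r"] by simp
qed

end

text \<open>
  The criterion of Hardy, Littlewood and Polya. In each direction the inequality between the partial
  integrals and the excess integrals is applied where it is an equality for one of the two functions.
\<close>

lemma majorized_by_iff_excess_le:
  assumes "tail_function D r" "tail_function D' r'"
  shows "majorized_by (tail_function.quantile D) (tail_function.quantile D') \<longleftrightarrow>
    (\<forall>c. tail_function.excess_integral D c \<le> tail_function.excess_integral D' c) \<and> tail_function.partial_integral D 1 = tail_function.partial_integral D' 1"
proof -
  interpret a: tail_function D r by fact
  interpret b: tail_function D' r' by fact
  have "(\<forall>u\<in>{0..1}. a.partial_integral u \<le> b.partial_integral u) \<longleftrightarrow> (\<forall>c. a.excess_integral c \<le> b.excess_integral c)"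
  proof safe
    fix c assume "\<forall>u\<in>{0..1}. a.partial_integral u \<le> b.partial_integral u"
    then have "a.partial_integral (D c) \<le> b.partial_integral (D c)" using a.D_bounds by simp
    then show "a.excess_integral c \<le> b.excess_integral c"
      using a.partial_integral_eq_excess_integral_at_D[of c] b.partial_integral_le_excess_integral[OF a.D_bounds, of c c] by linarith
  next
    fix u :: real assume le: "\<forall>c. a.excess_integral c \<le> b.excess_integral c" and u: "u \<in> {0..1}"
    obtain c where "b.partial_integral u - c * u = b.excess_integral c" using b.partial_integral_eq_excess_integral_somewhere[of u] u by auto
    then show "a.partial_integral u \<le> b.partial_integral u" using a.partial_integral_le_excess_integral[of u c] le[rule_format, of c] u by simp
  qed
  then show ?thesis by (simp add: majorized_by_def a.set_integral_quantile b.set_integral_quantile)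
qed

section \<open>The excess of a self-adjoint operator\<close>

context tracial_algebra
begin

lemma sa_symmetric: "X \<in> self_adjoint_part M \<longleftrightarrow> X \<in> M \<and> symmetric_op X"
  using cadjoint_eq_iff_symmetric[OF M_bounded] by (auto simp: self_adjoint_part_def)

lemma sa_self_adjoint_operator: "X \<in> self_adjoint_part M \<Longrightarrow> self_adjoint_operator X"
  by unfold_locales (auto simp: sa_symmetric M_bounded)

definition effects :: "('h \<Rightarrow>\<^sub>L 'h) set"
  where "effects = {P \<in> M. positive_op P \<and> positive_op (id_blinfun - P)}"

definition excess :: "('h \<Rightarrow>\<^sub>L 'h) \<Rightarrow> real \<Rightarrow> real"
  where "excess X c = re_tau ((X - c *\<^sub>R id_blinfun) o\<^sub>L symmetric_operator.cut X c)"

definition tail :: "('h \<Rightarrow>\<^sub>L 'h) \<Rightarrow> real \<Rightarrow> real"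
  where "tail X c = re_tau (symmetric_operator.cut X c)"

lemma re_tau_shift: "X \<in> M \<Longrightarrow> P \<in> M \<Longrightarrow> re_tau ((X - c *\<^sub>R id_blinfun) o\<^sub>L P) = re_tau (X o\<^sub>L P) - c * re_tau P"
proof -
  assume X: "X \<in> M" "P \<in> M"
  have "(X - c *\<^sub>R id_blinfun) o\<^sub>L P = (X o\<^sub>L P) - c *\<^sub>R P"
    by (rule blinfun_eqI) (simp add: blinfun.bilinear_simps)
  then show ?thesis using X by (simp add: re_tau_simps M_intros)
qed

context
  fixes X assumes X: "X \<in> self_adjoint_part M"
begin

interpretation self_adjoint_operator X by (rule sa_self_adjoint_operator[OF X])

lemma XM: "X \<in> M" using X by (simp add: sa_symmetric)

lemma cut_M: "cut c \<in> M" using cut(1) strong_algebra_M[OF XM] by blast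

lemma cut_effect: "cut c \<in> effects"
  using proj_form_le[OF proj_cut] projD(4)[OF proj_cut] projD(4)[OF proj_compl[OF proj_cut]]
  by (auto simp: effects_def cut_M positive_op_def blinfun.bilinear_simps inner_diff_left)

lemma positive_part:
  "positive_op ((X - c *\<^sub>R id_blinfun) o\<^sub>L cut c)"
  "positive_op (((X - c *\<^sub>R id_blinfun) o\<^sub>L cut c) - (X - c *\<^sub>R id_blinfun))"
proof -
  let ?A = "X - c *\<^sub>R id_blinfun"
  have W: "?A \<in> strong_algebra X" "?A o\<^sub>L cut c \<in> strong_algebra X" "(?A o\<^sub>L cut c) - ?A \<in> strong_algebra X"
    by (intro strong_algebra_intros cut)+
  have pr: "P \<in> strong_algebra X \<Longrightarrow> proj Q \<Longrightarrow> P (Q x) \<bullet> x = P (Q x) \<bullet> Q x" for P Q x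
    using projD(2,3)[of Q] strong_algebra_comm[of P X Q] projD(1)[of Q] by metis
  have Aapp: "?A x = X x - c *\<^sub>R x" for x by (simp add: blinfun.bilinear_simps)
  show "positive_op (?A o\<^sub>L cut c)"
    unfolding positive_op_def
  proof (intro conjI allI strong_algebra_symmetric[OF symmetric] W)
    fix x
    let ?y = "cut c x"
    have "(?A o\<^sub>L cut c) x \<bullet> x = ?A ?y \<bullet> ?y" using pr[OF W(1) proj_cut, of c x] by simp
    also have "\<dots> = X ?y \<bullet> ?y - c * (?y \<bullet> ?y)" by (simp add: Aapp inner_diff_left)
    also have "\<dots> \<ge> 0" using cut_above[of c ?y] projD(2)[OF proj_cut, of c x] by (cases "?y = 0") auto
    finally show "0 \<le> (?A o\<^sub>L cut c) x \<bullet> x" .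
  qed
  show "positive_op ((?A o\<^sub>L cut c) - ?A)"
    unfolding positive_op_def
  proof (intro conjI allI strong_algebra_symmetric[OF symmetric] W)
    fix x
    let ?y = "(id_blinfun - cut c) x"
    have "((?A o\<^sub>L cut c) - ?A) x \<bullet> x = - (?A ?y \<bullet> x)" by (simp add: blinfun.bilinear_simps inner_diff_left)
    also have "\<dots> = - (?A ?y \<bullet> ?y)" using pr[OF W(1) proj_compl[OF proj_cut], of c x] by simp
    also have "\<dots> = c * (?y \<bullet> ?y) - X ?y \<bullet> ?y" by (simp add: Aapp inner_diff_left)
    also have "\<dots> \<ge> 0"
      using cut_below[of c ?y] projD(2)[OF proj_cut, of c x] by (simp add: blinfun.bilinear_simps)
    finally show "0 \<le> ((?A o\<^sub>L cut c) - ?A) x \<bullet> x" .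
  qed
qed

text \<open>
  Write \<open>A = X - c\<close> and let \<open>K\<close> be its positive part. Then \<open>\<tau>(A P) \<le> \<tau>(K P) \<le> \<tau>(K)\<close>, as \<open>K - A\<close>, \<open>K\<close>
  and \<open>1 - P\<close> are positive.
\<close>

lemma excess_max:
  assumes "P \<in> effects"
  shows "re_tau ((X - c *\<^sub>R id_blinfun) o\<^sub>L P) \<le> excess X c"
proof -
  let ?A = "X - c *\<^sub>R id_blinfun"
  let ?K = "?A o\<^sub>L cut c"
  have P: "P \<in> M" "positive_op P" "positive_op (id_blinfun - P)" using assms by (auto simp: effects_def)
  have M: "?A \<in> M" "?K \<in> M" "?K - ?A \<in> M" "id_blinfun - P \<in> M"
    by (intro M_intros XM cut_M P)+
  have "0 \<le> re_tau (?K o\<^sub>L (id_blinfun - P))" by (intro re_tau_product_nonneg positive_part M P)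
  also have "?K o\<^sub>L (id_blinfun - P) = ?K - (?K o\<^sub>L P)" by (rule blinfun_eqI) (simp add: blinfun.bilinear_simps)
  finally have 1: "re_tau (?K o\<^sub>L P) \<le> re_tau ?K" using M P by (simp add: re_tau_simps M_comp)
  have "0 \<le> re_tau ((?K - ?A) o\<^sub>L P)" by (intro re_tau_product_nonneg positive_part M P)
  also have "(?K - ?A) o\<^sub>L P = (?K o\<^sub>L P) - (?A o\<^sub>L P)" by (rule blinfun_eqI) (simp add: blinfun.bilinear_simps)
  finally have "re_tau (?A o\<^sub>L P) \<le> re_tau (?K o\<^sub>L P)" using M P by (simp add: re_tau_simps M_comp)
  then show ?thesis using 1 by (simp add: excess_def)
qed

lemma excess_eq: "excess X c = re_tau (X o\<^sub>L cut c) - c * tail X c"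
  by (simp add: excess_def tail_def re_tau_shift XM cut_M)

text \<open>
  Each bound tests the maximality of one excess with the spectral cut that attains the other.
\<close>

lemma excess_increment:
  assumes "c \<le> d"
  shows "(d - c) * tail X d \<le> excess X c - excess X d" "excess X c - excess X d \<le> (d - c) * tail X c"
  using excess_max[OF cut_effect, of c d] excess_max[OF cut_effect, of d c]
  by (simp_all add: re_tau_shift XM cut_M excess_eq tail_def algebra_simps)

lemma excess_eq_0: "norm X \<le> c \<Longrightarrow> excess X c = 0"
  by (simp add: excess_def cut_eq_0 re_tau_def) (metis re_tau_def re_tau_simps(3) M_one scaleR_zero_left mult_zero_left)

lemma excess_below: "c < - norm X \<Longrightarrow> excess X c = re_tau X - c"
proof -
  assume "c < - norm X"
  then have "excess X c = re_tau (X o\<^sub>L id_blinfun) - c" by (simp add: excess_eq tail_def cut_eq_id re_tau_simps)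
  also have "X o\<^sub>L id_blinfun = X" by (rule blinfun_eqI) simp
  finally show ?thesis .
qed

text \<open>
  Normality of the trace enters here: it makes the tail continuous from the right.
\<close>

lemma tail_function_tail: "tail_function (tail X) (norm X)"
proof
  show "tail X d \<le> tail X c" if "c \<le> d" for c d
  proof -
    have "positive_op (cut c - cut d)"
      using projD(4)[OF proj_diff_cut[OF that]] proj_form_le(1)[OF proj_diff_cut[OF that]]
      by (simp add: positive_op_def)
    then have "0 \<le> re_tau (cut c - cut d)" by (intro tau_positive M_intros cut_M)
    then show ?thesis by (simp add: tail_def re_tau_simps cut_M)
  qed
  have "norm (cut c) \<le> 1" for c
    using proj_form_le(3)[OF proj_cut] by (intro norm_blinfun_bound) auto
  then show "(\<lambda>n. tail X (c + 1 / real (Suc n))) \<longlonglongrightarrow> tail X c" for c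
    unfolding tail_def by (intro re_tau_strong_limit cut_M cut_right_limit)
  show "tail X c = 0" if "norm X \<le> c" for c
    using re_tau_simps(3)[OF M_one, of 0] that by (simp add: tail_def cut_eq_0)
  show "tail X c = 1" if "c < - norm X" for c
    using that by (simp add: tail_def cut_eq_id re_tau_simps)
qed

lemma eigenvalue_function_eq: "eigenvalue_function \<tau> X = tail_function.quantile (tail X)"
  by (rule ext) (simp add: eigenvalue_function_def tail_function.quantile_def[OF tail_function_tail]
      spectral_projection_half_line tail_def re_tau_def)

lemma excess_eq_excess_integral: "excess X c = tail_function.excess_integral (tail X) c"
  by (rule tail_function.excess_integral_unique[OF tail_function_tail])
    (auto intro: excess_increment excess_eq_0)

lemma partial_integral_1_eq_re_tau: "tail_function.partial_integral (tail X) 1 = re_tau X"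
proof -
  interpret tail_function "tail X" "norm X" by (rule tail_function_tail)
  \<comment> \<open>far to the left the positive part of \<open>X - c\<close> is \<open>X - c\<close> itself\<close>
  let ?c = "- norm X - 1"
  have "partial_integral (tail X ?c) - ?c * tail X ?c = excess_integral ?c" by (rule partial_integral_eq_excess_integral_at_D)
  then show ?thesis using excess_eq_excess_integral[of ?c] excess_below[of ?c] eq_1[of ?c] by simp
qed

text \<open>
  The excess is the trace of the positive part, which vanishes by faithfulness.
\<close>

lemma le_if_excess_eq_0:
  assumes "excess X c \<le> 0" shows "X x \<bullet> x \<le> c * (x \<bullet> x)"
proof -
  let ?A = "X - c *\<^sub>R id_blinfun"
  have KM: "?A o\<^sub>L cut c \<in> M" by (intro M_intros XM cut_M)
  have "?A o\<^sub>L cut c = 0"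
    using tau_positive(2,3)[OF KM positive_part(1)] assms by (simp add: excess_def)
  then have "positive_op (- ?A)" using positive_part(2)[of c] by simp
  then have "0 \<le> (- ?A) x \<bullet> x" unfolding positive_op_def by blast
  then show ?thesis by (simp add: blinfun.bilinear_simps inner_diff_left)
qed

text \<open>
  The difference of the excess and the trace of \<open>X - c\<close> is the trace of the negative part, which
  vanishes by faithfulness.
\<close>

lemma ge_if_excess_eq:
  assumes "excess X c \<le> re_tau X - c" shows "c * (x \<bullet> x) \<le> X x \<bullet> x"
proof -
  let ?A = "X - c *\<^sub>R id_blinfun"
  have KM: "?A o\<^sub>L cut c \<in> M" "?A \<in> M" "(?A o\<^sub>L cut c) - ?A \<in> M" by (intro M_intros XM cut_M)+
  have "re_tau ?A = re_tau X - c" by (simp add: re_tau_simps M_intros XM)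
  then have "re_tau ((?A o\<^sub>L cut c) - ?A) \<le> 0" using assms KM by (simp add: re_tau_simps excess_def)
  then have "(?A o\<^sub>L cut c) - ?A = 0"
    using tau_positive(2,3)[OF KM(3) positive_part(2)] by simp
  then have "positive_op ?A" using positive_part(1)[of c] by simp
  then have "0 \<le> ?A x \<bullet> x" unfolding positive_op_def by blast
  then show ?thesis by (simp add: blinfun.bilinear_simps inner_diff_left)
qed

end

lemma majorized_iff:
  assumes "X \<in> self_adjoint_part M" "C \<in> self_adjoint_part M"
  shows "majorized_by (eigenvalue_function \<tau> X) (eigenvalue_function \<tau> C) \<longleftrightarrow>
    (\<forall>c. excess X c \<le> excess C c) \<and> re_tau X = re_tau C"
  using majorized_by_iff_excess_le[OF tail_function_tail[OF assms(1)] tail_function_tail[OF assms(2)]]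
  by (simp add: eigenvalue_function_eq assms excess_eq_excess_integral partial_integral_1_eq_re_tau)

text \<open>
  Beyond the norm of \<open>C\<close>, the excess of \<open>C\<close> is \<open>0\<close> above and \<open>\<tau>(C) - c\<close> below, the smallest
  possible values; this confines \<open>X\<close> to the same interval.
\<close>

lemma norm_le_if_majorized:
  assumes X: "X \<in> self_adjoint_part M" and C: "C \<in> self_adjoint_part M"
    and le: "\<And>c. excess X c \<le> excess C c" and tr: "re_tau X = re_tau C"
  shows "norm X \<le> norm C"
proof (rule field_le_epsilon)
  \<comment> \<open>the lower bound needs \<open>c < - \<parallel>C\<parallel>\<close> strictly, where no part of \<open>C\<close> lies at or below \<open>c\<close>\<close>
  fix e :: real assume e: "e > 0"
  have "X x \<bullet> x \<le> (norm C + e) * (x \<bullet> x)" for x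
    by (rule le_if_excess_eq_0[OF X]) (use le[of "norm C + e"] excess_eq_0[OF C, of "norm C + e"] e in simp)
  moreover have "(- norm C - e) * (x \<bullet> x) \<le> X x \<bullet> x" for x
    by (rule ge_if_excess_eq[OF X])
      (use le[of "- norm C - e"] excess_below[OF C, of "- norm C - e"] tr e in simp)
  ultimately have "\<bar>X x \<bullet> x\<bar> \<le> (norm C + e) * (x \<bullet> x)" for x
    by (simp add: abs_le_iff algebra_simps) (smt (verit))
  then show "norm X \<le> norm C + e"
    using X e by (intro norm_symmetric_le) (auto simp: sa_symmetric)
qed

section \<open>The majorized set and the C-numerical range\<close>

definition majorized_set :: "('h \<Rightarrow>\<^sub>L 'h) \<Rightarrow> ('h \<Rightarrow>\<^sub>L 'h) set"
  where "majorized_set C = {X \<in> self_adjoint_part M.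
    majorized_by (eigenvalue_function \<tau> X) (eigenvalue_function \<tau> C)}"

context
  fixes C assumes C: "C \<in> self_adjoint_part M"
begin

text \<open>
  By \<open>excess_max\<close>, a bound on the excess of \<open>X\<close> is a family of bounds that are affine and weakly
  continuous in \<open>X\<close>. This form makes convexity and compactness visible.
\<close>

lemma majorized_set_iff:
  "X \<in> majorized_set C \<longleftrightarrow> X \<in> M \<and> norm X \<le> norm C \<and> symmetric_op X \<and> re_tau X = re_tau C \<and>
    (\<forall>c. \<forall>P\<in>effects. re_tau (X o\<^sub>L P) - c * re_tau P \<le> excess C c)"
proof -
  have "(\<forall>c. excess X c \<le> excess C c) \<longleftrightarrow> (\<forall>c. \<forall>P\<in>effects. re_tau (X o\<^sub>L P) - c * re_tau P \<le> excess C c)"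
    if X: "X \<in> self_adjoint_part M"
  proof safe
    fix c P assume "\<forall>c. excess X c \<le> excess C c" and P: "P \<in> effects"
    then show "re_tau (X o\<^sub>L P) - c * re_tau P \<le> excess C c"
      using excess_max[OF X P, of c] X P by (simp add: re_tau_shift sa_symmetric effects_def) (meson order_trans)
  next
    fix c assume "\<forall>c. \<forall>P\<in>effects. re_tau (X o\<^sub>L P) - c * re_tau P \<le> excess C c"
    then show "excess X c \<le> excess C c"
      using cut_effect[OF X, of c] excess_eq[OF X, of c] by (simp add: tail_def)
  qed
  then show ?thesis
    using majorized_iff[OF _ C, of X] norm_le_if_majorized[OF _ C, of X]
    by (auto simp: majorized_set_def sa_symmetric)
qed

lemma majorized_set_self: "C \<in> majorized_set C"
  using C by (simp add: majorized_set_def majorized_iff)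

lemma majorized_set_convex:
  assumes X: "X \<in> majorized_set C" and Y: "Y \<in> majorized_set C" and u: "0 \<le> u" "0 \<le> v" "u + v = 1"
  shows "u *\<^sub>R X + v *\<^sub>R Y \<in> majorized_set C"
proof -
  let ?Z = "u *\<^sub>R X + v *\<^sub>R Y"
  have M: "X \<in> M" "Y \<in> M" using X Y by (auto simp: majorized_set_iff)
  have comb: "u * a + v * b \<le> k" if "a \<le> k" "b \<le> k" for a b k
    using convex_bound_le[OF that u] .
  have "norm ?Z \<le> u * norm X + v * norm Y" using u norm_triangle_ineq[of "u *\<^sub>R X" "v *\<^sub>R Y"] by simp
  also have "\<dots> \<le> norm C" by (rule comb) (use X Y in \<open>auto simp: majorized_set_iff\<close>)
  finally have "norm ?Z \<le> norm C" .
  moreover have "symmetric_op ?Z"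
    using X Y by (simp add: majorized_set_iff symmetric_op_def blinfun.bilinear_simps inner_add_left inner_add_right)
  moreover have "re_tau ?Z = re_tau C"
  proof -
    have "re_tau ?Z = u * re_tau C + v * re_tau C" using X Y by (simp add: re_tau_simps M_intros majorized_set_iff)
    then show ?thesis using u by (simp add: distrib_right[symmetric])
  qed
  moreover have "re_tau (?Z o\<^sub>L P) - c * re_tau P \<le> excess C c" if "P \<in> effects" for c P
  proof -
    have P: "P \<in> M" using that by (simp add: effects_def)
    have "?Z o\<^sub>L P = u *\<^sub>R (X o\<^sub>L P) + v *\<^sub>R (Y o\<^sub>L P)"
      by (rule blinfun_eqI) (simp add: blinfun.bilinear_simps)
    then have "re_tau (?Z o\<^sub>L P) = u * re_tau (X o\<^sub>L P) + v * re_tau (Y o\<^sub>L P)" using M P by (simp add: re_tau_simps M_intros)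
    moreover have "c * re_tau P = u * (c * re_tau P) + v * (c * re_tau P)" using u by (simp add: distrib_right[symmetric])
    ultimately have "re_tau (?Z o\<^sub>L P) - c * re_tau P = u * (re_tau (X o\<^sub>L P) - c * re_tau P) + v * (re_tau (Y o\<^sub>L P) - c * re_tau P)"
      by (simp add: right_diff_distrib)
    also have "\<dots> \<le> excess C c" by (rule comb) (use X Y that in \<open>auto simp: majorized_set_iff\<close>)
    finally show ?thesis .
  qed
  ultimately show ?thesis using M by (simp add: majorized_set_iff M_intros)
qed

lemma majorized_set_compact:
  "compactin (subtopology weak_operator_topology {X \<in> M. norm X \<le> norm C}) (majorized_set C)"
proof -
  let ?B = "{X \<in> M. norm X \<le> norm C}"
  let ?Y = "subtopology weak_operator_topology ?B"
  define K1 where "K1 = (\<lambda>(x, y). {X \<in> topspace ?Y. cinner (blinfun_apply X x) y - cinner (blinfun_apply X y) x \<in> {z. Re z = 0}}) ` UNIV"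
  define K2 where "K2 = (\<lambda>(c, P). {X \<in> topspace ?Y. \<tau> (X o\<^sub>L P) \<in> {z. Re z \<le> excess C c + c * re_tau P}}) ` (UNIV \<times> effects)"
  define K3 where "K3 = {X \<in> topspace ?Y. \<tau> (X o\<^sub>L id_blinfun) \<in> {z. Re z = re_tau C}}"
  have idc: "X o\<^sub>L id_blinfun = X" for X :: "'h \<Rightarrow>\<^sub>L 'h" by (rule blinfun_eqI) simp
  have "compact_space ?Y" using compactin_M_ball[of "norm C"] by (simp add: compactin_subspace)
  moreover have "closedin ?Y (\<Inter> (insert K3 (K1 \<union> K2)))"
  proof (rule closedin_Inter)
    fix S assume "S \<in> insert K3 (K1 \<union> K2)"
    then consider "S = K3" | x y where "S = {X \<in> topspace ?Y. cinner (blinfun_apply X x) y - cinner (blinfun_apply X y) x \<in> {z. Re z = 0}}"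
      | c P where "P \<in> effects" "S = {X \<in> topspace ?Y. \<tau> (X o\<^sub>L P) \<in> {z. Re z \<le> excess C c + c * re_tau P}}"
      by (auto simp: K1_def K2_def)
    then show "closedin ?Y S"
    proof cases
      case 1
      show ?thesis unfolding 1 K3_def
        by (rule closedin_continuous_map_preimage[OF continuous_map_tau_comp[OF M_one]])
          (auto intro!: closed_Collect_eq continuous_intros)
    next
      case 2
      show ?thesis unfolding 2
        by (rule closedin_continuous_map_preimage[of _ euclidean])
          (auto intro!: closed_Collect_eq continuous_intros continuous_map_diff continuous_map_from_subtopology continuous_map_coefficient)
    next
      case 3
      then have "P \<in> M" by (simp add: effects_def)
      show ?thesis unfolding 3(2)
        by (rule closedin_continuous_map_preimage[OF continuous_map_tau_comp[OF \<open>P \<in> M\<close>]])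
          (auto intro!: closed_Collect_le continuous_intros)
    qed
  qed simp
  ultimately have "compactin ?Y (\<Inter> (insert K3 (K1 \<union> K2)))" by (rule closedin_compact_space)
  moreover have "\<Inter> (insert K3 (K1 \<union> K2)) = majorized_set C"
  proof -
    have "X \<in> \<Inter> (insert K3 (K1 \<union> K2)) \<longleftrightarrow> X \<in> majorized_set C" for X
    proof -
      have "X \<in> \<Inter> (insert K3 (K1 \<union> K2)) \<longleftrightarrow> X \<in> K3 \<and> X \<in> \<Inter> K1 \<and> X \<in> \<Inter> K2" by blast
      moreover have "X \<in> K3 \<longleftrightarrow> X \<in> ?B \<and> re_tau X = re_tau C" by (simp add: K3_def idc re_tau_def)
      moreover have "X \<in> \<Inter> K1 \<longleftrightarrow> X \<in> ?B \<and> symmetric_op X"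
        by (simp add: K1_def split_paired_all symmetric_op_def inner_eq_Re_cinner[symmetric] inner_commute)
      moreover have "X \<in> \<Inter> K2 \<longleftrightarrow> (\<forall>c. \<forall>P\<in>effects. X \<in> ?B \<and> re_tau (X o\<^sub>L P) - c * re_tau P \<le> excess C c)"
        by (simp add: K2_def split_paired_all re_tau_def diff_le_eq)
      ultimately show ?thesis
        unfolding majorized_set_iff by blast
    qed
    then show ?thesis by blast
  qed
  ultimately show ?thesis by simp
qed

lemma C_numerical_range_eq: "C_numerical_range M \<tau> C T = (\<lambda>X. \<tau> (T o\<^sub>L X)) ` majorized_set C"
  by (auto simp: C_numerical_range_def majorized_set_def)

lemma C_numerical_range_compact_convex:
  assumes T: "T \<in> M"
  shows "C_numerical_range M \<tau> C T \<in> compact_convex_sets"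
proof -
  let ?V = "(\<lambda>X. \<tau> (T o\<^sub>L X)) ` majorized_set C"
  have M: "X \<in> M" if "X \<in> majorized_set C" for X using that by (simp add: majorized_set_iff)
  have "?V = (\<lambda>X. \<tau> (X o\<^sub>L T)) ` majorized_set C"
    by (rule image_cong[OF refl]) (simp add: tau_comm[OF T M])
  moreover have "compactin euclidean ((\<lambda>X. \<tau> (X o\<^sub>L T)) ` majorized_set C)"
    by (rule image_compactin[OF majorized_set_compact continuous_map_tau_comp[OF T]])
  ultimately have "compact ?V" by simp
  moreover have "convex ?V"
  proof (rule convexI)
    fix z w and u v :: real assume "z \<in> ?V" "w \<in> ?V" and u: "0 \<le> u" "0 \<le> v" "u + v = 1"
    then obtain X Y where X: "X \<in> majorized_set C" "z = \<tau> (T o\<^sub>L X)" and Y: "Y \<in> majorized_set C" "w = \<tau> (T o\<^sub>L Y)"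
      by blast
    have "T o\<^sub>L (u *\<^sub>R X + v *\<^sub>R Y) = u *\<^sub>R (T o\<^sub>L X) + v *\<^sub>R (T o\<^sub>L Y)"
      by (rule blinfun_eqI) (simp add: blinfun.bilinear_simps)
    then have "\<tau> (T o\<^sub>L (u *\<^sub>R X + v *\<^sub>R Y)) = u *\<^sub>R z + v *\<^sub>R w"
      using X Y by (simp add: tau_add tau_scaleR M_intros T M scaleR_conv_of_real)
    then show "u *\<^sub>R z + v *\<^sub>R w \<in> ?V"
      using majorized_set_convex[OF X(1) Y(1) u] by (metis image_eqI)
  qed
  moreover have "?V \<noteq> {}" using majorized_set_self by blast
  ultimately show ?thesis by (simp add: compact_convex_sets_def C_numerical_range_eq)
qed

text \<open>
  The point \<open>\<tau>(T X)\<close> of one numerical range is compared with the point \<open>\<tau>(S X)\<close> of the other, for the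
  same \<open>X\<close>.
\<close>

lemma hausdorff_distance_C_numerical_range:
  assumes T: "T \<in> M" and S: "S \<in> M"
  shows "hausdorff_distance (C_numerical_range M \<tau> C T) (C_numerical_range M \<tau> C S) \<le> norm C * norm (T - S)"
proof -
  have near: "infdist z (C_numerical_range M \<tau> C S) \<le> norm C * norm (T - S)"
    if T: "T \<in> M" and S: "S \<in> M" and z: "z \<in> C_numerical_range M \<tau> C T" for T S z
  proof -
    obtain X where X: "X \<in> majorized_set C" "z = \<tau> (T o\<^sub>L X)" using z by (auto simp: C_numerical_range_eq)
    have XM: "X \<in> M" "norm X \<le> norm C" using X by (auto simp: majorized_set_iff)
    have "infdist z (C_numerical_range M \<tau> C S) \<le> dist z (\<tau> (S o\<^sub>L X))"
      by (rule infdist_le) (use X in \<open>auto simp: C_numerical_range_eq\<close>)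
    also have "\<dots> = cmod (\<tau> ((T - S) o\<^sub>L X))"
    proof -
      have "(T - S) o\<^sub>L X = (T o\<^sub>L X) - (S o\<^sub>L X)" by (rule blinfun_eqI) (simp add: blinfun.bilinear_simps)
      then show ?thesis using XM T S by (simp add: X dist_norm tau_diff M_comp)
    qed
    also have "\<dots> \<le> norm ((T - S) o\<^sub>L X)" by (intro cmod_tau_le M_intros T S XM)
    also have "\<dots> \<le> norm (T - S) * norm X" by (rule norm_blinfun_compose)
    also have "\<dots> \<le> norm C * norm (T - S)"
      using XM mult_left_mono[of "norm X" "norm C" "norm (T - S)"] by (simp add: mult.commute)
    finally show ?thesis .
  qed
  show ?thesis
  proof (rule hausdorff_distance_leI)
    show "infdist z (C_numerical_range M \<tau> C T) \<le> norm C * norm (T - S)"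
      if "z \<in> C_numerical_range M \<tau> C S" for z
      using near[OF S T that] by (simp add: norm_minus_commute)
  qed (use near[OF T S] majorized_set_self in \<open>auto simp: C_numerical_range_eq\<close>)
qed

end

end

section \<open>Lipschitz continuity of the C-numerical range\<close>

theorem proposition2p19:
  fixes M :: "('h::complex_hilbert_space \<Rightarrow>\<^sub>L 'h) set"
    and \<tau> :: "('h \<Rightarrow>\<^sub>L 'h) \<Rightarrow> complex"
    and C :: "'h \<Rightarrow>\<^sub>L 'h"
  assumes "tracial_von_neumann_algebra M \<tau>"
    and "C \<in> self_adjoint_part M"
  shows "(\<forall>T\<in>M. \<forall>S\<in>M.
      hausdorff_distance (C_numerical_range M \<tau> C T) (C_numerical_range M \<tau> C S)
        \<le> norm C * norm (T - S)) \<and>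
    continuous_map (top_of_set M) hausdorff_topology (C_numerical_range M \<tau> C)"
proof -
  interpret tracial_algebra M \<tau> by unfold_locales (rule assms(1))
  interpret H: Metric_space compact_convex_sets compact_convex_distance
    by (rule Metric_space_compact_convex)
  let ?V = "C_numerical_range M \<tau> C"
  have dist: "hausdorff_distance (?V T) (?V S) \<le> norm C * norm (T - S)" if "T \<in> M" "S \<in> M" for T S
    using hausdorff_distance_C_numerical_range[OF assms(2) that] .
  have cc: "?V T \<in> compact_convex_sets" if "T \<in> M" for T
    using C_numerical_range_compact_convex[OF assms(2) that] .
  have "continuous_map (top_of_set M) hausdorff_topology ?V"
    unfolding hausdorff_topology_def H.continuous_map_to_metric
  proof (intro ballI allI impI)
    fix T and e :: real assume "T \<in> topspace (top_of_set M)" and e: "e > 0"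
    then have T: "T \<in> M" by simp
    \<comment> \<open>the summand \<open>1\<close> covers \<open>C = 0\<close>\<close>
    define \<delta> where "\<delta> = e / (norm C + 1)"
    have nC: "norm C + 1 > 0" using norm_ge_zero[of C] by linarith
    then have \<delta>: "\<delta> > 0" using e by (simp add: \<delta>_def)
    have "?V S \<in> H.mball (?V T) e" if "S \<in> M \<inter> ball T \<delta>" for S
    proof -
      have S: "S \<in> M" "norm (T - S) < \<delta>" using that by (auto simp: dist_norm)
      have "compact_convex_distance (?V T) (?V S) \<le> norm C * norm (T - S)"
        using dist[OF T S(1)] cc[OF T] cc[OF S(1)] by (simp add: compact_convex_distance_def)
      also have "\<dots> \<le> (norm C + 1) * norm (T - S)" by (intro mult_right_mono) auto
      also have "\<dots> < (norm C + 1) * \<delta>" using S(2) nC by (rule mult_strict_left_mono)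
      also have "\<dots> = e" using nC by (simp add: \<delta>_def)
      finally show ?thesis using cc T S(1) by simp
    qed
    then show "\<exists>U. openin (top_of_set M) U \<and> T \<in> U \<and> (\<forall>S\<in>U. ?V S \<in> H.mball (?V T) e)"
      using T \<delta> by (intro exI[of _ "M \<inter> ball T \<delta>"]) (auto simp: openin_open_Int)
  qed
  then show ?thesis using dist by blast
qed

end
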